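(* Suppose the unital $C^*$-algebra $\mathcal{A}=C^*(x_1,\ldots,x_n)$ is matricially tracially stable and $\tau$ is an embeddable tracial state on $\mathcal{A}$ such that $1<\delta_0(x_1,\ldots,x_n;\tau)$. Then $$\limsup_{k\to\infty}\frac{\log \mathrm{Card}\left(\mathrm{Rep}(\mathcal{A},k)/\backsimeq\right)}{k^2}=\infty.$$
   Context: $\tau_k$ is the normalized trace on $\mathcal{M}_k(\mathbb{C})$. $\mathrm{Rep}(\mathcal{A},k)/\backsimeq$ is the set of all unital $*$-homomorphisms $\mathcal{A}\to\mathcal{M}_k(\mathbb{C})$ modulo unitary equivalence. If $\rho$ is a tracial state on a unital $C^*$-algebra, put $\|x\|_{2,\rho}=\rho(x^*x)^{1/2}$. An ultrafilter $\alpha$ on an infinite set $I$ is nontrivial if there is a sequence $\{E_n\}$ in $\alpha$ with $\bigcap_n E_n=\varnothing$. Given unital $C^*$-algebras $\mathcal{A}_i$ with tracial states $\rho_i$ ($i\in I$), the tracial ultraproduct $\prod_{i\in I}^{\alpha}(\mathcal{A}_i,\rho_i)$ is the $C^*$-product $\prod_{i\in I}\mathcal{A}_i$ (bounded families) modulo the ideal of all $\{a_i\}$ with $\lim_{i\to\alpha}\|a_i\|_{2,\rho_i}=0$; the coset of $\{a_i\}$ is denoted $\{a_i\}_\alpha$, and the limit trace is $\rho_\alpha(\{a_i\}_\alpha)=\lim_{i\to\alpha}\rho_i(a_i)$. A unital $*$-homomorphism $\pi:\mathcal{A}\to\prod_{i\in I}^{\alpha}(\mathcal{A}_i,\rho_i)$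 is approximately liftable if there are $E\in\alpha$ and, for every $i\in E$, a unital $*$-homomorphism $\pi_i:\mathcal{A}\to\mathcal{A}_i$ such that $\pi(a)=\{\pi_i(a)\}_\alpha$ for every $a\in\mathcal{A}$ (where $\pi_i(a)=0$ for $i\notin E$). A separable unital $\mathcal{A}$ is matricially tracially stable if every unital $*$-homomorphism from $\mathcal{A}$ into any tracial ultraproduct of full matrix algebras (over any nontrivial ultrafilter) is approximately liftable. A tracial state $\tau$ on a unital separable $C^*$-algebra $\mathcal{A}$ is embeddable if there are a nontrivial ultrafilter $\alpha$ on $\mathbb{N}$ and a unital $*$-homomorphism $\pi:\mathcal{A}\to\prod_{n\in\mathbb{N}}^{\alpha}(\mathcal{M}_n(\mathbb{C}),\tau_n)$ with $\tau_\alpha\circ\pi=\tau$, where $\tau_\alpha$ is the limit trace. $\delta_0(x_1,\ldots,x_n;\tau)$ is Voiculescu's (modified, microstates) free entropy dimension of the tuple with respect to $\tau$ (for non-self-adjoint tuples, that of the tuple of real and imaginary parts). It is given by the following covering formula. Fix $R>\max_j\|x_j\|$. For $\varepsilon>0$ and $N,k\in\mathbb{N}$ let $\Gamma_{R,\tau}(x_1,\ldots,x_n;N,k,\varepsilon)$ be the set of $n$-tuples $(A_1,\ldots,A_n)$ in $\mathcal{M}_k(\mathbb{C})$ with $\|A_j\|\le R$ for all $j$ and $|\tau(m(x_1,\ldots,x_n))-\tau_k(m(A_1,\ldots,A_n))|<\varepsilon$ for all $*$-monomials $m$ of degree at most $N$. Let $\|(A_1,\ldots,A_n)\|_2^2=\sum_j\tau_k(A_j^*A_j)$,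 and let $\nu_2(\mathcal{E},\omega)$ be the minimal number of $\|\cdot\|_2$-balls of radius $\omega$ needed to cover $\mathcal{E}\subset\mathcal{M}_k(\mathbb{C})^n$. Then $$\delta_0(x_1,\ldots,x_n;\tau)=\limsup_{\omega\to0^+}\ \inf_{\varepsilon,N}\ \limsup_{k\to\infty}\frac{\log\nu_2(\Gamma_{R,\tau}(x_1,\ldots,x_n;N,k,\varepsilon),\omega)}{k^2|\log\omega|}.$$ *)

theory Defs
  imports
    "HOL-Analysis.Abstract_Metric_Spaces"
    "HOL-Analysis.L2_Norm"
    "HOL-Library.Extended_Real"
    "HOL-Library.Liminf_Limsup"
    "HOL-Library.Infinite_Typeclass"
    "HOL-Algebra.QuotRing"
    "HOL-Algebra.Subrings"
    "Jordan_Normal_Form.Schur_Decomposition"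
begin

section \<open>Unital C*-algebras\<close>

text \<open>
  Algebras are records with an explicit carrier, so that an abstract algebra, the matrix algebras of
  all sizes and the quotients defining ultraproducts are structures of the same kind.
\<close>

record 'a calg = "(complex, 'a) module" +
  star :: "'a \<Rightarrow> 'a"
  cnorm :: "'a \<Rightarrow> real"

text \<open>The value outside the carrier is a dummy: \<^locale>\<open>Metric_space\<close> wants a metric that is
  nonnegative and symmetric on the whole type.\<close>

definition cdist :: "'a calg \<Rightarrow> 'a \<Rightarrow> 'a \<Rightarrow> real" where
  "cdist A x y =
     (if x \<in> carrier A \<and> y \<in> carrier A then cnorm A (x \<ominus>\<^bsub>A\<^esub> y) else 0)"

locale unital_cstar_algebra =
  ring A + scalar: module "class_ring :: complex ring" A for A :: "'a calg" (structure) +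
  assumes smult_mult_left:
      "\<lbrakk>x \<in> carrier A; y \<in> carrier A\<rbrakk> \<Longrightarrow> (c \<odot> x) \<otimes> y = c \<odot> (x \<otimes> y)"
    and smult_mult_right:
      "\<lbrakk>x \<in> carrier A; y \<in> carrier A\<rbrakk> \<Longrightarrow> x \<otimes> (c \<odot> y) = c \<odot> (x \<otimes> y)"
    and star_closed: "x \<in> carrier A \<Longrightarrow> star A x \<in> carrier A"
    and star_star: "x \<in> carrier A \<Longrightarrow> star A (star A x) = x"
    and star_add:
      "\<lbrakk>x \<in> carrier A; y \<in> carrier A\<rbrakk> \<Longrightarrow> star A (x \<oplus> y) = star A x \<oplus> star A y"
    and star_smult: "x \<in> carrier A \<Longrightarrow> star A (c \<odot> x) = cnj c \<odot> star A x"
    and star_mult: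
      "\<lbrakk>x \<in> carrier A; y \<in> carrier A\<rbrakk> \<Longrightarrow> star A (x \<otimes> y) = star A y \<otimes> star A x"
    and cnorm_nonneg: "x \<in> carrier A \<Longrightarrow> 0 \<le> cnorm A x"
    and cnorm_eq_0: "x \<in> carrier A \<Longrightarrow> cnorm A x = 0 \<longleftrightarrow> x = \<zero>"
    and cnorm_triangle:
      "\<lbrakk>x \<in> carrier A; y \<in> carrier A\<rbrakk> \<Longrightarrow> cnorm A (x \<oplus> y) \<le> cnorm A x + cnorm A y"
    and cnorm_smult: "x \<in> carrier A \<Longrightarrow> cnorm A (c \<odot> x) = cmod c * cnorm A x"
    and cnorm_mult:
      "\<lbrakk>x \<in> carrier A; y \<in> carrier A\<rbrakk> \<Longrightarrow> cnorm A (x \<otimes> y) \<le> cnorm A x * cnorm A y"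
    and cstar_identity: "x \<in> carrier A \<Longrightarrow> cnorm A (star A x \<otimes> x) = (cnorm A x)\<^sup>2"
    and complete: "Metric_space.mcomplete (carrier A) (cdist A)"

lemma (in unital_cstar_algebra) Metric_space_cdist: "Metric_space (carrier A) (cdist A)"
proof
  have neg: "cnorm A (\<ominus> x) = cnorm A x" if x: "x \<in> carrier A" for x
  proof -
    have "((1::complex) + -1) \<odot> x = 1 \<odot> x \<oplus> (-1) \<odot> x"
      using scalar.smult_l_distr[of 1 "-1" x] x by simp
    hence "(-1) \<odot> x \<oplus> x = \<zero>"
      using x scalar.smult_l_null[OF x] scalar.smult_one[OF x] scalar.smult_closed[of "-1" x] a_comm[of x "(-1) \<odot> x"] by simp
    hence "\<ominus> x = (-1) \<odot> x" using x scalar.smult_closed[of "-1" x] by (simp add: minus_equality)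
    thus ?thesis using cnorm_smult[OF x, of "-1"] by simp
  qed
  fix x y z
  show "0 \<le> cdist A x y" by (simp add: cdist_def cnorm_nonneg)
  show "cdist A x y = cdist A y x"
  proof (cases "x \<in> carrier A \<and> y \<in> carrier A")
    case True
    hence "y \<ominus> x = \<ominus> (x \<ominus> y)" by (simp add: a_minus_def minus_add a_comm minus_minus)
    thus ?thesis using True neg[of "x \<ominus> y"] by (simp add: cdist_def)
  qed (auto simp: cdist_def)
  assume xy: "x \<in> carrier A" "y \<in> carrier A"
  show "cdist A x y = 0 \<longleftrightarrow> x = y" using xy by (simp add: cdist_def cnorm_eq_0)
  assume z: "z \<in> carrier A"
  have "x \<ominus> z = (x \<ominus> y) \<oplus> (y \<ominus> z)" using xy z
    by (simp add: a_minus_def a_assoc) (metis a_assoc a_inv_closed l_neg l_zero)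
  thus "cdist A x z \<le> cdist A x y + cdist A y z"
    using xy z by (simp add: cdist_def cnorm_triangle)
qed

definition unital_cstar_subalgebra :: "'a set \<Rightarrow> 'a calg \<Rightarrow> bool" where
  "unital_cstar_subalgebra B A \<longleftrightarrow>
     subring B A \<and> (\<forall>c. \<forall>x\<in>B. c \<odot>\<^bsub>A\<^esub> x \<in> B) \<and> (\<forall>x\<in>B. star A x \<in> B) \<and>
     closedin (Metric_space.mtopology (carrier A) (cdist A)) B"

definition cstar_generated :: "'a calg \<Rightarrow> 'a set \<Rightarrow> 'a set" where
  "cstar_generated A S = \<Inter>{B. unital_cstar_subalgebra B A \<and> S \<subseteq> B}"

definition unital_star_hom :: "'a calg \<Rightarrow> 'b calg \<Rightarrow> ('a \<Rightarrow> 'b) set" where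
  "unital_star_hom A B =
     {\<pi> \<in> Ring.ring_hom A B.
        (\<forall>c. \<forall>x\<in>carrier A. \<pi> (c \<odot>\<^bsub>A\<^esub> x) = c \<odot>\<^bsub>B\<^esub> \<pi> x) \<and>
        (\<forall>x\<in>carrier A. \<pi> (star A x) = star B (\<pi> x))}"

definition tracial_state :: "'a calg \<Rightarrow> ('a \<Rightarrow> complex) \<Rightarrow> bool" where
  "tracial_state A \<rho> \<longleftrightarrow>
     (\<forall>x\<in>carrier A. \<forall>y\<in>carrier A. \<rho> (x \<oplus>\<^bsub>A\<^esub> y) = \<rho> x + \<rho> y) \<and>
     (\<forall>c. \<forall>x\<in>carrier A. \<rho> (c \<odot>\<^bsub>A\<^esub> x) = c * \<rho> x) \<and>
     (\<forall>x\<in>carrier A. Im (\<rho> (star A x \<otimes>\<^bsub>A\<^esub> x)) = 0 \<and> 0 \<le> Re (\<rho> (star A x \<otimes>\<^bsub>A\<^esub> x))) \<and>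
     \<rho> \<one>\<^bsub>A\<^esub> = 1 \<and>
     (\<forall>x\<in>carrier A. \<forall>y\<in>carrier A. \<rho> (x \<otimes>\<^bsub>A\<^esub> y) = \<rho> (y \<otimes>\<^bsub>A\<^esub> x))"

definition norm2 :: "'a calg \<Rightarrow> ('a \<Rightarrow> complex) \<Rightarrow> 'a \<Rightarrow> real" where
  "norm2 A \<rho> x = sqrt (Re (\<rho> (star A x \<otimes>\<^bsub>A\<^esub> x)))"


section \<open>Matrix algebras\<close>

definition vec_norm2 :: "complex vec \<Rightarrow> real" where
  "vec_norm2 v = L2_set (\<lambda>i. cmod (vec_index v i)) {..<dim_vec v}"

definition op_norm :: "complex mat \<Rightarrow> real" where
  "op_norm X =
     (SUP v \<in> {v \<in> carrier_vec (dim_col X). vec_norm2 v \<le> 1}. vec_norm2 (X *\<^sub>v v))"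

definition mat_calg :: "nat \<Rightarrow> complex mat calg" where
  "mat_calg k =
     \<lparr>carrier = carrier_mat k k, monoid.mult = (*), one = 1\<^sub>m k, zero = 0\<^sub>m k k, add = (+),
      module.smult = (\<cdot>\<^sub>m), star = mat_adjoint, cnorm = op_norm\<rparr>"

definition ntrace :: "nat \<Rightarrow> complex mat \<Rightarrow> complex" where
  "ntrace k X = (\<Sum>i<k. X $$ (i, i)) / of_nat k"


section \<open>Tracial ultraproducts\<close>

text \<open>An ultrafilter on a set \<open>I\<close> is encoded as a filter on the ambient type that contains \<open>I\<close>,
  so that limits along it are the library's.\<close>

definition ultrafilter_on :: "'i set \<Rightarrow> 'i filter \<Rightarrow> bool" where
  "ultrafilter_on I \<alpha> \<longleftrightarrow>
     \<alpha> \<noteq> bot \<and> eventually (\<lambda>i. i \<in> I) \<alpha> \<and>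
     (\<forall>P. eventually P \<alpha> \<or> eventually (\<lambda>i. \<not> P i) \<alpha>)"

definition nontrivial_ultrafilter :: "'i set \<Rightarrow> 'i filter \<Rightarrow> bool" where
  "nontrivial_ultrafilter I \<alpha> \<longleftrightarrow>
     infinite I \<and> ultrafilter_on I \<alpha> \<and>
     (\<exists>E :: nat \<Rightarrow> 'i set. (\<forall>n. eventually (\<lambda>i. i \<in> E n) \<alpha>) \<and> (\<Inter>n. E n) = {})"

definition cstar_product :: "'i set \<Rightarrow> ('i \<Rightarrow> 'a calg) \<Rightarrow> ('i \<Rightarrow> 'a) calg" where
  "cstar_product I A =
     \<lparr>carrier = {a \<in> \<Pi>\<^sub>E i\<in>I. carrier (A i). \<exists>C. \<forall>i\<in>I. cnorm (A i) (a i) \<le> C},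
      monoid.mult = (\<lambda>a b. \<lambda>i\<in>I. a i \<otimes>\<^bsub>A i\<^esub> b i),
      one = (\<lambda>i\<in>I. \<one>\<^bsub>A i\<^esub>),
      zero = (\<lambda>i\<in>I. \<zero>\<^bsub>A i\<^esub>),
      add = (\<lambda>a b. \<lambda>i\<in>I. a i \<oplus>\<^bsub>A i\<^esub> b i),
      module.smult = (\<lambda>c a. \<lambda>i\<in>I. c \<odot>\<^bsub>A i\<^esub> a i),
      star = (\<lambda>a. \<lambda>i\<in>I. star (A i) (a i)),
      cnorm = (\<lambda>a. SUP i\<in>I. cnorm (A i) (a i))\<rparr>"

definition trace_null_ideal ::
  "'i set \<Rightarrow> 'i filter \<Rightarrow> ('i \<Rightarrow> 'a calg) \<Rightarrow> ('i \<Rightarrow> 'a \<Rightarrow> complex) \<Rightarrow> ('i \<Rightarrow> 'a) set" where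
  "trace_null_ideal I \<alpha> A \<rho> =
     {a \<in> carrier (cstar_product I A). ((\<lambda>i. norm2 (A i) (\<rho> i) (a i)) \<longlongrightarrow> 0) \<alpha>}"

definition ultra_coset ::
  "'i set \<Rightarrow> 'i filter \<Rightarrow> ('i \<Rightarrow> 'a calg) \<Rightarrow> ('i \<Rightarrow> 'a \<Rightarrow> complex) \<Rightarrow> ('i \<Rightarrow> 'a) \<Rightarrow> ('i \<Rightarrow> 'a) set"
where
  "ultra_coset I \<alpha> A \<rho> a = trace_null_ideal I \<alpha> A \<rho> +>\<^bsub>cstar_product I A\<^esub> a"

text \<open>The ring part is \<^const>\<open>FactRing\<close>; scalar multiplication follows the pattern of
  \<^const>\<open>rcoset_mult\<close>, and the norm is the quotient norm.\<close>

definition tracial_ultraproduct ::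
  "'i set \<Rightarrow> 'i filter \<Rightarrow> ('i \<Rightarrow> 'a calg) \<Rightarrow> ('i \<Rightarrow> 'a \<Rightarrow> complex) \<Rightarrow> ('i \<Rightarrow> 'a) set calg" where
  "tracial_ultraproduct I \<alpha> A \<rho> =
     (let P = cstar_product I A; J = trace_null_ideal I \<alpha> A \<rho>; Q = P Quot J in
      \<lparr>carrier = carrier Q, monoid.mult = monoid.mult Q, one = one Q, zero = zero Q, add = add Q,
       module.smult = (\<lambda>c X. \<Union>a\<in>X. J +>\<^bsub>P\<^esub> (c \<odot>\<^bsub>P\<^esub> a)),
       star = (\<lambda>X. \<Union>a\<in>X. J +>\<^bsub>P\<^esub> star P a),
       cnorm = (\<lambda>X. INF a\<in>X. cnorm P a)\<rparr>)"

definition limit_trace :: "'i filter \<Rightarrow> ('i \<Rightarrow> 'a \<Rightarrow> complex) \<Rightarrow> ('i \<Rightarrow> 'a) set \<Rightarrow> complex" where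
  "limit_trace \<alpha> \<rho> X = (THE z. \<forall>a\<in>X. ((\<lambda>i. \<rho> i (a i)) \<longlongrightarrow> z) \<alpha>)"

definition approximately_liftable ::
  "'a calg \<Rightarrow> 'i set \<Rightarrow> 'i filter \<Rightarrow> ('i \<Rightarrow> 'b calg) \<Rightarrow> ('i \<Rightarrow> 'b \<Rightarrow> complex) \<Rightarrow>
   ('a \<Rightarrow> ('i \<Rightarrow> 'b) set) \<Rightarrow> bool" where
  "approximately_liftable A I \<alpha> B \<rho> \<pi> \<longleftrightarrow>
     (\<exists>E \<phi>. E \<subseteq> I \<and> eventually (\<lambda>i. i \<in> E) \<alpha> \<and>
        (\<forall>i\<in>E. \<phi> i \<in> unital_star_hom A (B i)) \<and>
        (\<forall>a\<in>carrier A.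
           \<pi> a = ultra_coset I \<alpha> B \<rho> (\<lambda>i\<in>I. if i \<in> E then \<phi> i a else \<zero>\<^bsub>B i\<^esub>)))"

text \<open>HOL cannot quantify over all index sets inside a formula; here they range over all infinite
  subsets of an infinite type \<open>'i\<close>, which is an explicit argument. The notion is meant for
  separable algebras, in particular for finitely generated ones.\<close>

definition matricially_tracially_stable :: "'i::infinite itself \<Rightarrow> 'a calg \<Rightarrow> bool" where
  "matricially_tracially_stable TYPE('i) A \<longleftrightarrow>
     (\<forall>(I :: 'i set) \<alpha> (k :: 'i \<Rightarrow> nat) \<rho>.
        nontrivial_ultrafilter I \<alpha> \<longrightarrow>
        (\<forall>i\<in>I. 0 < k i \<and> tracial_state (mat_calg (k i)) (\<rho> i)) \<longrightarrow>
        (\<forall>\<pi> \<in> unital_star_hom A (tracial_ultraproduct I \<alpha> (\<lambda>i. mat_calg (k i)) \<rho>).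
           approximately_liftable A I \<alpha> (\<lambda>i. mat_calg (k i)) \<rho> \<pi>))"

text \<open>The natural numbers start at 1 here, since there is no tracial state on 0-by-0 matrices.\<close>

definition embeddable :: "'a calg \<Rightarrow> ('a \<Rightarrow> complex) \<Rightarrow> bool" where
  "embeddable A \<tau> \<longleftrightarrow>
     (\<exists>\<alpha>. nontrivial_ultrafilter {1::nat..} \<alpha> \<and>
        (\<exists>\<pi> \<in> unital_star_hom A (tracial_ultraproduct {1..} \<alpha> mat_calg ntrace).
           \<forall>a\<in>carrier A. limit_trace \<alpha> ntrace (\<pi> a) = \<tau> a))"


section \<open>Free entropy dimension\<close>

definition ecard :: "'b set \<Rightarrow> enat" where
  "ecard S = (if finite S then enat (card S) else \<infinity>)"

text \<open>Natural logarithm of a cardinality, with \<open>log 0 = -\<infinity>\<close> and \<open>log \<infinity> = \<infinity>\<close>.\<close>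

definition elog :: "enat \<Rightarrow> ereal" where
  "elog m = (case m of enat n \<Rightarrow> if n = 0 then -\<infinity> else ereal (ln (real n)) | \<infinity> \<Rightarrow> \<infinity>)"

text \<open>A *-monomial is a word; the letter \<open>(j, s)\<close> stands for the \<open>j\<close>-th variable, with a star iff
  \<open>s\<close> holds.\<close>

definition letter_val :: "'a calg \<Rightarrow> 'a list \<Rightarrow> nat \<times> bool \<Rightarrow> 'a" where
  "letter_val A xs l = (if snd l then star A (xs ! fst l) else xs ! fst l)"

definition monomial_val :: "'a calg \<Rightarrow> 'a list \<Rightarrow> (nat \<times> bool) list \<Rightarrow> 'a" where
  "monomial_val A xs w = foldr (\<lambda>l y. letter_val A xs l \<otimes>\<^bsub>A\<^esub> y) w \<one>\<^bsub>A\<^esub>"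

definition star_monomials :: "nat \<Rightarrow> nat \<Rightarrow> (nat \<times> bool) list set" where
  "star_monomials n N = {w. set w \<subseteq> {..<n} \<times> UNIV \<and> length w \<le> N}"

definition mat_tuples :: "nat \<Rightarrow> nat \<Rightarrow> complex mat list set" where
  "mat_tuples n k = {Xs. length Xs = n \<and> set Xs \<subseteq> carrier_mat k k}"

definition microstates ::
  "'a calg \<Rightarrow> ('a \<Rightarrow> complex) \<Rightarrow> real \<Rightarrow> 'a list \<Rightarrow> nat \<Rightarrow> nat \<Rightarrow> real \<Rightarrow> complex mat list set" where
  "microstates A \<tau> R xs N k \<epsilon> =
     {Xs \<in> mat_tuples (length xs) k.
        (\<forall>X\<in>set Xs. op_norm X \<le> R) \<and>
        (\<forall>w\<in>star_monomials (length xs) N.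
           cmod (\<tau> (monomial_val A xs w) - ntrace k (monomial_val (mat_calg k) Xs w)) < \<epsilon>)}"

definition tuple_norm2 :: "nat \<Rightarrow> complex mat list \<Rightarrow> real" where
  "tuple_norm2 k Xs = sqrt (\<Sum>X\<leftarrow>Xs. Re (ntrace k (mat_adjoint X * X)))"

definition tuple_ball :: "nat \<Rightarrow> nat \<Rightarrow> complex mat list \<Rightarrow> real \<Rightarrow> complex mat list set" where
  "tuple_ball n k Ys \<omega> = {Xs \<in> mat_tuples n k. tuple_norm2 k (map2 (-) Xs Ys) < \<omega>}"

definition covering_number :: "nat \<Rightarrow> nat \<Rightarrow> complex mat list set \<Rightarrow> real \<Rightarrow> enat" where
  "covering_number n k S \<omega> =
     (INF C \<in> {C. C \<subseteq> mat_tuples n k \<and> S \<subseteq> (\<Union>Ys\<in>C. tuple_ball n k Ys \<omega>)}. ecard C)"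

text \<open>The cut-off \<open>R\<close> is a parameter; the definition is meant for \<open>R\<close> larger than the norms of
  the generators.\<close>

definition free_entropy_dim :: "'a calg \<Rightarrow> ('a \<Rightarrow> complex) \<Rightarrow> real \<Rightarrow> 'a list \<Rightarrow> ereal" where
  "free_entropy_dim A \<tau> R xs =
     Limsup (at_right 0) (\<lambda>\<omega>.
       INF (\<epsilon>, N) \<in> {0<..} \<times> UNIV.
         limsup (\<lambda>k. elog (covering_number (length xs) k (microstates A \<tau> R xs N k \<epsilon>) \<omega>)
                       / ereal ((real k)\<^sup>2 * \<bar>ln \<omega>\<bar>)))"


section \<open>Finite-dimensional representations\<close>

text \<open>Homomorphisms are made extensional, so that distinct elements of this set differ on the
  carrier.\<close>

definition reps :: "'a calg \<Rightarrow> nat \<Rightarrow> ('a \<Rightarrow> complex mat) set" where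
  "reps A k = unital_star_hom A (mat_calg k) \<inter> extensional (carrier A)"

definition unitary_mats :: "nat \<Rightarrow> complex mat set" where
  "unitary_mats k =
     {U \<in> carrier_mat k k. mat_adjoint U * U = 1\<^sub>m k \<and> U * mat_adjoint U = 1\<^sub>m k}"

definition unitary_equiv ::
  "'a calg \<Rightarrow> nat \<Rightarrow> (('a \<Rightarrow> complex mat) \<times> ('a \<Rightarrow> complex mat)) set" where
  "unitary_equiv A k =
     {(\<pi>, \<sigma>). \<pi> \<in> reps A k \<and> \<sigma> \<in> reps A k \<and>
        (\<exists>U\<in>unitary_mats k. \<forall>a\<in>carrier A. \<sigma> a = U * \<pi> a * mat_adjoint U)}"

end

theory Submission
  imports Defs
begin

text \<open>Suppose that, for some \<open>M\<close> and all large \<open>k\<close>, there are at most \<open>exp (M k^2)\<close> unitary equivalence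
classes of \<open>k\<close>-dimensional representations. Two facts then force the free entropy dimension to be at
most 1.

First, by stability every good microstate is \<open>\<omega>\<close>-close in the normalized Hilbert-Schmidt norm to the
tuple \<open>(\<phi> x_1, ..., \<phi> x_n)\<close> of some representation \<open>\<phi>\<close> (\<open>microstates_near_reps\<close>). Second, the tuples
of one equivalence class form an orbit of the unitary group \<open>U(k)\<close>, and \<open>U(k)\<close> is covered by
\<open>(c / \<omega>)^(k^2)\<close> Hilbert-Schmidt balls of radius \<open>\<omega>\<close> (\<open>unitary_cover\<close>); the exponent is the real dimension
of \<open>U(k)\<close>, and this is where the threshold 1 comes from. Representations are contractive
(\<open>rep_contractive\<close>), so a cover of \<open>U(k)\<close> gives covers of the orbits. Altogether the microstates are
covered by \<open>exp (M k^2) (C / \<omega>)^(k^2)\<close> balls (\<open>covering_by_orbits\<close>); the logarithm divided by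
\<open>k^2 |ln \<omega>|\<close> is \<open>(M + ln (C / \<omega>)) / |ln \<omega>|\<close>, which tends to 1 as \<open>\<omega>\<close> tends to 0.

For the first fact, assume there are better and better microstates that stay away from all
representations. Take an ultrafilter along which their moments converge to those of \<open>\<tau>\<close>. Evaluating
*-polynomials at the microstates should define a *-homomorphism from the algebra into the tracial
ultraproduct; lifting it by stability gives representations near the microstates, a
contradiction. To see that the homomorphism extends from *-polynomials to the whole algebra, let \<open>p\<close> be a
*-polynomial. The Hilbert-Schmidt norms of \<open>p\<close> at the microstates converge to the 2-norm of \<open>p(x)\<close> with
respect to \<open>\<tau>\<close>, which is at most the norm of \<open>p(x)\<close> because positive functionals are bounded
(\<open>positive_functional_bound\<close>, which rests on square roots of \<open>1 - h\<close>). Their operator norms are a different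
matter: they need not be bounded in terms of the norm of \<open>p(x)\<close>. However, all moments of \<open>p* p\<close> converge, so for
every \<open>M\<close> above the norm of \<open>p(x)\<close> the singular values that exceed \<open>M\<close> carry asymptotically no trace and can be cut off
(\<open>truncate_mat\<close>, \<open>truncate_pol\<close>). A diagonal choice, possible since the ultrafilter is countably
incomplete, then yields a bounded family for every element of the algebra (\<open>approximates_exists\<close>).

For the second fact, every unitary matrix is \<open>((1 + iH) / (1 - iH))^2\<close> with \<open>H\<close> Hermitian of norm at most 1
(\<open>unitary_param_surj\<close>), this parametrization is Lipschitz with constant 4 (\<open>unitary_param_Lipschitz\<close>), and in the
\<open>k^2\<close> real coordinates of \<open>H\<close> one rounds to a lattice and counts lattice points
(\<open>card_lattice_l1_ball\<close>).\<close>

(* The dollar sign denotes the entries of vectors of type complex vec. *)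
unbundle no vec_syntax


section \<open>Adjoint, operator norm and Hilbert-Schmidt norm of matrices\<close>

lemma dim_mat_adjoint [simp]:
  "dim_row (mat_adjoint A) = dim_col A" "dim_col (mat_adjoint A) = dim_row A"
  by (simp_all add: mat_adjoint_def)

lemma mat_adjoint_closed [simp, intro]: "A \<in> carrier_mat n m \<Longrightarrow> mat_adjoint A \<in> carrier_mat m n"
  by auto

lemma index_mat_adjoint [simp]:
  "i < dim_col A \<Longrightarrow> j < dim_row A \<Longrightarrow> mat_adjoint A $$ (i, j) = conjugate (A $$ (j, i))"
  by (simp add: mat_adjoint_def mat_of_rows_index)

lemma mat_adjoint_adjoint [simp]: "mat_adjoint (mat_adjoint A) = A"
  by (rule eq_matI) auto

lemma mat_adjoint_one [simp]: "mat_adjoint (1\<^sub>m n :: complex mat) = 1\<^sub>m n"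
  by (rule eq_matI) auto

lemma mat_adjoint_zero [simp]: "mat_adjoint (0\<^sub>m n m :: complex mat) = 0\<^sub>m m n"
  by (rule eq_matI) auto

lemma mat_adjoint_add:
  "A \<in> carrier_mat n m \<Longrightarrow> B \<in> carrier_mat n m \<Longrightarrow>
   mat_adjoint (A + B :: complex mat) = mat_adjoint A + mat_adjoint B"
  by (rule eq_matI) auto

lemma mat_adjoint_minus:
  "A \<in> carrier_mat n m \<Longrightarrow> B \<in> carrier_mat n m \<Longrightarrow>
   mat_adjoint (A - B :: complex mat) = mat_adjoint A - mat_adjoint B"
  by (rule eq_matI) auto

lemma mat_adjoint_smult: "mat_adjoint (c \<cdot>\<^sub>m A :: complex mat) = cnj c \<cdot>\<^sub>m mat_adjoint A"
  by (rule eq_matI) auto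

lemma mat_adjoint_mult:
  assumes "A \<in> carrier_mat n m" "B \<in> carrier_mat m l"
  shows "mat_adjoint (A * B :: complex mat) = mat_adjoint B * mat_adjoint A"
  by (rule eq_matI, insert assms) (auto simp: scalar_prod_def mult.commute intro!: sum.cong)

lemma square_mult_closed [intro]:
  "A \<in> carrier_mat k k \<Longrightarrow> B \<in> carrier_mat k k \<Longrightarrow> A * B \<in> carrier_mat k k"
  by auto

lemma mat_adjoint_diag: "mat_adjoint (mat_diag n d :: complex mat) = mat_diag n (\<lambda>i. cnj (d i))"
  by (rule eq_matI) (auto simp: mat_diag_def)

lemma vec_norm2_nonneg [simp]: "0 \<le> vec_norm2 v"
  by (simp add: vec_norm2_def)

lemma vec_norm2_sq: "(vec_norm2 v)\<^sup>2 = (\<Sum>i<dim_vec v. (cmod (v $ i))\<^sup>2)"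
  by (simp add: vec_norm2_def L2_set_def sum_nonneg)

lemma vec_norm2_sq_sprod: "complex_of_real ((vec_norm2 v)\<^sup>2) = v \<bullet>c v"
  by (simp add: vec_norm2_sq scalar_prod_def complex_norm_square atLeast0LessThan del: of_real_power)

lemma vec_norm2_zero [simp]: "vec_norm2 (0\<^sub>v n) = 0"
  by (simp add: vec_norm2_def L2_set_def)

lemma vec_norm2_eq_0_iff: "vec_norm2 v = 0 \<longleftrightarrow> v = 0\<^sub>v (dim_vec v)"
proof
  assume "vec_norm2 v = 0"
  thus "v = 0\<^sub>v (dim_vec v)"
    by (intro eq_vecI) (auto simp: vec_norm2_def L2_set_eq_0_iff)
next
  assume "v = 0\<^sub>v (dim_vec v)"
  thus "vec_norm2 v = 0" by (metis vec_norm2_zero)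
qed

lemma vec_norm2_smult: "vec_norm2 (c \<cdot>\<^sub>v v) = cmod c * vec_norm2 v"
  by (auto simp: vec_norm2_def norm_mult L2_set_right_distrib intro!: L2_set_cong)

lemma vec_norm2_add:
  assumes "dim_vec v = dim_vec w"
  shows "vec_norm2 (v + w) \<le> vec_norm2 v + vec_norm2 w"
proof -
  have "vec_norm2 (v + w) \<le> L2_set (\<lambda>i. cmod (v $ i) + cmod (w $ i)) {..<dim_vec w}"
    unfolding vec_norm2_def by (auto intro!: L2_set_mono norm_triangle_ineq)
  also have "\<dots> \<le> vec_norm2 v + vec_norm2 w"
    unfolding vec_norm2_def assms by (rule L2_set_triangle_ineq)
  finally show ?thesis .
qed

lemma sprod_Cauchy_Schwarz:
  assumes "dim_vec v = dim_vec w"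
  shows "cmod (v \<bullet> w) \<le> vec_norm2 v * vec_norm2 w"
proof -
  have "cmod (v \<bullet> w) \<le> (\<Sum>i<dim_vec w. \<bar>cmod (v $ i)\<bar> * \<bar>cmod (w $ i)\<bar>)"
    unfolding scalar_prod_def
    by (rule order_trans[OF norm_sum]) (simp add: norm_mult atLeast0LessThan)
  also have "\<dots> \<le> vec_norm2 v * vec_norm2 w"
    unfolding vec_norm2_def assms by (rule L2_set_mult_ineq)
  finally show ?thesis .
qed

lemma vec_norm2_conjugate [simp]: "vec_norm2 (conjugate v) = vec_norm2 v"
  by (auto simp: vec_norm2_def intro!: L2_set_cong)

lemma sprod_adjoint:
  assumes "A \<in> carrier_mat n m" "v \<in> carrier_vec m" "w \<in> carrier_vec n"
  shows "(A *\<^sub>v v :: complex vec) \<bullet>c w = v \<bullet>c (mat_adjoint A *\<^sub>v w)"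
proof -
  have "(A *\<^sub>v v) \<bullet>c w = (\<Sum>i<n. \<Sum>j<m. A $$ (i,j) * v $ j * cnj (w $ i))"
    using assms by (auto simp: scalar_prod_def sum_distrib_right atLeast0LessThan intro!: sum.cong)
  also have "\<dots> = (\<Sum>j<m. \<Sum>i<n. A $$ (i,j) * v $ j * cnj (w $ i))"
    by (rule sum.swap)
  also have "\<dots> = v \<bullet>c (mat_adjoint A *\<^sub>v w)"
    using assms by (auto simp: scalar_prod_def sum_distrib_left atLeast0LessThan cnj_sum intro!: sum.cong)
  finally show ?thesis .
qed

lemma vec_norm2_mult_le_entries:
  assumes "dim_vec v = dim_col X"
  shows "vec_norm2 (X *\<^sub>v v) \<le> L2_set (\<lambda>i. vec_norm2 (row X i)) {..<dim_row X} * vec_norm2 v"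
proof -
  have "vec_norm2 (X *\<^sub>v v) \<le> L2_set (\<lambda>i. vec_norm2 (row X i) * vec_norm2 v) {..<dim_row X}"
    unfolding vec_norm2_def[of "X *\<^sub>v v"]
    using assms by (auto intro!: L2_set_mono sprod_Cauchy_Schwarz)
  thus ?thesis by (simp add: L2_set_left_distrib)
qed

lemma op_norm_bdd:
  "bdd_above ((\<lambda>v. vec_norm2 (X *\<^sub>v v)) ` {v \<in> carrier_vec (dim_col X). vec_norm2 v \<le> 1})"
proof (rule bdd_aboveI2)
  fix v assume "v \<in> {v \<in> carrier_vec (dim_col X). vec_norm2 v \<le> 1}"
  then show "vec_norm2 (X *\<^sub>v v) \<le> L2_set (\<lambda>i. vec_norm2 (row X i)) {..<dim_row X} * 1"
    by (intro order_trans[OF vec_norm2_mult_le_entries] mult_left_mono) auto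
qed

lemma op_norm_nonneg [simp]: "0 \<le> op_norm X"
  unfolding op_norm_def
  by (rule cSUP_upper2[OF op_norm_bdd, of "0\<^sub>v (dim_col X)"]) auto

lemma vec_norm2_mult_le:
  assumes "v \<in> carrier_vec (dim_col X)"
  shows "vec_norm2 (X *\<^sub>v v) \<le> op_norm X * vec_norm2 v"
proof (cases "vec_norm2 v = 0")
  case True
  hence "v = 0\<^sub>v (dim_col X)" using assms by (simp add: vec_norm2_eq_0_iff)
  hence "X *\<^sub>v v = 0\<^sub>v (dim_row X)" by (auto intro!: eq_vecI)
  thus ?thesis using True by simp
next
  case False
  hence pos: "0 < vec_norm2 v" using vec_norm2_nonneg[of v] by linarith
  define u where "u = complex_of_real (1 / vec_norm2 v) \<cdot>\<^sub>v v"
  have u: "u \<in> carrier_vec (dim_col X)" "vec_norm2 u = 1"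
    using assms pos by (auto simp: u_def vec_norm2_smult norm_divide)
  have "vec_norm2 (X *\<^sub>v u) \<le> op_norm X"
    unfolding op_norm_def by (rule cSUP_upper[OF _ op_norm_bdd]) (use u in auto)
  moreover have "X *\<^sub>v u = complex_of_real (1 / vec_norm2 v) \<cdot>\<^sub>v (X *\<^sub>v v)"
    unfolding u_def using assms by (intro mult_mat_vec[of X "dim_row X" "dim_col X"]) auto
  ultimately have "vec_norm2 (X *\<^sub>v v) / vec_norm2 v \<le> op_norm X"
    using pos by (simp add: vec_norm2_smult norm_divide)
  thus ?thesis using pos by (simp add: field_simps)
qed

lemma op_norm_leI:
  assumes "0 \<le> C" "\<And>v. v \<in> carrier_vec (dim_col X) \<Longrightarrow> vec_norm2 (X *\<^sub>v v) \<le> C * vec_norm2 v"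
  shows "op_norm X \<le> C"
  unfolding op_norm_def
proof (rule cSUP_least)
  show "{v \<in> carrier_vec (dim_col X). vec_norm2 v \<le> 1} \<noteq> {}"
    by (auto intro!: exI[of _ "0\<^sub>v (dim_col X)"])
  fix v assume v: "v \<in> {v \<in> carrier_vec (dim_col X). vec_norm2 v \<le> 1}"
  have "vec_norm2 (X *\<^sub>v v) \<le> C * vec_norm2 v" using assms(2) v by auto
  also have "\<dots> \<le> C * 1" using v assms(1) by (intro mult_left_mono) auto
  finally show "vec_norm2 (X *\<^sub>v v) \<le> C" by simp
qed

lemma op_norm_add:
  assumes "X \<in> carrier_mat n m" "Y \<in> carrier_mat n m"
  shows "op_norm (X + Y) \<le> op_norm X + op_norm Y"
proof (rule op_norm_leI)
  fix v :: "complex vec" assume v: "v \<in> carrier_vec (dim_col (X + Y))"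
  have "vec_norm2 ((X + Y) *\<^sub>v v) = vec_norm2 (X *\<^sub>v v + Y *\<^sub>v v)"
    using assms v by (subst add_mult_distrib_mat_vec[of _ n m]) auto
  also have "\<dots> \<le> vec_norm2 (X *\<^sub>v v) + vec_norm2 (Y *\<^sub>v v)"
    using assms by (intro vec_norm2_add) auto
  also have "\<dots> \<le> op_norm X * vec_norm2 v + op_norm Y * vec_norm2 v"
    using assms v by (intro add_mono vec_norm2_mult_le) auto
  finally show "vec_norm2 ((X + Y) *\<^sub>v v) \<le> (op_norm X + op_norm Y) * vec_norm2 v"
    by (simp add: algebra_simps)
qed auto

lemma op_norm_smult: "op_norm (c \<cdot>\<^sub>m X) \<le> cmod c * op_norm X"
proof (rule op_norm_leI)
  fix v :: "complex vec" assume v: "v \<in> carrier_vec (dim_col (c \<cdot>\<^sub>m X))"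
  have "(c \<cdot>\<^sub>m X) *\<^sub>v v = c \<cdot>\<^sub>v (X *\<^sub>v v)"
    using v by (auto intro!: eq_vecI)
  thus "vec_norm2 ((c \<cdot>\<^sub>m X) *\<^sub>v v) \<le> (cmod c * op_norm X) * vec_norm2 v"
    using vec_norm2_mult_le[of v X] v by (simp add: vec_norm2_smult mult_left_mono mult.assoc)
qed auto

lemma op_norm_mult:
  assumes "X \<in> carrier_mat n m" "Y \<in> carrier_mat m l"
  shows "op_norm (X * Y) \<le> op_norm X * op_norm Y"
proof (rule op_norm_leI)
  fix v :: "complex vec" assume v: "v \<in> carrier_vec (dim_col (X * Y))"
  have "vec_norm2 ((X * Y) *\<^sub>v v) = vec_norm2 (X *\<^sub>v (Y *\<^sub>v v))"
    using assms v by (subst assoc_mult_mat_vec[of _ n m _ l]) auto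
  also have "\<dots> \<le> op_norm X * vec_norm2 (Y *\<^sub>v v)"
    using assms v by (intro vec_norm2_mult_le) auto
  also have "\<dots> \<le> op_norm X * (op_norm Y * vec_norm2 v)"
    using assms v by (intro mult_left_mono vec_norm2_mult_le) auto
  finally show "vec_norm2 ((X * Y) *\<^sub>v v) \<le> (op_norm X * op_norm Y) * vec_norm2 v"
    by (simp add: algebra_simps)
qed auto

lemma op_norm_one: "op_norm (1\<^sub>m n) \<le> 1"
  by (rule op_norm_leI) auto

lemma op_norm_zero: "op_norm (0\<^sub>m n m) = 0"
  by (rule antisym, rule op_norm_leI) (auto simp: vec_norm2_def L2_set_def)

text \<open>With \<open>w = X* v\<close>, \<open>|w|^2 = <X w, v>\<close> is at most \<open>|X| |w| |v|\<close>.\<close>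

lemma op_norm_adjoint_le: "op_norm (mat_adjoint X) \<le> op_norm X"
proof (rule op_norm_leI)
  fix v :: "complex vec" assume v: "v \<in> carrier_vec (dim_col (mat_adjoint X))"
  define w where "w = mat_adjoint X *\<^sub>v v"
  have w: "w \<in> carrier_vec (dim_col X)"
    unfolding w_def by (rule mult_mat_vec_carrier) (use v in auto)
  have "complex_of_real ((vec_norm2 w)\<^sup>2) = (X *\<^sub>v w) \<bullet>c v"
    unfolding vec_norm2_sq_sprod using v w
    by (subst sprod_adjoint[of X "dim_row X" "dim_col X"]) (auto simp: w_def)
  hence "(vec_norm2 w)\<^sup>2 = cmod ((X *\<^sub>v w) \<bullet>c v)"
    by (metis norm_of_real abs_of_nonneg zero_le_power2)
  also have "\<dots> \<le> vec_norm2 (X *\<^sub>v w) * vec_norm2 (conjugate v)"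
    using v by (intro sprod_Cauchy_Schwarz) auto
  also have "\<dots> \<le> (op_norm X * vec_norm2 w) * vec_norm2 v"
    using w by (auto intro!: mult_right_mono vec_norm2_mult_le)
  finally have "vec_norm2 w * vec_norm2 w \<le> vec_norm2 w * (op_norm X * vec_norm2 v)"
    by (simp add: power2_eq_square algebra_simps)
  thus "vec_norm2 (mat_adjoint X *\<^sub>v v) \<le> op_norm X * vec_norm2 v"
    unfolding w_def[symmetric]
    by (cases "vec_norm2 w = 0") (auto simp: mult_le_cancel_left less_le)
qed auto

lemma op_norm_adjoint: "op_norm (mat_adjoint X) = op_norm X"
  using op_norm_adjoint_le[of X] op_norm_adjoint_le[of "mat_adjoint X"] by simp

text \<open>The norm \<open>norm2\<close> of \<^term>\<open>mat_calg k\<close> for the normalized trace, see \<open>norm2_mat_calg\<close> below.\<close>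

definition hs_norm :: "nat \<Rightarrow> complex mat \<Rightarrow> real" where
  "hs_norm k X = sqrt (Re (ntrace k (mat_adjoint X * X)))"

lemma ntrace_adjoint_mult:
  assumes "X \<in> carrier_mat k k"
  shows "ntrace k (mat_adjoint X * X) =
    complex_of_real ((L2_set (\<lambda>(i, j). cmod (X $$ (i, j))) ({..<k} \<times> {..<k}))\<^sup>2 / real k)"
proof -
  have "(\<Sum>i<k. (mat_adjoint X * X) $$ (i, i)) = (\<Sum>j<k. \<Sum>i<k. complex_of_real ((cmod (X $$ (i, j)))\<^sup>2))"
    using assms
    by (auto simp: scalar_prod_def atLeast0LessThan complex_norm_square mult.commute simp del: of_real_power intro!: sum.cong)
  also have "\<dots> = (\<Sum>i<k. \<Sum>j<k. complex_of_real ((cmod (X $$ (i, j)))\<^sup>2))"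
    by (rule sum.swap)
  also have "\<dots> = complex_of_real ((L2_set (\<lambda>(i, j). cmod (X $$ (i, j))) ({..<k} \<times> {..<k}))\<^sup>2)"
    by (simp add: L2_set_def sum_nonneg sum.cartesian_product split_def)
  finally show ?thesis by (simp add: ntrace_def)
qed

lemma hs_norm_L2_set:
  assumes "X \<in> carrier_mat k k"
  shows "hs_norm k X = L2_set (\<lambda>(i, j). cmod (X $$ (i, j))) ({..<k} \<times> {..<k}) / sqrt k"
  by (simp add: hs_norm_def ntrace_adjoint_mult[OF assms] real_sqrt_divide del: of_real_power of_real_divide)

lemma hs_norm_nonneg: "X \<in> carrier_mat k k \<Longrightarrow> 0 \<le> hs_norm k X"
  by (simp add: hs_norm_L2_set)

lemma hs_norm_sq:
  assumes "X \<in> carrier_mat k k"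
  shows "(hs_norm k X)\<^sup>2 = Re (ntrace k (mat_adjoint X * X))"
  by (simp add: hs_norm_def ntrace_adjoint_mult[OF assms] del: of_real_power of_real_divide)

lemma ntrace_add:
  "X \<in> carrier_mat k k \<Longrightarrow> Y \<in> carrier_mat k k \<Longrightarrow> ntrace k (X + Y) = ntrace k X + ntrace k Y"
  by (simp add: ntrace_def sum.distrib add_divide_distrib)

lemma ntrace_smult: "X \<in> carrier_mat k k \<Longrightarrow> ntrace k (c \<cdot>\<^sub>m X) = c * ntrace k X"
  by (simp add: ntrace_def sum_distrib_left)

lemma ntrace_comm:
  assumes "X \<in> carrier_mat k k" "Y \<in> carrier_mat k k"
  shows "ntrace k (X * Y) = ntrace k (Y * X)"
proof -
  have "(\<Sum>i<k. (X * Y) $$ (i, i)) = (\<Sum>i<k. \<Sum>j<k. X $$ (i, j) * Y $$ (j, i))"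
    using assms by (auto simp: scalar_prod_def atLeast0LessThan intro!: sum.cong)
  also have "\<dots> = (\<Sum>j<k. \<Sum>i<k. X $$ (i, j) * Y $$ (j, i))" by (rule sum.swap)
  also have "\<dots> = (\<Sum>i<k. (Y * X) $$ (i, i))"
    using assms by (auto simp: scalar_prod_def atLeast0LessThan mult.commute intro!: sum.cong)
  finally show ?thesis by (simp add: ntrace_def)
qed

lemma ntrace_one: "0 < k \<Longrightarrow> ntrace k (1\<^sub>m k) = 1"
  by (simp add: ntrace_def)

lemma tracial_state_ntrace: "0 < k \<Longrightarrow> tracial_state (mat_calg k) (ntrace k)"
  unfolding tracial_state_def mat_calg_def
  by (auto simp: ntrace_add ntrace_smult ntrace_one ntrace_adjoint_mult intro: ntrace_comm)

lemma norm2_mat_calg: "norm2 (mat_calg k) (ntrace k) X = hs_norm k X"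
  by (simp add: norm2_def mat_calg_def hs_norm_def)

lemma hs_norm_add:
  assumes "X \<in> carrier_mat k k" "Y \<in> carrier_mat k k"
  shows "hs_norm k (X + Y) \<le> hs_norm k X + hs_norm k Y"
proof -
  have "L2_set (\<lambda>(i, j). cmod ((X + Y) $$ (i, j))) ({..<k} \<times> {..<k})
      \<le> L2_set (\<lambda>p. (case p of (i, j) \<Rightarrow> cmod (X $$ (i, j))) + (case p of (i, j) \<Rightarrow> cmod (Y $$ (i, j)))) ({..<k} \<times> {..<k})"
    using assms by (intro L2_set_mono) (auto intro: norm_triangle_ineq)
  also have "\<dots> \<le> L2_set (\<lambda>(i, j). cmod (X $$ (i, j))) ({..<k} \<times> {..<k})
      + L2_set (\<lambda>(i, j). cmod (Y $$ (i, j))) ({..<k} \<times> {..<k})"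
    by (rule L2_set_triangle_ineq)
  finally show ?thesis using assms
    by (simp add: hs_norm_L2_set add_divide_distrib[symmetric] divide_right_mono)
qed

lemma hs_norm_smult:
  assumes "X \<in> carrier_mat k k"
  shows "hs_norm k (c \<cdot>\<^sub>m X) = cmod c * hs_norm k X"
proof -
  have "L2_set (\<lambda>(i, j). cmod ((c \<cdot>\<^sub>m X) $$ (i, j))) ({..<k} \<times> {..<k})
      = L2_set (\<lambda>p. cmod c * (case p of (i, j) \<Rightarrow> cmod (X $$ (i, j)))) ({..<k} \<times> {..<k})"
    using assms by (intro L2_set_cong) (auto simp: norm_mult)
  thus ?thesis using assms by (simp add: hs_norm_L2_set L2_set_right_distrib)
qed

lemma hs_norm_adjoint:
  assumes "X \<in> carrier_mat k k"
  shows "hs_norm k (mat_adjoint X) = hs_norm k X"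
  unfolding hs_norm_def using assms by (simp add: ntrace_comm[of "mat_adjoint X" k X])

lemma hs_norm_zero: "hs_norm k (0\<^sub>m k k) = 0"
  using hs_norm_smult[of "0\<^sub>m k k" k 0] by (simp add: smult_zero_mat)

lemma hs_norm_minus_commute:
  assumes "X \<in> carrier_mat k k" "Y \<in> carrier_mat k k"
  shows "hs_norm k (X - Y) = hs_norm k (Y - X)"
proof -
  have "X - Y = (-1) \<cdot>\<^sub>m (Y - X)" using assms by (auto intro!: eq_matI)
  thus ?thesis using assms by (simp add: hs_norm_smult[OF minus_carrier_mat])
qed

lemma hs_norm_triangle:
  assumes "X \<in> carrier_mat k k" "Y \<in> carrier_mat k k" "Z \<in> carrier_mat k k"
  shows "hs_norm k (X - Z) \<le> hs_norm k (X - Y) + hs_norm k (Y - Z)"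
proof -
  have "X - Z = (X - Y) + (Y - Z)" using assms by (auto intro!: eq_matI)
  thus ?thesis using hs_norm_add[of "X - Y" k "Y - Z"] assms by (simp add: minus_carrier_mat)
qed

lemma hs_norm_sq_cols:
  assumes "X \<in> carrier_mat k k"
  shows "(hs_norm k X)\<^sup>2 = (\<Sum>j<k. (vec_norm2 (col X j))\<^sup>2) / k"
proof -
  have "(L2_set (\<lambda>(i, j). cmod (X $$ (i, j))) ({..<k} \<times> {..<k}))\<^sup>2 = (\<Sum>i<k. \<Sum>j<k. (cmod (X $$ (i,j)))\<^sup>2)"
    by (simp add: L2_set_def sum_nonneg sum.cartesian_product split_def)
  also have "\<dots> = (\<Sum>j<k. \<Sum>i<k. (cmod (X $$ (i,j)))\<^sup>2)" by (rule sum.swap)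
  finally show ?thesis using assms
    by (simp add: hs_norm_L2_set power_divide vec_norm2_sq)
qed

text \<open>The squared Hilbert-Schmidt norm is the average of the squared norms of the columns, and left
multiplication by \<open>X\<close> acts on each column separately.\<close>

lemma hs_norm_mult_left:
  assumes "X \<in> carrier_mat k k" "Y \<in> carrier_mat k k"
  shows "hs_norm k (X * Y) \<le> op_norm X * hs_norm k Y"
proof (rule power2_le_imp_le)
  have "(\<Sum>j<k. (vec_norm2 (col (X * Y) j))\<^sup>2) \<le> (\<Sum>j<k. (op_norm X * vec_norm2 (col Y j))\<^sup>2)"
  proof (intro sum_mono power_mono)
    fix j assume "j \<in> {..<k}"
    hence "col (X * Y) j = X *\<^sub>v col Y j" using assms by (intro eq_vecI) auto
    thus "vec_norm2 (col (X * Y) j) \<le> op_norm X * vec_norm2 (col Y j)"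
      using assms by (auto intro!: vec_norm2_mult_le)
  qed auto
  thus "(hs_norm k (X * Y))\<^sup>2 \<le> (op_norm X * hs_norm k Y)\<^sup>2"
    using assms
    by (simp add: hs_norm_sq_cols[of "X * Y"] hs_norm_sq_cols[of Y] power_mult_distrib sum_distrib_left[symmetric] divide_right_mono)
qed (use assms in \<open>auto intro!: hs_norm_nonneg mult_nonneg_nonneg\<close>)

lemma hs_norm_mult_right:
  assumes "X \<in> carrier_mat k k" "Y \<in> carrier_mat k k"
  shows "hs_norm k (X * Y) \<le> hs_norm k X * op_norm Y"
  using hs_norm_mult_left[of "mat_adjoint Y" k "mat_adjoint X"] assms
  by (simp add: mat_adjoint_mult[of X k k Y k, symmetric] hs_norm_adjoint op_norm_adjoint mult.commute)


section \<open>Unitary diagonalization of normal matrices\<close>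

lemma unitary_mats_iff:
  "U \<in> unitary_mats k \<longleftrightarrow> U \<in> carrier_mat k k \<and> mat_adjoint U * U = 1\<^sub>m k"
  by (auto simp: unitary_mats_def intro: mat_mult_left_right_inverse[of "mat_adjoint U" k U])

lemma unitary_matsD:
  assumes "U \<in> unitary_mats k"
  shows "U \<in> carrier_mat k k" "mat_adjoint U * U = 1\<^sub>m k" "U * mat_adjoint U = 1\<^sub>m k"
  using assms by (auto simp: unitary_mats_def)

lemma unitary_mats_adjoint: "U \<in> unitary_mats k \<Longrightarrow> mat_adjoint U \<in> unitary_mats k"
  by (auto simp: unitary_mats_def)

lemma unitary_mats_mult:
  assumes "U \<in> unitary_mats k" "V \<in> unitary_mats k"
  shows "U * V \<in> unitary_mats k"
proof -
  note U = unitary_matsD[OF assms(1)] and V = unitary_matsD[OF assms(2)]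
  have "mat_adjoint (U * V) * (U * V) = mat_adjoint V * (mat_adjoint U * U) * V"
    using U(1) V(1)
    by (simp add: mat_adjoint_mult[of _ k k _ k] square_mult_closed[of _ k] assoc_mult_mat[of _ k k _ k _ k])
  also have "\<dots> = 1\<^sub>m k" using U V by simp
  finally show ?thesis using U(1) V(1) by (simp add: unitary_mats_iff)
qed

text \<open>The block matrix with diagonal blocks \<open>a\<close> and \<open>M\<close>, for the induction on the dimension.\<close>

definition border_mat :: "nat \<Rightarrow> complex \<Rightarrow> complex mat \<Rightarrow> complex mat" where
  "border_mat n a M = mat (Suc n) (Suc n) (\<lambda>(i, j).
     case i of 0 \<Rightarrow> (case j of 0 \<Rightarrow> a | Suc _ \<Rightarrow> 0) | Suc i \<Rightarrow> (case j of 0 \<Rightarrow> 0 | Suc j \<Rightarrow> M $$ (i, j)))"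

lemma border_mat_closed [simp]: "border_mat n a M \<in> carrier_mat (Suc n) (Suc n)"
  by (simp add: border_mat_def)

lemma border_mat_mult:
  assumes "M \<in> carrier_mat n n" "N \<in> carrier_mat n n"
  shows "border_mat n a M * border_mat n b N = border_mat n (a * b) (M * N)"
  using assms
  by (intro eq_matI)
     (auto simp: border_mat_def scalar_prod_def atLeast0LessThan sum.lessThan_Suc_shift
           simp del: sum.lessThan_Suc split: nat.splits)

lemma border_mat_adjoint:
  assumes "M \<in> carrier_mat n n"
  shows "mat_adjoint (border_mat n a M) = border_mat n (cnj a) (mat_adjoint M)"
  using assms by (intro eq_matI) (auto simp: border_mat_def split: nat.splits)

lemma border_mat_one: "border_mat n 1 (1\<^sub>m n) = 1\<^sub>m (Suc n)"
  by (intro eq_matI) (auto simp: border_mat_def split: nat.splits)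

lemma border_mat_diag: "border_mat n a (mat_diag n d) = mat_diag (Suc n) (case_nat a d)"
  by (intro eq_matI) (auto simp: border_mat_def mat_diag_def split: nat.splits)

lemma border_mat_inj:
  assumes "border_mat n a M = border_mat n b N" "M \<in> carrier_mat n n" "N \<in> carrier_mat n n"
  shows "M = N"
proof (rule eq_matI)
  fix i j assume "i < dim_row N" "j < dim_col N"
  thus "M $$ (i, j) = N $$ (i, j)"
    using arg_cong[OF assms(1), of "\<lambda>X. X $$ (Suc i, Suc j)"] assms(3) by (simp add: border_mat_def)
qed (use assms in auto)

text \<open>Complete \<open>v\<close> to a basis, orthogonalize, and normalize the columns.\<close>

lemma unitary_with_first_column:
  assumes v: "v \<in> carrier_vec n" and v0: "v \<noteq> 0\<^sub>v n"
  obtains W c where "W \<in> unitary_mats n" "col W 0 = c \<cdot>\<^sub>v v"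
proof -
  interpret cof_vec_space n "TYPE(complex)" .
  note bc = basis_completion[OF v v0]
  define ws where "ws = gram_schmidt n (basis_completion v)"
  note gs = gram_schmidt_result[OF bc(2) bc(4) bc(5) ws_def]
  have len: "length ws = n" using gs(4) bc(6) by simp
  have n: "n \<noteq> 0" using v v0 by (metis carrier_vecD eq_vecI less_nat_zero_code index_zero_vec(2))
  obtain vs where bv: "basis_completion v = v # vs"
    using bc(6,7) n by (cases "basis_completion v") auto
  have hd: "hd ws = v" unfolding ws_def bv by (rule gram_schmidt_hd[OF v])
  have dims: "ws ! i \<in> carrier_vec n" if "i < n" for i using gs(3) len that by auto
  have orth: "ws ! i \<bullet>c ws ! j = 0 \<longleftrightarrow> i \<noteq> j" if "i < n" "j < n" for i j
    using corthogonalD[OF gs(2)] len that by auto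
  have pos: "vec_norm2 (ws ! i) \<noteq> 0" if "i < n" for i
    using orth[OF that that] vec_norm2_sq_sprod[of "ws ! i"] by auto
  define W where "W = mat n n (\<lambda>(i, j). ws ! j $ i / complex_of_real (vec_norm2 (ws ! j)))"
  have W: "W \<in> carrier_mat n n" by (simp add: W_def)
  have "mat_adjoint W * W = 1\<^sub>m n"
  proof (rule eq_matI)
    fix i j assume ij: "i < dim_row (1\<^sub>m n :: complex mat)" "j < dim_col (1\<^sub>m n :: complex mat)"
    hence "(mat_adjoint W * W) $$ (i, j) =
        (\<Sum>l<n. cnj (ws ! i $ l) * ws ! j $ l / (complex_of_real (vec_norm2 (ws ! i)) * complex_of_real (vec_norm2 (ws ! j))))"
      by (simp add: W_def scalar_prod_def atLeast0LessThan)
    also have "\<dots> = (ws ! j \<bullet>c ws ! i) / (complex_of_real (vec_norm2 (ws ! i)) * complex_of_real (vec_norm2 (ws ! j)))"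
      using dims[of i] dims[of j] ij
      by (simp add: scalar_prod_def atLeast0LessThan sum_divide_distrib mult.commute)
    also have "\<dots> = 1\<^sub>m n $$ (i, j)"
    proof (cases "i = j")
      case True
      thus ?thesis using ij pos[of i] vec_norm2_sq_sprod[of "ws ! i", symmetric]
        by (simp add: power2_eq_square)
    next
      case False
      thus ?thesis using orth[of j i] ij by simp
    qed
    finally show "(mat_adjoint W * W) $$ (i, j) = 1\<^sub>m n $$ (i, j)" .
  qed (use W in auto)
  moreover have "ws ! 0 = v" using hd len n by (metis hd_conv_nth length_0_conv)
  hence "col W 0 = complex_of_real (1 / vec_norm2 v) \<cdot>\<^sub>v v"
    using v n by (intro eq_vecI) (auto simp: W_def)
  ultimately show ?thesis using that W by (simp add: unitary_mats_iff)
qed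

text \<open>The \<open>(0, 0)\<close> entries of \<open>A* A\<close> and \<open>A A*\<close> are the squared norms of the first column and of the
first row, so these two norms agree.\<close>

lemma normal_first_row:
  fixes A :: "complex mat"
  assumes A: "A \<in> carrier_mat (Suc n) (Suc n)"
    and normal: "mat_adjoint A * A = A * mat_adjoint A"
    and col: "\<And>i. i < n \<Longrightarrow> A $$ (Suc i, 0) = 0"
    and j: "j < n"
  shows "A $$ (0, Suc j) = 0"
proof -
  have "(mat_adjoint A * A) $$ (0, 0) = complex_of_real (\<Sum>i<Suc n. (cmod (A $$ (i, 0)))\<^sup>2)"
    using A by (simp add: scalar_prod_def atLeast0LessThan complex_norm_square mult.commute
      del: of_real_power sum.lessThan_Suc)
  moreover have "(A * mat_adjoint A) $$ (0, 0) = complex_of_real (\<Sum>i<Suc n. (cmod (A $$ (0, i)))\<^sup>2)"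
    using A by (simp add: scalar_prod_def atLeast0LessThan complex_norm_square mult.commute
      del: of_real_power sum.lessThan_Suc)
  ultimately have "(\<Sum>i<Suc n. (cmod (A $$ (i, 0)))\<^sup>2) = (\<Sum>i<Suc n. (cmod (A $$ (0, i)))\<^sup>2)"
    using normal by (metis of_real_eq_iff)
  hence "(\<Sum>i<n. (cmod (A $$ (0, Suc i)))\<^sup>2) = 0"
    using col by (simp add: sum.lessThan_Suc_shift del: sum.lessThan_Suc)
  thus ?thesis using j by (simp add: sum_nonneg_eq_0_iff)
qed

text \<open>Put an eigenvector into the first column of a unitary \<open>W\<close>. Then \<open>W* A W\<close> is block diagonal by
\<open>normal_first_row\<close>, and the lower block is again normal.\<close>

theorem normal_mat_unitarily_diagonalizable:
  assumes "A \<in> carrier_mat n n" "mat_adjoint A * A = A * mat_adjoint A"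
  obtains U d where "U \<in> unitary_mats n" "A = U * mat_diag n d * mat_adjoint U"
proof -
  have "\<exists>U d. U \<in> unitary_mats n \<and> A = U * mat_diag n d * mat_adjoint U"
    using assms
  proof (induction n arbitrary: A)
    case 0
    thus ?case by (intro exI[of _ "1\<^sub>m 0"]) (auto simp: unitary_mats_iff intro!: eq_matI)
  next
    case (Suc n)
    let ?N = "Suc n"
    note A = Suc.prems(1)
    obtain as where "char_poly A = (\<Prod>a\<leftarrow>as. [:- a, 1:])" "length as = ?N"
      using char_poly_factorized[OF A] by auto
    then obtain e where "poly (char_poly A) e = 0"
      by (cases as) auto
    hence "eigenvalue A e" using eigenvalue_root_char_poly[OF A] by simp
    then obtain v where v: "v \<in> carrier_vec ?N" "v \<noteq> 0\<^sub>v ?N" and ev: "A *\<^sub>v v = e \<cdot>\<^sub>v v"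
      using A by (auto simp: eigenvalue_def eigenvector_def)
    obtain W c where W: "W \<in> unitary_mats ?N" and Wc: "col W 0 = c \<cdot>\<^sub>v v"
      using unitary_with_first_column[OF v] .
    note Wu = unitary_matsD[OF W]
    have Wa: "mat_adjoint W \<in> carrier_mat ?N ?N" and Aa: "mat_adjoint A \<in> carrier_mat ?N ?N"
      using Wu(1) A by auto
    note [simp] = square_mult_closed[of _ ?N] assoc_mult_mat[of _ ?N ?N _ ?N _ ?N] mat_adjoint_mult[of _ ?N ?N _ ?N]
    have cancel: "W * (mat_adjoint W * X) = X" "mat_adjoint W * (W * X) = X"
      if "X \<in> carrier_mat ?N ?N" for X
      using Wu Wa that by (simp_all flip: assoc_mult_mat[of _ ?N ?N _ ?N _ ?N])
    define B where "B = mat_adjoint W * A * W"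
    have B: "B \<in> carrier_mat ?N ?N" using A Wu by (auto simp: B_def)
    have AB: "A = W * B * mat_adjoint W"
      unfolding B_def using A Wu(1) Wa Wu(3) by (simp add: cancel)
    have Badj: "mat_adjoint B = mat_adjoint W * mat_adjoint A * W"
      unfolding B_def using A Wu(1) Wa by simp
    have "mat_adjoint B * B = mat_adjoint W * (mat_adjoint A * A) * W"
      unfolding Badj unfolding B_def using A Aa Wu(1) Wa by (simp add: cancel)
    also have "\<dots> = B * mat_adjoint B"
      unfolding Badj Suc.prems(2) unfolding B_def using A Aa Wu(1) Wa by (simp add: cancel)
    finally have Bnormal: "mat_adjoint B * B = B * mat_adjoint B" .
    have "col B 0 = mat_adjoint W *\<^sub>v (A *\<^sub>v col W 0)"
      using A Wu(1) Wa unfolding B_def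
      by (subst col_mult2[of _ ?N ?N _ ?N], auto)+ (subst assoc_mult_mat_vec[of _ ?N ?N _ ?N], auto intro: col_carrier_vec)
    also have "A *\<^sub>v col W 0 = e \<cdot>\<^sub>v col W 0"
      unfolding Wc using A v ev by (simp add: mult_mat_vec[of _ ?N ?N] smult_smult_assoc mult.commute)
    also have "mat_adjoint W *\<^sub>v (e \<cdot>\<^sub>v col W 0) = e \<cdot>\<^sub>v col (mat_adjoint W * W) 0"
      using Wu(1) Wa by (simp add: mult_mat_vec[of _ ?N ?N]) (intro eq_vecI, auto)
    also have "\<dots> = e \<cdot>\<^sub>v unit_vec ?N 0" using Wu(2) by simp
    finally have colB: "col B 0 = e \<cdot>\<^sub>v unit_vec ?N 0" .
    have col0: "B $$ (Suc i, 0) = 0" if "i < n" for i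
      using arg_cong[OF colB, of "\<lambda>x. x $ Suc i"] B that by simp
    have row0: "B $$ (0, Suc j) = 0" if "j < n" for j
      by (rule normal_first_row[OF B Bnormal col0 that])
    define C where "C = mat n n (\<lambda>(i, j). B $$ (Suc i, Suc j))"
    have C: "C \<in> carrier_mat n n" by (simp add: C_def)
    define b where "b = B $$ (0, 0)"
    have BC: "B = border_mat n b C"
      using B col0 row0 by (intro eq_matI) (auto simp: border_mat_def C_def b_def split: nat.splits)
    have "border_mat n (cnj b * b) (mat_adjoint C * C) = border_mat n (b * cnj b) (C * mat_adjoint C)"
      using Bnormal C unfolding BC by (simp add: border_mat_adjoint border_mat_mult)
    hence "mat_adjoint C * C = C * mat_adjoint C"
      by (rule border_mat_inj) (use C in auto)
    then obtain V d where V: "V \<in> unitary_mats n" and CV: "C = V * mat_diag n d * mat_adjoint V"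
      using Suc.IH[OF C] by blast
    note Vu = unitary_matsD[OF V]
    define V' where "V' = border_mat n 1 V"
    have V'c: "V' \<in> carrier_mat ?N ?N" by (simp add: V'_def)
    have V': "V' \<in> unitary_mats ?N"
      using Vu by (simp add: unitary_mats_iff V'_def border_mat_adjoint border_mat_mult border_mat_one)
    have "B = V' * mat_diag ?N (case_nat b d) * mat_adjoint V'"
      unfolding BC CV V'_def using Vu
      by (simp add: border_mat_adjoint border_mat_mult flip: border_mat_diag)
    hence "A = (W * V') * mat_diag ?N (case_nat b d) * mat_adjoint (W * V')"
      unfolding AB using Wu(1) Wa V'c by simp
    thus ?case using unitary_mats_mult[OF W V'] by blast
  qed
  thus ?thesis using that by blast
qed


section \<open>Cutting off large singular values\<close>

text \<open>\<open>odd_power A z q\<close> is \<open>z (z* z)^q\<close>. Its squared 2-norm is the moment of order \<open>2 q + 1\<close> of \<open>z* z\<close>, which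
bounds the part of \<open>z\<close> with large singular values.\<close>

primrec odd_power :: "'a calg \<Rightarrow> 'a \<Rightarrow> nat \<Rightarrow> 'a" where
  "odd_power A z 0 = z"
| "odd_power A z (Suc q) = odd_power A z q \<otimes>\<^bsub>A\<^esub> (star A z \<otimes>\<^bsub>A\<^esub> z)"

lemma mat_calg_simps [simp]:
  "carrier (mat_calg k) = carrier_mat k k" "monoid.mult (mat_calg k) = (*)"
  "one (mat_calg k) = 1\<^sub>m k" "zero (mat_calg k) = 0\<^sub>m k k" "add (mat_calg k) = (+)"
  "module.smult (mat_calg k) = (\<cdot>\<^sub>m)" "star (mat_calg k) = mat_adjoint" "cnorm (mat_calg k) = op_norm"
  by (simp_all add: mat_calg_def)

text \<open>For fixed \<open>U\<close>, the matrices that are diagonal in the basis of the columns of \<open>U\<close>. Products, adjoints and linear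
combinations are computed pointwise on \<open>f\<close>, which gives a functional calculus.\<close>

definition diag_conj :: "nat \<Rightarrow> complex mat \<Rightarrow> (nat \<Rightarrow> complex) \<Rightarrow> complex mat" where
  "diag_conj k U f = U * mat_diag k f * mat_adjoint U"

context
  fixes k :: nat and U :: "complex mat"
  assumes U: "U \<in> unitary_mats k"
begin

lemma diag_conj_closed [simp]: "diag_conj k U f \<in> carrier_mat k k"
  using unitary_matsD(1)[OF U] by (auto simp: diag_conj_def)

lemma diag_conj_mult: "diag_conj k U f * diag_conj k U g = diag_conj k U (\<lambda>i. f i * g i)"
proof -
  note Uu = unitary_matsD[OF U]
  note [simp] = square_mult_closed[of _ k] assoc_mult_mat[of _ k k _ k _ k]
  have c: "mat_adjoint U * (U * X) = X" if "X \<in> carrier_mat k k" for X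
    using Uu that by (simp flip: assoc_mult_mat[of _ k k _ k _ k])
  have "mat_diag k f * (mat_diag k g * mat_adjoint U) = mat_diag k (\<lambda>i. f i * g i) * mat_adjoint U"
    using Uu(1) by (simp flip: assoc_mult_mat[of _ k k _ k _ k] add: mat_diag_diag)
  thus ?thesis using Uu(1) by (simp add: diag_conj_def c)
qed

lemma diag_conj_adjoint: "mat_adjoint (diag_conj k U f) = diag_conj k U (\<lambda>i. cnj (f i))"
  using unitary_matsD(1)[OF U]
  by (simp add: diag_conj_def mat_adjoint_mult[of _ k k _ k] mat_adjoint_diag
      square_mult_closed[of _ k] assoc_mult_mat[of _ k k _ k _ k])

lemma diag_conj_one: "diag_conj k U (\<lambda>_. 1) = 1\<^sub>m k"
  using unitary_matsD[OF U] by (simp add: diag_conj_def)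

lemma diag_conj_minus: "diag_conj k U f - diag_conj k U g = diag_conj k U (\<lambda>i. f i - g i)"
proof -
  note Uu = unitary_matsD[OF U]
  have "mat_diag k f - mat_diag k g = mat_diag k (\<lambda>i. f i - g i)"
    by (rule eq_matI) (auto simp: mat_diag_def)
  thus ?thesis using Uu(1) unfolding diag_conj_def
    by (simp add: mult_minus_distrib_mat[of _ k k _ k, symmetric] minus_mult_distrib_mat[of _ k k _ _ k, symmetric])
qed

lemma diag_conj_add: "diag_conj k U f + diag_conj k U g = diag_conj k U (\<lambda>i. f i + g i)"
proof -
  note Uu = unitary_matsD[OF U]
  have "mat_diag k f + mat_diag k g = mat_diag k (\<lambda>i. f i + g i)"
    by (rule eq_matI) (auto simp: mat_diag_def)
  thus ?thesis using Uu(1) unfolding diag_conj_def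
    by (simp add: mult_add_distrib_mat[of _ k k _ k, symmetric] add_mult_distrib_mat[of _ k k _ _ k, symmetric])
qed

lemma diag_conj_smult: "c \<cdot>\<^sub>m diag_conj k U f = diag_conj k U (\<lambda>i. c * f i)"
proof -
  note Uu = unitary_matsD[OF U]
  have "mat_diag k (\<lambda>i. c * f i) = c \<cdot>\<^sub>m mat_diag k f"
    by (rule eq_matI) (auto simp: mat_diag_def)
  thus ?thesis using Uu(1) unfolding diag_conj_def
    by (simp add: mult_smult_distrib[of _ k k _ k] mult_smult_assoc_mat[of _ k k _ k])
qed

lemma ntrace_diag_conj: "ntrace k (diag_conj k U f) = (\<Sum>i<k. f i) / of_nat k"
proof -
  note Uu = unitary_matsD[OF U]
  have "ntrace k (diag_conj k U f) = ntrace k (mat_adjoint U * (U * mat_diag k f))"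
    unfolding diag_conj_def using Uu(1) by (intro ntrace_comm) auto
  also have "mat_adjoint U * (U * mat_diag k f) = mat_diag k f"
    using Uu by (simp add: left_mult_one_mat[of _ k k] flip: assoc_mult_mat[of _ k k _ k _ k])
  finally show ?thesis by (simp add: ntrace_def mat_diag_def)
qed

lemma vec_norm2_unitary:
  assumes "v \<in> carrier_vec k"
  shows "vec_norm2 (mat_adjoint U *\<^sub>v v) = vec_norm2 v"
proof -
  note Uu = unitary_matsD[OF U]
  have "complex_of_real ((vec_norm2 (mat_adjoint U *\<^sub>v v))\<^sup>2) = complex_of_real ((vec_norm2 v)\<^sup>2)"
    unfolding vec_norm2_sq_sprod using assms Uu
    by (subst sprod_adjoint[of _ k k])
       (auto simp flip: assoc_mult_mat_vec[of _ k k _ k] intro!: mult_mat_vec_carrier[of _ k k])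
  thus ?thesis by (simp add: power2_eq_iff_nonneg del: of_real_power)
qed

text \<open>\<open>|X v|^2 = <v, X* X v>\<close> is a sum of the \<open>e i\<close> weighted by the squared coordinates of \<open>v\<close> in the basis \<open>U\<close>.\<close>

lemma op_norm_le_diag_conj:
  assumes X: "X \<in> carrier_mat k k" "mat_adjoint X * X = diag_conj k U (\<lambda>i. complex_of_real (e i))"
    and e: "\<And>i. i < k \<Longrightarrow> e i \<le> C\<^sup>2" and C: "0 \<le> C"
  shows "op_norm X \<le> C"
proof (rule op_norm_leI)
  note Uu = unitary_matsD[OF U]
  fix v :: "complex vec" assume "v \<in> carrier_vec (dim_col X)"
  hence v: "v \<in> carrier_vec k" using X by simp
  define w where "w = mat_adjoint U *\<^sub>v v"
  have w: "w \<in> carrier_vec k" unfolding w_def using Uu v by (auto intro!: mult_mat_vec_carrier[of _ k k])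
  have Xv: "X *\<^sub>v v \<in> carrier_vec k" using X v by (auto intro!: mult_mat_vec_carrier[of _ k k])
  have dw: "mat_diag k (\<lambda>i. complex_of_real (e i)) *\<^sub>v w = vec k (\<lambda>i. e i * w $ i)"
  proof (rule eq_vecI)
    fix i assume "i < dim_vec (vec k (\<lambda>i. e i * w $ i))"
    hence i: "i < k" by simp
    have "(mat_diag k (\<lambda>i. complex_of_real (e i)) *\<^sub>v w) $ i = (\<Sum>j<k. (if i = j then complex_of_real (e j) else 0) * w $ j)"
      using i w by (simp add: mat_diag_def scalar_prod_def atLeast0LessThan)
    also have "\<dots> = (\<Sum>j<k. if i = j then e j * w $ j else 0)"
      by (rule sum.cong) auto
    finally show "(mat_diag k (\<lambda>i. complex_of_real (e i)) *\<^sub>v w) $ i = vec k (\<lambda>i. e i * w $ i) $ i"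
      using i by simp
  qed (simp add: mat_diag_def)
  have "complex_of_real ((vec_norm2 (X *\<^sub>v v))\<^sup>2) = v \<bullet>c (mat_adjoint X *\<^sub>v (X *\<^sub>v v))"
    unfolding vec_norm2_sq_sprod by (rule sprod_adjoint[OF X(1) v Xv])
  also have "mat_adjoint X *\<^sub>v (X *\<^sub>v v) = U *\<^sub>v (mat_diag k (\<lambda>i. complex_of_real (e i)) *\<^sub>v w)"
  proof -
    have "mat_adjoint X *\<^sub>v (X *\<^sub>v v) = (U * mat_diag k (\<lambda>i. complex_of_real (e i)) * mat_adjoint U) *\<^sub>v v"
      using assoc_mult_mat_vec[OF mat_adjoint_closed[OF X(1)] X(1) v] unfolding X(2) diag_conj_def
      by (rule sym)
    also have "\<dots> = (U * mat_diag k (\<lambda>i. complex_of_real (e i))) *\<^sub>v w"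
      unfolding w_def using Uu v by (intro assoc_mult_mat_vec[of _ k k _ k]) auto
    also have "\<dots> = U *\<^sub>v (mat_diag k (\<lambda>i. complex_of_real (e i)) *\<^sub>v w)"
      using Uu w by (intro assoc_mult_mat_vec[of _ k k _ k]) auto
    finally show ?thesis .
  qed
  also have "v \<bullet>c \<dots> = w \<bullet>c (mat_diag k (\<lambda>i. complex_of_real (e i)) *\<^sub>v w)"
    unfolding w_def using Uu v by (subst sprod_adjoint[of _ k k]) (auto intro!: mult_mat_vec_carrier[of _ k k])
  also have "\<dots> = (\<Sum>i<k. complex_of_real (e i) * (w $ i * cnj (w $ i)))"
    unfolding dw using w
    by (simp add: scalar_prod_def atLeast0LessThan) (rule sum.cong, simp_all)
  also have "\<dots> = complex_of_real (\<Sum>i<k. e i * (cmod (w $ i))\<^sup>2)"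
    by (simp only: complex_norm_square of_real_sum of_real_mult)
  finally have "(vec_norm2 (X *\<^sub>v v))\<^sup>2 = (\<Sum>i<k. e i * (cmod (w $ i))\<^sup>2)"
    by (simp only: of_real_eq_iff)
  also have "\<dots> \<le> (\<Sum>i<k. C\<^sup>2 * (cmod (w $ i))\<^sup>2)"
    using e by (intro sum_mono mult_right_mono) auto
  also have "\<dots> = C\<^sup>2 * (vec_norm2 w)\<^sup>2" using w by (simp add: vec_norm2_sq sum_distrib_left)
  also have "\<dots> = (C * vec_norm2 v)\<^sup>2"
    unfolding w_def vec_norm2_unitary[OF v] by (rule power_mult_distrib[symmetric])
  finally have le: "(vec_norm2 (X *\<^sub>v v))\<^sup>2 \<le> (C * vec_norm2 v)\<^sup>2" .
  show "vec_norm2 (X *\<^sub>v v) \<le> C * vec_norm2 v"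
    by (rule power2_le_imp_le[OF le]) (rule mult_nonneg_nonneg[OF C vec_norm2_nonneg])
qed (rule C)

end

text \<open>Replace every singular value \<open>s > M\<close> of \<open>Z\<close> by \<open>M\<close>. With \<open>d = s^2\<close> an eigenvalue of \<open>Z* Z\<close>, the error in the
squared Hilbert-Schmidt norm is the average of \<open>(s - M)^2\<close> over the eigenvalues \<open>d > M^2\<close>, hence at most the
average of \<open>d (d / M^2)^(2 q)\<close> for every \<open>q\<close>. One truncation serves for all \<open>q\<close> at once; this makes it
possible to choose \<open>q\<close> later, depending on the limit of the moments.\<close>

theorem truncate_mat:
  assumes Z: "Z \<in> carrier_mat k k" and M: "0 < M"
  obtains Y where "Y \<in> carrier_mat k k" "op_norm Y \<le> M"
    "\<And>q. (hs_norm k (Z - Y))\<^sup>2 \<le> (hs_norm k (odd_power (mat_calg k) Z q))\<^sup>2 / M ^ (4 * q)"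
proof -
  have ZZ: "mat_adjoint Z * Z \<in> carrier_mat k k" using Z by auto
  have "mat_adjoint (mat_adjoint Z * Z) = mat_adjoint Z * Z"
    using Z by (simp add: mat_adjoint_mult[of _ k k _ k])
  then obtain U d' where U: "U \<in> unitary_mats k" and d': "mat_adjoint Z * Z = diag_conj k U d'"
    using normal_mat_unitarily_diagonalizable[OF ZZ] unfolding diag_conj_def by metis
  note Uu = unitary_matsD[OF U]
  note [simp] = diag_conj_closed[OF U] diag_conj_mult[OF U] diag_conj_adjoint[OF U]
  define d where "d i = (vec_norm2 (col (Z * U) i))\<^sup>2" for i
  \<comment> \<open>The eigenvalues of \<open>Z* Z\<close> are real and nonnegative, being squared norms of the columns of \<open>Z U\<close>.\<close>
  have d'_eq: "d' i = complex_of_real (d i)" if i: "i < k" for i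
  proof -
    note [simp] = square_mult_closed[of _ k] assoc_mult_mat[of _ k k _ k _ k]
    have c: "mat_adjoint U * (U * X) = X" if "X \<in> carrier_mat k k" for X
      using Uu that by (simp flip: assoc_mult_mat[of _ k k _ k _ k])
    have "mat_adjoint (Z * U) * (Z * U) = mat_adjoint U * (mat_adjoint Z * Z) * U"
      using Z Uu by (simp add: mat_adjoint_mult[of _ k k _ k])
    also have "\<dots> = mat_diag k d'" using Uu unfolding d' diag_conj_def by (simp add: c right_mult_one_mat[of _ k k])
    finally have "d' i = (mat_adjoint (Z * U) * (Z * U)) $$ (i, i)" using i by (simp add: mat_diag_def)
    also have "\<dots> = col (Z * U) i \<bullet>c col (Z * U) i"
      using Z Uu i by (simp add: scalar_prod_def mult.commute)
    finally show ?thesis unfolding d_def vec_norm2_sq_sprod .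
  qed
  have dd: "mat_adjoint Z * Z = diag_conj k U (\<lambda>i. complex_of_real (d i))"
  proof -
    have "mat_diag k d' = mat_diag k (\<lambda>i. complex_of_real (d i))"
      by (rule eq_matI) (auto simp: mat_diag_def d'_eq)
    thus ?thesis unfolding d' diag_conj_def by simp
  qed
  have d0: "0 \<le> d i" for i by (simp add: d_def)
  \<comment> \<open>All matrices below are of the form \<open>Z g(Z* Z)\<close>.\<close>
  define F where "F f = Z * diag_conj k U (\<lambda>i. complex_of_real (f i))" for f
  have Fc: "F f \<in> carrier_mat k k" for f using Z by (simp add: F_def square_mult_closed[of _ k])
  have FF: "mat_adjoint (F f) * F f = diag_conj k U (\<lambda>i. complex_of_real ((f i)\<^sup>2 * d i))" for f
  proof -
    have "mat_adjoint (F f) * F f = diag_conj k U (\<lambda>i. complex_of_real (f i)) * (mat_adjoint Z * Z) * diag_conj k U (\<lambda>i. complex_of_real (f i))"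
      unfolding F_def using Z
      by (simp add: mat_adjoint_mult[of _ k k _ k] square_mult_closed[of _ k] assoc_mult_mat[of _ k k _ k _ k] del: diag_conj_mult[OF U])
    thus ?thesis unfolding dd by (simp add: power2_eq_square mult_ac)
  qed
  have hsF: "(hs_norm k (F f))\<^sup>2 = (\<Sum>i<k. (f i)\<^sup>2 * d i) / k" for f
    unfolding hs_norm_sq[OF Fc] FF ntrace_diag_conj[OF U] by simp
  have odd: "odd_power (mat_calg k) Z q = F (\<lambda>i. d i ^ q)" for q
  proof (induction q)
    case 0
    thus ?case using Z by (simp add: F_def diag_conj_one[OF U])
  next
    case (Suc q)
    have "odd_power (mat_calg k) Z (Suc q) = F (\<lambda>i. d i ^ q) * (mat_adjoint Z * Z)"
      using Suc by simp
    also have "\<dots> = Z * (diag_conj k U (\<lambda>i. complex_of_real (d i ^ q)) * (mat_adjoint Z * Z))"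
      unfolding F_def by (rule assoc_mult_mat[of _ k k _ k _ k]) (use Z in auto)
    also have "\<dots> = F (\<lambda>i. d i ^ Suc q)"
      unfolding dd diag_conj_mult[OF U] F_def by (simp only: power_Suc2 of_real_mult)
    finally show ?case .
  qed
  define t where "t i = (if d i \<le> M\<^sup>2 then 1 else M / sqrt (d i))" for i
  define Y where "Y = F t"
  have Y: "Y \<in> carrier_mat k k" by (simp add: Y_def Fc)
  have "op_norm Y \<le> M"
  proof (rule op_norm_le_diag_conj[OF U Y])
    show "mat_adjoint Y * Y = diag_conj k U (\<lambda>i. complex_of_real ((t i)\<^sup>2 * d i))"
      unfolding Y_def by (rule FF)
    fix i
    show "(t i)\<^sup>2 * d i \<le> M\<^sup>2"
      using d0[of i] M zero_le_power2[of M] by (cases "d i = 0") (auto simp: t_def power_divide)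
  qed (use M in simp)
  moreover have "(hs_norm k (Z - Y))\<^sup>2 \<le> (hs_norm k (odd_power (mat_calg k) Z q))\<^sup>2 / M ^ (4 * q)" for q
  proof -
    have "Z - Y = Z * (diag_conj k U (\<lambda>_. 1) - diag_conj k U (\<lambda>i. complex_of_real (t i)))"
      unfolding Y_def F_def using Z
      by (simp add: mult_minus_distrib_mat[of _ k k _ k] diag_conj_one[OF U])
    hence ZY: "Z - Y = F (\<lambda>i. 1 - t i)"
      by (simp add: F_def diag_conj_minus[OF U])
    have "(1 - t i)\<^sup>2 * d i \<le> (d i ^ q)\<^sup>2 * d i / M ^ (4 * q)" for i
    proof (cases "d i \<le> M\<^sup>2")
      case True
      thus ?thesis using d0[of i] M by (simp add: t_def)
    next
      case False
      have "M \<le> sqrt (d i)" using False M by (simp add: real_le_rsqrt)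
      hence "0 \<le> t i" "t i \<le> 1" using M False d0[of i] by (auto simp: t_def divide_le_eq_1)
      hence "(1 - t i)\<^sup>2 * d i \<le> 1 * d i" using d0 by (intro mult_right_mono power_le_one) auto
      also have "\<dots> \<le> (d i / M\<^sup>2) ^ (2 * q) * d i"
        using False M d0[of i] by (intro mult_right_mono one_le_power) auto
      also have "\<dots> = (d i ^ q)\<^sup>2 * d i / M ^ (4 * q)"
        by (simp add: power_divide power_mult[symmetric] power_even_eq mult.commute)
      finally show ?thesis .
    qed
    hence "(\<Sum>i<k. (1 - t i)\<^sup>2 * d i) \<le> (\<Sum>i<k. (d i ^ q)\<^sup>2 * d i) / M ^ (4 * q)"
      by (simp add: sum_divide_distrib sum_mono)
    hence "(\<Sum>i<k. (1 - t i)\<^sup>2 * d i) / k \<le> (\<Sum>i<k. (d i ^ q)\<^sup>2 * d i) / M ^ (4 * q) / k"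
      by (rule divide_right_mono) simp
    thus ?thesis unfolding ZY odd hsF by (simp only: divide_divide_eq_left mult.commute)
  qed
  ultimately show ?thesis using that Y by blast
qed

definition truncate :: "real \<Rightarrow> nat \<Rightarrow> complex mat \<Rightarrow> complex mat" where
  "truncate M k Z = (SOME Y. Y \<in> carrier_mat k k \<and> op_norm Y \<le> M \<and>
     (\<forall>q. (hs_norm k (Z - Y))\<^sup>2 \<le> (hs_norm k (odd_power (mat_calg k) Z q))\<^sup>2 / M ^ (4 * q)))"

lemma truncate:
  assumes "Z \<in> carrier_mat k k" "0 < M"
  shows "truncate M k Z \<in> carrier_mat k k" "op_norm (truncate M k Z) \<le> M"
    "(hs_norm k (Z - truncate M k Z))\<^sup>2 \<le> (hs_norm k (odd_power (mat_calg k) Z q))\<^sup>2 / M ^ (4 * q)"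
proof -
  have "\<exists>Y. Y \<in> carrier_mat k k \<and> op_norm Y \<le> M \<and>
     (\<forall>q. (hs_norm k (Z - Y))\<^sup>2 \<le> (hs_norm k (odd_power (mat_calg k) Z q))\<^sup>2 / M ^ (4 * q))"
    using truncate_mat[OF assms] by metis
  from someI_ex[OF this] show "truncate M k Z \<in> carrier_mat k k" "op_norm (truncate M k Z) \<le> M"
    "(hs_norm k (Z - truncate M k Z))\<^sup>2 \<le> (hs_norm k (odd_power (mat_calg k) Z q))\<^sup>2 / M ^ (4 * q)"
    unfolding truncate_def by auto
qed


section \<open>Parametrizing the unitary group by Hermitian contractions\<close>

lemma hermitian_diag_conj:
  assumes H: "H \<in> carrier_mat k k" "mat_adjoint H = H"
  obtains U h where "U \<in> unitary_mats k" "H = diag_conj k U (\<lambda>i. complex_of_real (h i))"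
proof -
  obtain U d where U: "U \<in> unitary_mats k" and d: "H = diag_conj k U d"
    using normal_mat_unitarily_diagonalizable[OF H(1)] H(2) unfolding diag_conj_def by metis
  have "H = diag_conj k U (\<lambda>i. complex_of_real (Re (d i)))"
  proof -
    have "H = (1/2) \<cdot>\<^sub>m (H + mat_adjoint H)"
      unfolding H(2) using H(1) by (intro eq_matI) auto
    also have "\<dots> = diag_conj k U (\<lambda>i. 1/2 * (d i + cnj (d i)))"
      unfolding d diag_conj_adjoint[OF U] diag_conj_add[OF U] diag_conj_smult[OF U] ..
    also have "\<dots> = diag_conj k U (\<lambda>i. complex_of_real (Re (d i)))"
      by (simp add: complex_add_cnj)
    finally show ?thesis .
  qed
  thus ?thesis using that[OF U, of "\<lambda>i. Re (d i)"] by simp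
qed

lemma op_norm_diag_conj_le:
  assumes U: "U \<in> unitary_mats k" and le: "\<And>i. i < k \<Longrightarrow> cmod (f i) \<le> C" and C: "0 \<le> C"
  shows "op_norm (diag_conj k U f) \<le> C"
proof (rule op_norm_le_diag_conj[OF U])
  have "(\<lambda>i. cnj (f i) * f i) = (\<lambda>i. complex_of_real ((cmod (f i))\<^sup>2))"
    by (simp add: complex_norm_square mult.commute del: of_real_power)
  thus "mat_adjoint (diag_conj k U f) * diag_conj k U f = diag_conj k U (\<lambda>i. complex_of_real ((cmod (f i))\<^sup>2))"
    unfolding diag_conj_adjoint[OF U] diag_conj_mult[OF U] by simp
qed (use assms in \<open>auto intro!: power_mono\<close>)

text \<open>\<open>R\<close> is the inverse of \<open>1 - iH\<close>; it is a contraction when \<open>H\<close> is Hermitian.\<close>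

definition resolvent :: "nat \<Rightarrow> complex mat \<Rightarrow> complex mat \<Rightarrow> bool" where
  "resolvent k H R \<longleftrightarrow> R \<in> carrier_mat k k \<and> op_norm R \<le> 1 \<and>
     (1\<^sub>m k - \<i> \<cdot>\<^sub>m H) * R = 1\<^sub>m k \<and> R * (1\<^sub>m k - \<i> \<cdot>\<^sub>m H) = 1\<^sub>m k"

lemma one_minus_ii_of_real_nonzero: "1 - \<i> * complex_of_real x \<noteq> 0"
  by (auto simp: complex_eq_iff)

lemma resolvent_diag_conj:
  assumes U: "U \<in> unitary_mats k"
  shows "resolvent k (diag_conj k U (\<lambda>i. complex_of_real (h i)))
           (diag_conj k U (\<lambda>i. inverse (1 - \<i> * complex_of_real (h i))))"
  unfolding resolvent_def
proof (intro conjI)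
  have id: "1\<^sub>m k - \<i> \<cdot>\<^sub>m diag_conj k U (\<lambda>i. complex_of_real (h i)) = diag_conj k U (\<lambda>i. 1 - \<i> * complex_of_real (h i))"
    unfolding diag_conj_one[OF U, symmetric] diag_conj_smult[OF U] diag_conj_minus[OF U] ..
  show "op_norm (diag_conj k U (\<lambda>i. inverse (1 - \<i> * complex_of_real (h i)))) \<le> 1"
  proof (rule op_norm_diag_conj_le[OF U])
    fix i
    have "1 \<le> cmod (1 - \<i> * complex_of_real (h i))"
      using abs_Re_le_cmod[of "1 - \<i> * complex_of_real (h i)"] by simp
    thus "cmod (inverse (1 - \<i> * complex_of_real (h i))) \<le> 1"
      by (simp add: norm_inverse inverse_le_1_iff)
  qed simp
  show "(1\<^sub>m k - \<i> \<cdot>\<^sub>m diag_conj k U (\<lambda>i. complex_of_real (h i))) * diag_conj k U (\<lambda>i. inverse (1 - \<i> * complex_of_real (h i))) = 1\<^sub>m k"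
    "diag_conj k U (\<lambda>i. inverse (1 - \<i> * complex_of_real (h i))) * (1\<^sub>m k - \<i> \<cdot>\<^sub>m diag_conj k U (\<lambda>i. complex_of_real (h i))) = 1\<^sub>m k"
    unfolding id diag_conj_mult[OF U] using one_minus_ii_of_real_nonzero
    by (simp_all add: diag_conj_one[OF U])
qed (simp add: diag_conj_closed[OF U])

text \<open>The resolvent identity; it makes the resolvent Lipschitz with constant 1.\<close>

lemma resolvent_diff:
  assumes H: "H \<in> carrier_mat k k" and K: "K \<in> carrier_mat k k"
    and R: "resolvent k H R" and S: "resolvent k K S"
  shows "R - S = \<i> \<cdot>\<^sub>m (R * (H - K) * S)"
proof -
  have c: "R \<in> carrier_mat k k" "S \<in> carrier_mat k k" using R S by (auto simp: resolvent_def)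
  define A where "A = 1\<^sub>m k - \<i> \<cdot>\<^sub>m H"
  define B where "B = 1\<^sub>m k - \<i> \<cdot>\<^sub>m K"
  have AB: "A \<in> carrier_mat k k" "B \<in> carrier_mat k k" using H K by (auto simp: A_def B_def)
  have "R * (B - A) * S = R * B * S - R * A * S"
    using c AB
    by (simp add: mult_minus_distrib_mat[of _ k k _ k] minus_mult_distrib_mat[of _ k k _ _ k] square_mult_closed[of _ k])
  also have "R * B * S = R * (B * S)" using c AB by (intro assoc_mult_mat[of _ k k _ k _ k]) auto
  also have "B * S = 1\<^sub>m k" using S by (simp add: resolvent_def B_def)
  also have "R * A = 1\<^sub>m k" using R by (simp add: resolvent_def A_def)
  finally have "R * (B - A) * S = R - S" using c by simp
  moreover have "B - A = \<i> \<cdot>\<^sub>m (H - K)"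
    using H K by (intro eq_matI) (auto simp: A_def B_def algebra_simps)
  ultimately show ?thesis using c H K
    by (simp add: mult_smult_distrib[of _ k k _ k] mult_smult_assoc_mat[of _ k k _ k] minus_carrier_mat square_mult_closed[of _ k])
qed

lemma hs_norm_resolvent_diff:
  assumes H: "H \<in> carrier_mat k k" and K: "K \<in> carrier_mat k k"
    and R: "resolvent k H R" and S: "resolvent k K S"
  shows "hs_norm k (R - S) \<le> hs_norm k (H - K)"
proof -
  have c: "R \<in> carrier_mat k k" "S \<in> carrier_mat k k" "op_norm R \<le> 1" "op_norm S \<le> 1"
    using R S by (auto simp: resolvent_def)
  have HK: "H - K \<in> carrier_mat k k" using K by (rule minus_carrier_mat)
  have RHK: "R * (H - K) \<in> carrier_mat k k" using c HK by auto
  have "hs_norm k (R - S) = hs_norm k (R * (H - K) * S)"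
    unfolding resolvent_diff[OF assms] using c RHK by (subst hs_norm_smult) auto
  also have "\<dots> \<le> hs_norm k (R * (H - K)) * op_norm S"
    by (rule hs_norm_mult_right[OF RHK c(2)])
  also have "\<dots> \<le> hs_norm k (R * (H - K)) * 1"
    by (rule mult_left_mono[OF c(4) hs_norm_nonneg[OF RHK]])
  also have "\<dots> \<le> op_norm R * hs_norm k (H - K)"
    using hs_norm_mult_left[OF c(1) HK] by simp
  also have "\<dots> \<le> 1 * hs_norm k (H - K)"
    by (rule mult_right_mono[OF c(3) hs_norm_nonneg[OF HK]])
  finally show ?thesis by simp
qed

text \<open>With \<open>C = 2 R - 1 = (1 + iH) / (1 - iH)\<close> the Cayley transform of \<open>H\<close>, \<open>W\<close> is \<open>C^2\<close>. On \<open>[-1, 1]\<close> the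
scalar Cayley transform only covers the right half of the unit circle; its square covers the circle.\<close>

definition unitary_param :: "nat \<Rightarrow> complex mat \<Rightarrow> complex mat \<Rightarrow> bool" where
  "unitary_param k H W \<longleftrightarrow> (\<exists>R. resolvent k H R \<and>
     W = (2 \<cdot>\<^sub>m R - 1\<^sub>m k) * (2 \<cdot>\<^sub>m R - 1\<^sub>m k) \<and> W \<in> unitary_mats k \<and> 2 \<cdot>\<^sub>m R - 1\<^sub>m k \<in> unitary_mats k)"

lemma unitary_diag_conj:
  assumes U: "U \<in> unitary_mats k" and f: "\<And>i. cmod (f i) = 1"
  shows "diag_conj k U f \<in> unitary_mats k"
proof -
  have "(\<lambda>i. cnj (f i) * f i) = (\<lambda>i. 1)"
    using f by (simp add: complex_norm_square[symmetric] mult.commute del: of_real_power) 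
  thus ?thesis
    unfolding unitary_mats_iff diag_conj_adjoint[OF U] diag_conj_mult[OF U]
    by (simp add: diag_conj_one[OF U] diag_conj_closed[OF U])
qed

lemma cayley_scalar:
  "2 * inverse (1 - \<i> * complex_of_real x) - 1 = (1 + \<i> * complex_of_real x) / (1 - \<i> * complex_of_real x)"
  using one_minus_ii_of_real_nonzero[of x] by (simp add: field_simps)

lemma unitary_param_diag_conj:
  assumes U: "U \<in> unitary_mats k"
  shows "unitary_param k (diag_conj k U (\<lambda>i. complex_of_real (h i)))
    (diag_conj k U (\<lambda>i. ((1 + \<i> * complex_of_real (h i)) / (1 - \<i> * complex_of_real (h i)))\<^sup>2))"
proof -
  have m: "cmod ((1 + \<i> * complex_of_real x) / (1 - \<i> * complex_of_real x)) = 1" for x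
  proof -
    have "cmod (1 + \<i> * complex_of_real x) = cmod (cnj (1 + \<i> * complex_of_real x))"
      by (rule complex_mod_cnj[symmetric])
    also have "cnj (1 + \<i> * complex_of_real x) = 1 - \<i> * complex_of_real x" by simp
    finally show ?thesis using one_minus_ii_of_real_nonzero[of x] by (simp add: norm_divide)
  qed
  define f where "f i = (1 + \<i> * complex_of_real (h i)) / (1 - \<i> * complex_of_real (h i))" for i
  have mf: "cmod (f i) = 1" for i unfolding f_def by (rule m)
  have id: "2 \<cdot>\<^sub>m diag_conj k U (\<lambda>i. inverse (1 - \<i> * complex_of_real (h i))) - 1\<^sub>m k = diag_conj k U f"
    unfolding diag_conj_one[OF U, symmetric] diag_conj_smult[OF U] diag_conj_minus[OF U] cayley_scalar f_def ..
  have "diag_conj k U (\<lambda>i. (f i)\<^sup>2) \<in> unitary_mats k"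
    by (rule unitary_diag_conj[OF U]) (simp add: norm_power mf)
  hence "unitary_param k (diag_conj k U (\<lambda>i. complex_of_real (h i))) (diag_conj k U (\<lambda>i. (f i)\<^sup>2))"
    unfolding unitary_param_def
    by (intro exI[of _ "diag_conj k U (\<lambda>i. inverse (1 - \<i> * complex_of_real (h i)))"])
       (simp add: id resolvent_diag_conj[OF U] diag_conj_mult[OF U] power2_eq_square
         unitary_diag_conj[OF U] mf)
  thus ?thesis unfolding f_def .
qed

lemma unitary_param_exists:
  assumes "H \<in> carrier_mat k k" "mat_adjoint H = H"
  shows "\<exists>W. unitary_param k H W"
  using hermitian_diag_conj[OF assms] unitary_param_diag_conj by metis

text \<open>The fourth root \<open>z\<close> of \<open>u\<close> with argument in \<open>[-pi/4, pi/4]\<close> has \<open>|Im z| \<le> Re z\<close>, and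
\<open>(1 + ix) / (1 - ix) = z / cnj z = z^2\<close> for \<open>x = Im z / Re z\<close>.\<close>

lemma unit_complex_cayley:
  assumes "cmod u = 1"
  obtains x :: real where "\<bar>x\<bar> \<le> 1" "((1 + \<i> * complex_of_real x) / (1 - \<i> * complex_of_real x))\<^sup>2 = u"
proof -
  define z where "z = csqrt (csqrt u)"
  have z2: "z\<^sup>2 = csqrt u" by (simp add: z_def)
  have z4: "(z\<^sup>2)\<^sup>2 = u" by (simp add: z2)
  have "cmod z ^ 4 = 1" using arg_cong[OF z4, of cmod] assms by (simp add: norm_power)
  hence mz: "cmod z = 1" 
    by (metis norm_ge_zero power_eq_1_iff real_norm_def abs_of_nonneg zero_neq_numeral)
  have "0 \<le> Re (z\<^sup>2)" unfolding z2 by (rule Re_csqrt)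
  hence le: "(Im z)\<^sup>2 \<le> (Re z)\<^sup>2" by (simp add: power2_eq_square)
  have sq: "(Re z)\<^sup>2 + (Im z)\<^sup>2 = 1" using mz by (simp add: cmod_def)
  have re0: "Re z \<noteq> 0" using le sq by (cases "Re z = 0") auto
  define x where "x = Im z / Re z"
  have x1: "\<bar>x\<bar> \<le> 1" using le re0 by (simp add: x_def abs_le_square_iff[symmetric] divide_le_eq_1)
  have "1 + \<i> * complex_of_real x = z / Re z" "1 - \<i> * complex_of_real x = cnj z / Re z"
    using re0 by (simp_all add: x_def complex_eq_iff)
  hence "(1 + \<i> * complex_of_real x) / (1 - \<i> * complex_of_real x) = z / cnj z"
    using re0 by simp
  also have "\<dots> = z\<^sup>2"
  proof -
    have "z * cnj z = 1" using mz by (simp add: complex_norm_square[symmetric] del: of_real_power)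
    hence "inverse (cnj z) = z" by (metis inverse_unique mult.commute)
    thus ?thesis by (simp add: divide_inverse power2_eq_square)
  qed
  finally have "((1 + \<i> * complex_of_real x) / (1 - \<i> * complex_of_real x))\<^sup>2 = u" using z4 by simp
  thus ?thesis using that x1 by blast
qed

lemma unitary_param_surj:
  assumes V: "V \<in> unitary_mats k"
  obtains H where "H \<in> carrier_mat k k" "mat_adjoint H = H" "op_norm H \<le> 1" "unitary_param k H V"
proof -
  note Vu = unitary_matsD[OF V]
  obtain U d where U: "U \<in> unitary_mats k" and d: "V = diag_conj k U d"
    using normal_mat_unitarily_diagonalizable[OF Vu(1)] Vu unfolding diag_conj_def by metis
  note Uu = unitary_matsD[OF U]
  have dc_inj: "f i = g i" if eq: "diag_conj k U f = diag_conj k U g" and i: "i < k" for f g i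
  proof -
    have c: "mat_adjoint U * diag_conj k U f * U = mat_diag k f" for f
    proof -
      note [simp] = square_mult_closed[of _ k] assoc_mult_mat[of _ k k _ k _ k]
      have "mat_adjoint U * (U * X) = X" if "X \<in> carrier_mat k k" for X
        using Uu that by (simp flip: assoc_mult_mat[of _ k k _ k _ k])
      thus ?thesis using Uu by (simp add: diag_conj_def right_mult_one_mat[of _ k k])
    qed
    have "mat_diag k f = mat_diag k g" using c[of f] c[of g] eq by simp
    from arg_cong[OF this, of "\<lambda>X. X $$ (i, i)"] i show ?thesis by (simp add: mat_diag_def)
  qed
  have "diag_conj k U (\<lambda>i. cnj (d i) * d i) = diag_conj k U (\<lambda>_. 1)"
    using Vu(2) unfolding d diag_conj_adjoint[OF U] diag_conj_mult[OF U] diag_conj_one[OF U] .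
  hence "cnj (d i) * d i = 1" if "i < k" for i using dc_inj that by blast
  hence "cmod (d i) = 1" if "i < k" for i
    using that by (metis complex_mod_cnj norm_mult norm_one power2_eq_1_iff power2_eq_square norm_ge_zero not_one_le_zero real_sqrt_abs2 real_sqrt_one abs_norm_cancel)
  hence "\<exists>x::real. \<bar>x\<bar> \<le> 1 \<and> (i < k \<longrightarrow> ((1 + \<i> * complex_of_real x) / (1 - \<i> * complex_of_real x))\<^sup>2 = d i)" for i
    using unit_complex_cayley[of "d i"] by (cases "i < k") (metis, auto intro: exI[of _ 0])
  then obtain h :: "nat \<Rightarrow> real" where h: "\<And>i. \<bar>h i\<bar> \<le> 1"
    "\<And>i. i < k \<Longrightarrow> ((1 + \<i> * complex_of_real (h i)) / (1 - \<i> * complex_of_real (h i)))\<^sup>2 = d i"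
    by metis
  have "mat_diag k (\<lambda>i. ((1 + \<i> * complex_of_real (h i)) / (1 - \<i> * complex_of_real (h i)))\<^sup>2) = mat_diag k d"
    by (rule eq_matI) (auto simp: mat_diag_def h(2))
  hence "V = diag_conj k U (\<lambda>i. ((1 + \<i> * complex_of_real (h i)) / (1 - \<i> * complex_of_real (h i)))\<^sup>2)"
    unfolding d diag_conj_def by simp
  hence "unitary_param k (diag_conj k U (\<lambda>i. complex_of_real (h i))) V"
    using unitary_param_diag_conj[OF U, of h] by simp
  moreover have "op_norm (diag_conj k U (\<lambda>i. complex_of_real (h i))) \<le> 1"
    by (rule op_norm_diag_conj_le[OF U]) (use h in auto)
  ultimately show ?thesis
    using that[of "diag_conj k U (\<lambda>i. complex_of_real (h i))"] diag_conj_closed[OF U] diag_conj_adjoint[OF U]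
    by simp
qed

lemma op_norm_unitary:
  assumes "U \<in> unitary_mats k"
  shows "op_norm U \<le> 1"
proof (rule op_norm_leI)
  note Uu = unitary_matsD[OF assms]
  fix v :: "complex vec" assume "v \<in> carrier_vec (dim_col U)"
  hence "v \<in> carrier_vec k" using Uu by simp
  from vec_norm2_unitary[OF unitary_mats_adjoint[OF assms] this]
  show "vec_norm2 (U *\<^sub>v v) \<le> 1 * vec_norm2 v" by simp
qed simp

text \<open>Resolvents, hence \<open>C = 2 R - 1\<close>, depend on \<open>H\<close> with Lipschitz constants 1 and 2; squaring unitaries doubles
the constant since \<open>C^2 - D^2 = C (C - D) + (C - D) D\<close>.\<close>

lemma unitary_param_Lipschitz:
  assumes H: "H \<in> carrier_mat k k" and K: "K \<in> carrier_mat k k"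
    and V: "unitary_param k H V" and W: "unitary_param k K W"
  shows "hs_norm k (V - W) \<le> 4 * hs_norm k (H - K)"
proof -
  obtain R where R: "resolvent k H R" and VR: "V = (2 \<cdot>\<^sub>m R - 1\<^sub>m k) * (2 \<cdot>\<^sub>m R - 1\<^sub>m k)"
    and CR: "2 \<cdot>\<^sub>m R - 1\<^sub>m k \<in> unitary_mats k" using V by (auto simp: unitary_param_def)
  obtain S where S: "resolvent k K S" and WS: "W = (2 \<cdot>\<^sub>m S - 1\<^sub>m k) * (2 \<cdot>\<^sub>m S - 1\<^sub>m k)"
    and CS: "2 \<cdot>\<^sub>m S - 1\<^sub>m k \<in> unitary_mats k" using W by (auto simp: unitary_param_def)
  define C where "C = 2 \<cdot>\<^sub>m R - 1\<^sub>m k"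
  define D where "D = 2 \<cdot>\<^sub>m S - 1\<^sub>m k"
  have c: "C \<in> carrier_mat k k" "D \<in> carrier_mat k k" "op_norm C \<le> 1" "op_norm D \<le> 1"
    using CR CS op_norm_unitary unitary_matsD(1) by (auto simp: C_def D_def)
  have CDc: "C - D \<in> carrier_mat k k" using c(2) by (rule minus_carrier_mat)
  have RS: "R \<in> carrier_mat k k" "S \<in> carrier_mat k k" using R S by (auto simp: resolvent_def)
  have "C - D = 2 \<cdot>\<^sub>m (R - S)" using RS by (intro eq_matI) (auto simp: C_def D_def algebra_simps)
  hence CD: "hs_norm k (C - D) \<le> 2 * hs_norm k (H - K)"
    using hs_norm_resolvent_diff[OF H K R S] RS by (simp add: hs_norm_smult minus_carrier_mat)
  have "V - W = C * (C - D) + (C - D) * D"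
  proof -
    have "C * (C - D) + (C - D) * D = (C * C - C * D) + (C * D - D * D)"
      using c by (simp add: mult_minus_distrib_mat[of _ k k _ k] minus_mult_distrib_mat[of _ k k _ _ k])
    also have "\<dots> = C * C - D * D"
      using c by (intro eq_matI) (auto simp del: index_mult_mat(1))
    finally show ?thesis by (simp add: VR WS C_def D_def)
  qed
  hence "hs_norm k (V - W) \<le> hs_norm k (C * (C - D)) + hs_norm k ((C - D) * D)"
    using hs_norm_add[of "C * (C - D)" k "(C - D) * D"] c CDc by (simp add: square_mult_closed[of _ k])
  also have "\<dots> \<le> op_norm C * hs_norm k (C - D) + hs_norm k (C - D) * op_norm D"
    by (intro add_mono hs_norm_mult_left hs_norm_mult_right c CDc)
  also have "\<dots> \<le> 1 * hs_norm k (C - D) + hs_norm k (C - D) * 1"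
    by (intro add_mono mult_left_mono mult_right_mono c hs_norm_nonneg CDc)
  finally show ?thesis using CD by simp
qed


section \<open>Covering the unitary group\<close>

lemma sum_exp_int_le:
  fixes u :: real and m :: nat
  assumes u: "0 < u"
  shows "(\<Sum>z\<in>{- int m..int m}. exp (- u * \<bar>real_of_int z\<bar>)) \<le> 2 * (1 + 1 / u)"
proof -
  let ?x = "exp (- u)"
  have x: "0 < ?x" "?x < 1" using u by auto
  have geo: "(\<Sum>n\<le>m. ?x ^ n) \<le> 1 / (1 - ?x)"
  proof -
    have "(\<Sum>n\<le>m. ?x ^ n) \<le> (\<Sum>n. ?x ^ n)"
      by (rule sum_le_suminf) (use x in \<open>auto intro: summable_geometric\<close>)
    thus ?thesis using x by (simp add: suminf_geometric)
  qed
  have e: "exp (- u * \<bar>real_of_int z\<bar>) = ?x ^ nat \<bar>z\<bar>" for z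
    by (simp add: exp_of_nat_mult[symmetric] mult.commute)
  have "(\<Sum>z\<in>{- int m..int m}. exp (- u * \<bar>real_of_int z\<bar>))
      \<le> (\<Sum>z\<in>int ` {..m} \<union> (\<lambda>n. - int n) ` {..m}. ?x ^ nat \<bar>z\<bar>)"
    unfolding e
  proof (rule sum_mono2)
    show "{- int m..int m} \<subseteq> int ` {..m} \<union> (\<lambda>n. - int n) ` {..m}"
    proof
      fix z assume z: "z \<in> {- int m..int m}"
      show "z \<in> int ` {..m} \<union> (\<lambda>n. - int n) ` {..m}"
        by (cases "0 \<le> z") (use z in \<open>auto intro!: image_eqI[of _ _ "nat \<bar>z\<bar>"]\<close>)
    qed
  qed auto
  also have "\<dots> \<le> (\<Sum>z\<in>int ` {..m}. ?x ^ nat \<bar>z\<bar>) + (\<Sum>z\<in>(\<lambda>n. - int n) ` {..m}. ?x ^ nat \<bar>z\<bar>)"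
    by (subst sum_Un) (auto intro!: sum_nonneg)
  also have "\<dots> = 2 * (\<Sum>n\<le>m. ?x ^ n)"
    by (subst (1 2) sum.reindex) (auto simp: inj_on_def)
  also have "\<dots> \<le> 2 * (1 / (1 - ?x))" using geo by simp
  also have "1 / (1 - ?x) \<le> 1 + 1 / u"
  proof -
    have "1 + u \<le> exp u" by (rule exp_ge_add_one_self)
    hence "?x \<le> 1 / (1 + u)" using u by (simp add: exp_minus field_simps)
    hence "u / (1 + u) \<le> 1 - ?x" using u by (simp add: field_simps)
    hence "1 / (1 - ?x) \<le> 1 / (u / (1 + u))" using u by (intro divide_left_mono) auto
    also have "\<dots> = 1 + 1 / u" using u by (simp add: field_simps)
    finally show ?thesis .
  qed
  finally show ?thesis by simp
qed

text \<open>Weight each lattice point \<open>g\<close> by \<open>exp (- |g|_1 / L)\<close>. Points of the ball have weight at least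
\<open>exp (- card P)\<close>, and the total weight is a product of geometric series, at most \<open>(2 (1 + L))^card P\<close>. The
constant 6 is \<open>2 * 3\<close> with \<open>exp 1 \<le> 3\<close>.\<close>

lemma card_lattice_l1_ball:
  fixes L :: real
  assumes P: "finite P" and L: "0 < L"
  shows "finite {g \<in> P \<rightarrow>\<^sub>E (UNIV :: int set). (\<Sum>p\<in>P. \<bar>real_of_int (g p)\<bar>) \<le> card P * L}" (is "finite ?G")
    and "real (card {g \<in> P \<rightarrow>\<^sub>E (UNIV :: int set). (\<Sum>p\<in>P. \<bar>real_of_int (g p)\<bar>) \<le> card P * L})
      \<le> (6 * (1 + L)) ^ card P"
proof -
  define m where "m = nat \<lceil>card P * L\<rceil>"
  have sub: "?G \<subseteq> P \<rightarrow>\<^sub>E {- int m..int m}"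
  proof
    fix g assume g: "g \<in> ?G"
    have "g p \<in> {- int m..int m}" if p: "p \<in> P" for p
    proof -
      have "\<bar>real_of_int (g p)\<bar> \<le> (\<Sum>p\<in>P. \<bar>real_of_int (g p)\<bar>)"
        using P p by (intro member_le_sum) auto
      also have "\<dots> \<le> card P * L" using g by simp
      also have "\<dots> \<le> real m" unfolding m_def using L by linarith
      finally show ?thesis by simp linarith
    qed
    thus "g \<in> P \<rightarrow>\<^sub>E {- int m..int m}" using g by (auto simp: PiE_iff)
  qed
  have fin: "finite (P \<rightarrow>\<^sub>E {- int m..int m})" using P by (intro finite_PiE) auto
  show finG: "finite ?G" by (rule finite_subset[OF sub fin])
  have u: "0 < 1 / L" using L by simp
  have "real (card ?G) * exp (- real (card P)) = (\<Sum>g\<in>?G. exp (- real (card P)))" by simp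
  also have "\<dots> \<le> (\<Sum>g\<in>?G. \<Prod>p\<in>P. exp (- (1 / L) * \<bar>real_of_int (g p)\<bar>))"
  proof (rule sum_mono)
    fix g assume g: "g \<in> ?G"
    hence "(\<Sum>p\<in>P. \<bar>real_of_int (g p)\<bar>) / L \<le> card P" using L by (simp add: divide_le_eq)
    hence "exp (- real (card P)) \<le> exp (\<Sum>p\<in>P. - (1 / L) * \<bar>real_of_int (g p)\<bar>)"
      by (simp add: sum_distrib_left[symmetric] sum_negf sum_divide_distrib[symmetric])
    thus "exp (- real (card P)) \<le> (\<Prod>p\<in>P. exp (- (1 / L) * \<bar>real_of_int (g p)\<bar>))"
      using P by (simp add: exp_sum)
  qed
  also have "\<dots> \<le> (\<Sum>g\<in>P \<rightarrow>\<^sub>E {- int m..int m}. \<Prod>p\<in>P. exp (- (1 / L) * \<bar>real_of_int (g p)\<bar>))"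
    by (rule sum_mono2[OF fin sub]) (auto intro!: prod_nonneg)
  also have "\<dots> = (\<Prod>p\<in>P. \<Sum>z\<in>{- int m..int m}. exp (- (1 / L) * \<bar>real_of_int z\<bar>))"
    by (rule prod_sum_PiE[symmetric]) (use P in auto)
  also have "\<dots> \<le> (\<Prod>p\<in>P. 2 * (1 + L))"
    using sum_exp_int_le[OF u, of m] by (intro prod_mono) (auto intro!: sum_nonneg)
  also have "\<dots> = (2 * (1 + L)) ^ card P" by simp
  finally have "real (card ?G) \<le> (2 * (1 + L)) ^ card P * exp (real (card P))"
    by (simp add: exp_minus field_simps)
  also have "exp (real (card P)) = exp 1 ^ card P" by (simp add: exp_of_nat_mult[symmetric])
  also have "(2 * (1 + L)) ^ card P * exp 1 ^ card P = (2 * (1 + L) * exp 1) ^ card P"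
    by (simp add: power_mult_distrib)
  also have "\<dots> \<le> (6 * (1 + L)) ^ card P"
  proof (rule power_mono)
    have "2 * (1 + L) * exp 1 \<le> 2 * (1 + L) * 3" using L exp_le by (intro mult_left_mono) auto
    thus "2 * (1 + L) * exp 1 \<le> 6 * (1 + L)" by simp
  qed (use L in auto)
  finally show "real (card ?G) \<le> (6 * (1 + L)) ^ card P" .
qed

text \<open>The \<open>k^2\<close> real coordinates of a Hermitian matrix: real parts on and above the diagonal, imaginary parts
below it.\<close>

definition herm_mat :: "nat \<Rightarrow> (nat \<times> nat \<Rightarrow> real) \<Rightarrow> complex mat" where
  "herm_mat k h = mat k k (\<lambda>(i, j).
     if i = j then of_real (h (i, i))
     else if i < j then Complex (h (i, j)) (h (j, i)) else Complex (h (j, i)) (- h (i, j)))"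

definition herm_coords :: "complex mat \<Rightarrow> nat \<times> nat \<Rightarrow> real" where
  "herm_coords H = (\<lambda>(i, j). if i \<le> j then Re (H $$ (i, j)) else Im (H $$ (j, i)))"

lemma herm_mat_closed [simp]: "herm_mat k h \<in> carrier_mat k k"
  by (simp add: herm_mat_def)

lemma herm_mat_adjoint: "mat_adjoint (herm_mat k h) = herm_mat k h"
  by (rule eq_matI) (auto simp: herm_mat_def complex_eq_iff)

lemma herm_mat_coords:
  assumes H: "H \<in> carrier_mat k k" "mat_adjoint H = H"
  shows "herm_mat k (herm_coords H) = H"
proof (rule eq_matI)
  fix i j assume "i < dim_row H" "j < dim_col H"
  hence ij: "i < k" "j < k" using H by auto
  have *: "H $$ (a, b) = cnj (H $$ (b, a))" if "a < k" "b < k" for a b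
    using arg_cong[OF H(2), of "\<lambda>X. X $$ (a, b)"] that H(1) by simp
  show "herm_mat k (herm_coords H) $$ (i, j) = H $$ (i, j)"
    using ij *[of i i] *[of i j] by (auto simp: herm_mat_def herm_coords_def complex_eq_iff)
qed (use H in \<open>auto simp: herm_mat_def\<close>)

lemma hs_norm_herm_mat_diff:
  assumes k: "0 < k" and eta: "0 \<le> \<eta>"
    and le: "\<And>i j. i < k \<Longrightarrow> j < k \<Longrightarrow> \<bar>h (i, j) - g (i, j)\<bar> \<le> \<eta> / 2"
  shows "hs_norm k (herm_mat k h - herm_mat k g) \<le> \<eta> * sqrt k"
proof -
  have "cmod ((herm_mat k h - herm_mat k g) $$ (i, j)) \<le> \<eta>" if "i < k" "j < k" for i j
  proof -
    let ?z = "(herm_mat k h - herm_mat k g) $$ (i, j)"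
    have "\<bar>Re ?z\<bar> \<le> \<eta> / 2" "\<bar>Im ?z\<bar> \<le> \<eta> / 2"
      using that le[of i j] le[of j i] eta by (auto simp: herm_mat_def abs_minus_commute)
    thus ?thesis using cmod_le[of ?z] by linarith
  qed
  hence "L2_set (\<lambda>(i, j). cmod ((herm_mat k h - herm_mat k g) $$ (i, j))) ({..<k} \<times> {..<k})
      \<le> L2_set (\<lambda>_. \<eta>) ({..<k} \<times> {..<k})"
    by (intro L2_set_mono) auto
  also have "\<dots> = \<eta> * real k" using eta by (simp add: L2_set_constant real_sqrt_mult)
  finally show ?thesis using k
    by (subst hs_norm_L2_set) (auto simp: divide_le_eq minus_carrier_mat mult.assoc)
qed

text \<open>Cauchy-Schwarz: the coordinates have squared sum at most \<open>k\<close>, and there are \<open>k^2\<close> of them.\<close>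

lemma herm_coords_l1_le:
  assumes k: "0 < k" and H: "H \<in> carrier_mat k k" "mat_adjoint H = H" and le: "op_norm H \<le> 1"
  shows "(\<Sum>p\<in>{..<k} \<times> {..<k}. \<bar>herm_coords H p\<bar>) \<le> k * sqrt k"
proof -
  let ?P = "{..<k} \<times> {..<k}"
  have "hs_norm k (H * 1\<^sub>m k) \<le> op_norm H * hs_norm k (1\<^sub>m k)"
    by (rule hs_norm_mult_left) (use H in auto)
  moreover have "hs_norm k (1\<^sub>m k) = 1" using k by (simp add: hs_norm_def ntrace_one)
  ultimately have "hs_norm k H \<le> 1" using H le by simp
  hence L2: "L2_set (\<lambda>(i, j). cmod (H $$ (i, j))) ?P \<le> sqrt k"
    using k H by (simp add: hs_norm_L2_set divide_le_eq)
  have sym: "cmod (H $$ (a, b)) = cmod (H $$ (b, a))" if "a < k" "b < k" for a b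
    using arg_cong[OF H(2), of "\<lambda>X. X $$ (a, b)"] that H(1) by (metis index_mat_adjoint carrier_matD complex_mod_cnj conjugate_complex_def)
  have "(\<Sum>p\<in>?P. \<bar>herm_coords H p\<bar>) \<le> (\<Sum>p\<in>?P. \<bar>1\<bar> * \<bar>case p of (i, j) \<Rightarrow> cmod (H $$ (i, j))\<bar>)"
  proof (rule sum_mono)
    fix p assume "p \<in> ?P"
    then obtain i j where p: "p = (i, j)" "i < k" "j < k" by auto
    show "\<bar>herm_coords H p\<bar> \<le> \<bar>1\<bar> * \<bar>case p of (i, j) \<Rightarrow> cmod (H $$ (i, j))\<bar>"
      using sym[of i j] p abs_Re_le_cmod[of "H $$ (i, j)"] abs_Im_le_cmod[of "H $$ (j, i)"]
      by (auto simp: herm_coords_def)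
  qed
  also have "\<dots> \<le> L2_set (\<lambda>_. 1) ?P * L2_set (\<lambda>(i, j). cmod (H $$ (i, j))) ?P"
    by (rule L2_set_mult_ineq)
  also have "\<dots> \<le> k * sqrt k" using L2
    by (simp add: L2_set_constant real_sqrt_mult mult_left_mono)
  finally show ?thesis .
qed

text \<open>Round every coordinate to the lattice of mesh \<open>\<eta> = \<delta> / sqrt k\<close>: this moves \<open>H\<close> by at most
\<open>\<eta> sqrt k = \<delta>\<close>. The rounded coordinates, in units of \<open>\<eta>\<close>, have \<open>l1\<close> norm at most
\<open>k sqrt k / \<eta> + k^2 = k^2 (1 + 1 / \<delta>)\<close>, so lattice points can be counted in dimension \<open>k^2\<close>.\<close>

lemma hermitian_ball_cover:
  fixes \<delta> :: real
  assumes k: "0 < k" and d: "0 < \<delta>" "\<delta> \<le> 1"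
  obtains \<K> where "finite \<K>" "real (card \<K>) \<le> (18 / \<delta>) ^ k\<^sup>2"
    "\<And>K. K \<in> \<K> \<Longrightarrow> K \<in> carrier_mat k k \<and> mat_adjoint K = K"
    "\<And>H. H \<in> carrier_mat k k \<Longrightarrow> mat_adjoint H = H \<Longrightarrow> op_norm H \<le> 1 \<Longrightarrow>
       \<exists>K\<in>\<K>. hs_norm k (H - K) \<le> \<delta>"
proof -
  let ?P = "{..<k} \<times> {..<k}"
  define \<eta> where "\<eta> = \<delta> / sqrt k"
  have eta: "0 < \<eta>" using k d by (simp add: \<eta>_def)
  define L where "L = 1 + 1 / \<delta>"
  have L: "0 < L" using d by (simp add: L_def add_pos_pos)
  have cP: "card ?P = k\<^sup>2" by (simp add: power2_eq_square)
  define G where "G = {g \<in> ?P \<rightarrow>\<^sub>E (UNIV :: int set). (\<Sum>p\<in>?P. \<bar>real_of_int (g p)\<bar>) \<le> card ?P * L}"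
  have G: "finite G" "real (card G) \<le> (6 * (1 + L)) ^ k\<^sup>2"
    using card_lattice_l1_ball[of ?P L] L unfolding G_def cP by auto
  define \<K> where "\<K> = (\<lambda>g. herm_mat k (\<lambda>p. \<eta> * real_of_int (g p))) ` G"
  show ?thesis
  proof (rule that)
    show "finite \<K>" using G by (simp add: \<K>_def)
    have "real (card \<K>) \<le> real (card G)" unfolding \<K>_def using card_image_le[OF G(1)] by simp
    also have "\<dots> \<le> (6 * (1 + L)) ^ k\<^sup>2" by (rule G(2))
    also have "\<dots> \<le> (18 / \<delta>) ^ k\<^sup>2"
    proof (rule power_mono)
      have "12 \<le> 12 / \<delta>" using d by (simp add: le_divide_eq)
      thus "6 * (1 + L) \<le> 18 / \<delta>" by (simp add: L_def)
    qed (use L in auto)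
    finally show "real (card \<K>) \<le> (18 / \<delta>) ^ k\<^sup>2" .
    show "K \<in> carrier_mat k k \<and> mat_adjoint K = K" if "K \<in> \<K>" for K
      using that by (auto simp: \<K>_def herm_mat_adjoint)
  next
    fix H assume H: "H \<in> carrier_mat k k" "mat_adjoint H = H" "op_norm H \<le> 1"
    define g where "g = restrict (\<lambda>p. round (herm_coords H p / \<eta>)) ?P"
    have r: "\<bar>herm_coords H p / \<eta> - real_of_int (round (herm_coords H p / \<eta>))\<bar> \<le> 1 / 2" for p
      using of_int_round_abs_le[of "herm_coords H p / \<eta>"] by (simp add: abs_minus_commute)
    have "g \<in> G"
    proof -
      have "(\<Sum>p\<in>?P. \<bar>real_of_int (g p)\<bar>) \<le> (\<Sum>p\<in>?P. \<bar>herm_coords H p\<bar> / \<eta> + 1)"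
      proof (rule sum_mono)
        fix p assume "p \<in> ?P"
        hence "g p = round (herm_coords H p / \<eta>)" by (simp add: g_def)
        moreover have "\<bar>herm_coords H p\<bar> / \<eta> = \<bar>herm_coords H p / \<eta>\<bar>" using eta by simp
        ultimately show "\<bar>real_of_int (g p)\<bar> \<le> \<bar>herm_coords H p\<bar> / \<eta> + 1"
          using r[of p] by linarith
      qed
      also have "\<dots> = (\<Sum>p\<in>?P. \<bar>herm_coords H p\<bar>) / \<eta> + k\<^sup>2"
        by (simp add: sum.distrib sum_divide_distrib power2_eq_square)
      also have "\<dots> \<le> k * sqrt k / \<eta> + k\<^sup>2"
        using herm_coords_l1_le[OF k H] eta by (simp add: divide_right_mono)
      also have "\<dots> = card ?P * L"
        using k d unfolding cP L_def \<eta>_def by (simp add: field_simps power2_eq_square)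
      finally show ?thesis by (auto simp: G_def g_def)
    qed
    hence "herm_mat k (\<lambda>p. \<eta> * real_of_int (g p)) \<in> \<K>" by (auto simp: \<K>_def)
    moreover have "hs_norm k (herm_mat k (herm_coords H) - herm_mat k (\<lambda>p. \<eta> * real_of_int (g p))) \<le> \<eta> * sqrt k"
    proof (rule hs_norm_herm_mat_diff[OF k])
      fix i j assume ij: "i < k" "j < k"
      have "herm_coords H (i, j) - \<eta> * real_of_int (g (i, j))
          = \<eta> * (herm_coords H (i, j) / \<eta> - real_of_int (round (herm_coords H (i, j) / \<eta>)))"
        using eta ij by (simp add: g_def right_diff_distrib)
      hence "\<bar>herm_coords H (i, j) - \<eta> * real_of_int (g (i, j))\<bar>
          = \<eta> * \<bar>herm_coords H (i, j) / \<eta> - real_of_int (round (herm_coords H (i, j) / \<eta>))\<bar>"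
        using eta by (simp only: abs_mult abs_of_pos)
      also have "\<dots> \<le> \<eta> * (1 / 2)" using r eta by (intro mult_left_mono) auto
      finally show "\<bar>herm_coords H (i, j) - \<eta> * real_of_int (g (i, j))\<bar> \<le> \<eta> / 2" by simp
    qed (use eta in simp)
    moreover have "\<eta> * sqrt k = \<delta>" using k by (simp add: \<eta>_def)
    ultimately show "\<exists>K\<in>\<K>. hs_norm k (H - K) \<le> \<delta>"
      unfolding herm_mat_coords[OF H(1,2)] by metis
  qed
qed

theorem unitary_cover:
  fixes \<delta> :: real
  assumes k: "0 < k" and d: "0 < \<delta>" "\<delta> \<le> 1"
  obtains \<V> where "finite \<V>" "\<V> \<subseteq> unitary_mats k" "real (card \<V>) \<le> (18 / \<delta>) ^ k\<^sup>2"
    "\<And>U. U \<in> unitary_mats k \<Longrightarrow> \<exists>V\<in>\<V>. hs_norm k (U - V) \<le> 4 * \<delta>"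
proof -
  obtain \<K> where K: "finite \<K>" "real (card \<K>) \<le> (18 / \<delta>) ^ k\<^sup>2"
    "\<And>K. K \<in> \<K> \<Longrightarrow> K \<in> carrier_mat k k \<and> mat_adjoint K = K"
    "\<And>H. H \<in> carrier_mat k k \<Longrightarrow> mat_adjoint H = H \<Longrightarrow> op_norm H \<le> 1 \<Longrightarrow>
       \<exists>K\<in>\<K>. hs_norm k (H - K) \<le> \<delta>"
    using hermitian_ball_cover[OF assms] by metis
  define w where "w K = (SOME W. unitary_param k K W)" for K
  have w: "unitary_param k K (w K)" if "K \<in> \<K>" for K
    unfolding w_def using unitary_param_exists K(3)[OF that] by (metis someI_ex)
  show ?thesis
  proof (rule that[of "w ` \<K>"])
    show "finite (w ` \<K>)" using K by simp
    show "w ` \<K> \<subseteq> unitary_mats k" using w by (auto simp: unitary_param_def)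
    have "real (card (w ` \<K>)) \<le> real (card \<K>)" using card_image_le[OF K(1)] by simp
    thus "real (card (w ` \<K>)) \<le> (18 / \<delta>) ^ k\<^sup>2" using K(2) by simp
    fix U assume U: "U \<in> unitary_mats k"
    obtain H where H: "H \<in> carrier_mat k k" "mat_adjoint H = H" "op_norm H \<le> 1" "unitary_param k H U"
      using unitary_param_surj[OF U] .
    obtain K where KK: "K \<in> \<K>" "hs_norm k (H - K) \<le> \<delta>" using K(4)[OF H(1-3)] by blast
    have "hs_norm k (U - w K) \<le> 4 * hs_norm k (H - K)"
      using unitary_param_Lipschitz[OF H(1) _ H(4) w[OF KK(1)]] K(3)[OF KK(1)] by blast
    thus "\<exists>V\<in>w ` \<K>. hs_norm k (U - V) \<le> 4 * \<delta>" using KK by force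
  qed
qed


section \<open>Positive functionals and contractivity in C*-algebras\<close>

context unital_cstar_algebra
begin

lemma smult_closed [simp]: "x \<in> carrier A \<Longrightarrow> c \<odot> x \<in> carrier A"
  using scalar.smult_closed[of c x] by simp

lemma a_inv_eq_smult: "x \<in> carrier A \<Longrightarrow> \<ominus> x = (-1) \<odot> x"
proof -
  assume x: "x \<in> carrier A"
  have "((1::complex) + -1) \<odot> x = 1 \<odot> x \<oplus> (-1) \<odot> x"
    using scalar.smult_l_distr[of 1 "-1" x] x by simp
  hence "(-1) \<odot> x \<oplus> x = \<zero>"
    using x scalar.smult_l_null[OF x] scalar.smult_one[OF x] a_comm[of x "(-1) \<odot> x"] by simp
  thus ?thesis using x by (simp add: minus_equality)
qed

lemma cnorm_a_inv: "x \<in> carrier A \<Longrightarrow> cnorm A (\<ominus> x) = cnorm A x"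
  by (simp add: a_inv_eq_smult cnorm_smult)

lemma cnorm_zero [simp]: "cnorm A \<zero> = 0"
  by (simp add: cnorm_eq_0)

lemma cnorm_minus_commute:
  assumes "x \<in> carrier A" "y \<in> carrier A"
  shows "cnorm A (x \<ominus> y) = cnorm A (y \<ominus> x)"
proof -
  have "y \<ominus> x = \<ominus> (x \<ominus> y)" using assms by algebra
  thus ?thesis using assms by (simp add: cnorm_a_inv)
qed

lemma cnorm_minus_le:
  "x \<in> carrier A \<Longrightarrow> y \<in> carrier A \<Longrightarrow> cnorm A (x \<ominus> y) \<le> cnorm A x + cnorm A y"
  using cnorm_triangle[of x "\<ominus> y"] by (simp add: a_minus_def cnorm_a_inv)

lemma cnorm_dist_triangle:
  assumes "x \<in> carrier A" "y \<in> carrier A" "z \<in> carrier A"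
  shows "cnorm A (x \<ominus> z) \<le> cnorm A (x \<ominus> y) + cnorm A (y \<ominus> z)"
proof -
  have "x \<ominus> z = (x \<ominus> y) \<oplus> (y \<ominus> z)" using assms by algebra
  thus ?thesis using assms by (simp add: cnorm_triangle)
qed

lemma cnorm_add_diff_le:
  assumes "x \<in> carrier A" "y \<in> carrier A" "x' \<in> carrier A" "y' \<in> carrier A"
  shows "cnorm A ((x \<oplus> y) \<ominus> (x' \<oplus> y')) \<le> cnorm A (x \<ominus> x') + cnorm A (y \<ominus> y')"
proof -
  have "(x \<oplus> y) \<ominus> (x' \<oplus> y') = (x \<ominus> x') \<oplus> (y \<ominus> y')" using assms by algebra
  thus ?thesis using assms by (simp add: cnorm_triangle)
qed

lemma cnorm_mult_diff_le:
  assumes "x \<in> carrier A" "y \<in> carrier A" "x' \<in> carrier A" "y' \<in> carrier A"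
  shows "cnorm A (x \<otimes> y \<ominus> x' \<otimes> y') \<le> cnorm A x * cnorm A (y \<ominus> y') + cnorm A (x \<ominus> x') * cnorm A y'"
proof -
  have "x \<otimes> y \<ominus> x' \<otimes> y' = x \<otimes> (y \<ominus> y') \<oplus> (x \<ominus> x') \<otimes> y'" using assms by algebra
  hence "cnorm A (x \<otimes> y \<ominus> x' \<otimes> y') \<le> cnorm A (x \<otimes> (y \<ominus> y')) + cnorm A ((x \<ominus> x') \<otimes> y')"
    using assms by (simp add: cnorm_triangle)
  thus ?thesis using cnorm_mult[of x "y \<ominus> y'"] cnorm_mult[of "x \<ominus> x'" y'] assms by simp
qed

lemma smult_minus_distrib:
  assumes "x \<in> carrier A" "y \<in> carrier A"
  shows "c \<odot> (x \<ominus> y) = c \<odot> x \<ominus> c \<odot> y"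
proof -
  have "c \<odot> (\<ominus> y) = \<ominus> (c \<odot> y)"
    using assms scalar.smult_assoc1[of c "-1" y] scalar.smult_assoc1[of "-1" c y]
    by (simp add: a_inv_eq_smult)
  thus ?thesis using assms scalar.smult_r_distr[of c x "\<ominus> y"] by (simp add: a_minus_def)
qed

lemma star_minus:
  assumes "x \<in> carrier A" "y \<in> carrier A"
  shows "star A (x \<ominus> y) = star A x \<ominus> star A y"
  using assms star_closed by (simp add: a_minus_def star_add a_inv_eq_smult star_smult)

lemma star_one: "star A \<one> = \<one>"
  by (metis one_closed r_one l_one star_closed star_mult star_star)

lemma cnorm_star:
  assumes "x \<in> carrier A"
  shows "cnorm A (star A x) = cnorm A x"
proof -
  have le: "cnorm A y \<le> cnorm A (star A y)" if y: "y \<in> carrier A" for y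
  proof (cases "cnorm A y = 0")
    case True
    thus ?thesis using y star_closed cnorm_nonneg by simp
  next
    case False
    hence pos: "0 < cnorm A y" using cnorm_nonneg[OF y] by simp
    have "cnorm A y * cnorm A y \<le> cnorm A (star A y) * cnorm A y"
      using cnorm_mult[of "star A y" y] cstar_identity[OF y] star_closed[OF y] y
      by (simp add: power2_eq_square)
    thus ?thesis using pos by simp
  qed
  show ?thesis using le[OF assms] le[OF star_closed[OF assms]] assms by (simp add: star_star)
qed

text \<open>\<open>s = 1 - y\<close> is a self-adjoint root of \<open>1 - h\<close> if \<open>y = (h + y^2) / 2\<close> is self-adjoint. Let \<open>q\<close> be the smaller
root of the scalar equation \<open>q = (|h| + q^2) / 2\<close>. On the ball of radius \<open>q < 1\<close>, \<open>T y = (h + y^2) / 2\<close> is a contraction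
with factor \<open>q\<close>, so its iterates from 0 converge, and they are self-adjoint.\<close>

lemma sqrt_one_minus:
  assumes h: "h \<in> carrier A" "star A h = h" "cnorm A h < 1"
  obtains s where "s \<in> carrier A" "star A s \<otimes> s = \<one> \<ominus> h"
proof -
  define q where "q = 1 - sqrt (1 - cnorm A h)"
  have q: "0 \<le> q" "q < 1" using h cnorm_nonneg[of h] by (auto simp: q_def real_sqrt_le_1_iff)
  have "(1 - q)\<^sup>2 = 1 - cnorm A h" using h by (simp add: q_def)
  hence qh: "cnorm A h + q * q = 2 * q" by (simp add: power2_eq_square algebra_simps)
  define T where "T y = (1/2) \<odot> (h \<oplus> y \<otimes> y)" for y
  have T_closed: "T y \<in> carrier A" if "y \<in> carrier A" for y using that h by (simp add: T_def)
  have T_Lip: "cnorm A (T y \<ominus> T z) \<le> (cnorm A y + cnorm A z) / 2 * cnorm A (y \<ominus> z)"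
    if "y \<in> carrier A" "z \<in> carrier A" for y z
  proof -
    have "T y \<ominus> T z = (1/2) \<odot> ((h \<oplus> y \<otimes> y) \<ominus> (h \<oplus> z \<otimes> z))"
      using that h by (simp add: T_def smult_minus_distrib)
    also have "(h \<oplus> y \<otimes> y) \<ominus> (h \<oplus> z \<otimes> z) = y \<otimes> y \<ominus> z \<otimes> z" using that h by algebra
    finally have "cnorm A (T y \<ominus> T z) = 1/2 * cnorm A (y \<otimes> y \<ominus> z \<otimes> z)"
      using that by (simp add: cnorm_smult)
    also have "\<dots> \<le> 1/2 * (cnorm A y * cnorm A (y \<ominus> z) + cnorm A (y \<ominus> z) * cnorm A z)"
      using cnorm_mult_diff_le[of y y z z] that by simp
    finally show ?thesis by (simp add: algebra_simps)
  qed
  define y where "y n = (T ^^ n) \<zero>" for n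
  have y0: "y 0 = \<zero>" and ySuc: "y (Suc n) = T (y n)" for n by (simp_all add: y_def)
  have yc: "y n \<in> carrier A" for n by (induction n) (simp_all add: y0 ySuc T_closed)
  have ys: "star A (y n) = y n" for n
  proof (induction n)
    case 0
    show ?case using cnorm_star[of \<zero>] star_closed[of \<zero>] by (simp add: y0 cnorm_eq_0)
  next
    case (Suc n)
    thus ?case using yc[of n] h by (simp add: ySuc T_def star_smult star_add star_mult)
  qed
  have yq: "cnorm A (y n) \<le> q" for n
  proof (induction n)
    case 0
    thus ?case using q by (simp add: y0)
  next
    case (Suc n)
    have "cnorm A (y (Suc n)) = 1/2 * cnorm A (h \<oplus> y n \<otimes> y n)"
      using yc[of n] h by (simp add: ySuc T_def cnorm_smult)
    also have "\<dots> \<le> 1/2 * (cnorm A h + cnorm A (y n) * cnorm A (y n))"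
      using cnorm_triangle[of h "y n \<otimes> y n"] cnorm_mult[of "y n" "y n"] yc[of n] h by simp
    also have "\<dots> \<le> 1/2 * (cnorm A h + q * q)"
      using Suc cnorm_nonneg[OF yc[of n]] q by (simp add: mult_mono)
    finally show ?case by (simp add: qh)
  qed
  have ydiff: "cnorm A (y (n + m) \<ominus> y n) \<le> q ^ n" for n m
  proof (induction n)
    case 0
    have "y m \<ominus> \<zero> = y m" using yc by algebra
    thus ?case using yq[of m] q by (simp add: y0)
  next
    case (Suc n)
    have "cnorm A (y (Suc n + m) \<ominus> y (Suc n)) \<le> (cnorm A (y (n + m)) + cnorm A (y n)) / 2 * cnorm A (y (n + m) \<ominus> y n)"
      using T_Lip[OF yc yc] by (simp add: ySuc)
    also have "\<dots> \<le> q * q ^ n"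
      using Suc yq[of "n + m"] yq[of n] q cnorm_nonneg yc
      by (intro mult_mono) (auto intro!: cnorm_nonneg)
    finally show ?case by simp
  qed
  interpret M: Metric_space "carrier A" "cdist A" by (rule Metric_space_cdist)
  have dist_eq: "cdist A a b = cnorm A (a \<ominus> b)" if "a \<in> carrier A" "b \<in> carrier A" for a b
    using that by (simp add: cdist_def)
  have "M.MCauchy y"
    unfolding M.MCauchy_def
  proof (intro conjI allI impI)
    show "range y \<subseteq> carrier A" using yc by auto
    fix \<epsilon> :: real assume e: "0 < \<epsilon>"
    have "(\<lambda>n. q ^ n) \<longlonglongrightarrow> 0" using q by (intro LIMSEQ_realpow_zero) auto
    from order_tendstoD(2)[OF this, of \<epsilon>] e
    obtain N where N: "q ^ n < \<epsilon>" if "n \<ge> N" for n by (auto simp: eventually_sequentially)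
    show "\<exists>N. \<forall>n n'. N \<le> n \<longrightarrow> N \<le> n' \<longrightarrow> cdist A (y n) (y n') < \<epsilon>"
    proof (intro exI[of _ N] allI impI)
      fix n n' assume nn: "N \<le> n" "N \<le> n'"
      show "cdist A (y n) (y n') < \<epsilon>"
      proof (cases "n \<le> n'")
        case True
        then obtain m where "n' = n + m" using le_Suc_ex by blast
        thus ?thesis using ydiff[of n m] N[OF nn(1)] yc by (simp add: dist_eq cnorm_minus_commute[of "y n"])
      next
        case False
        then obtain m where "n = n' + m" using le_Suc_ex[of n' n] by auto
        thus ?thesis using ydiff[of n' m] N[OF nn(2)] yc by (simp add: dist_eq)
      qed
    qed
  qed
  then obtain w where "limitin M.mtopology y w sequentially"
    using complete unfolding M.mcomplete_def by blast
  hence w: "w \<in> carrier A" and lim: "(\<lambda>n. cdist A (y n) w) \<longlonglongrightarrow> 0"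
    by (auto simp: M.limitin_metric_dist_null)
  have lim: "(\<lambda>n. cnorm A (y n \<ominus> w)) \<longlonglongrightarrow> 0"
    using lim yc w by (simp add: dist_eq)
  have sw: "star A w = w"
  proof -
    have "cnorm A (star A w \<ominus> w) \<le> 2 * cnorm A (y n \<ominus> w)" for n
    proof -
      have "star A w \<ominus> y n = star A (w \<ominus> y n)" using ys yc w by (simp add: star_minus)
      hence "cnorm A (star A w \<ominus> y n) = cnorm A (y n \<ominus> w)"
        using yc w by (simp add: cnorm_star cnorm_minus_commute[of w])
      thus ?thesis using cnorm_dist_triangle[of "star A w" "y n" w] yc w star_closed by simp
    qed
    hence "cnorm A (star A w \<ominus> w) \<le> 2 * 0"
      by (intro LIMSEQ_le_const[OF tendsto_mult_left[OF lim]]) auto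
    hence "star A w \<ominus> w = \<zero>" using w star_closed cnorm_nonneg[of "star A w \<ominus> w"] by (simp flip: cnorm_eq_0)
    thus ?thesis using w star_closed by simp
  qed
  have Tw: "T w = w"
  proof -
    have le: "cnorm A (T w \<ominus> w) \<le> (cnorm A w + q) / 2 * cnorm A (y n \<ominus> w) + cnorm A (y (Suc n) \<ominus> w)" for n
    proof -
      have "cnorm A (T w \<ominus> w) \<le> cnorm A (T w \<ominus> T (y n)) + cnorm A (y (Suc n) \<ominus> w)"
        using cnorm_dist_triangle[of "T w" "T (y n)" w] T_closed yc w by (simp add: ySuc)
      also have "cnorm A (T w \<ominus> T (y n)) \<le> (cnorm A w + cnorm A (y n)) / 2 * cnorm A (w \<ominus> y n)"
        by (rule T_Lip[OF w yc])
      also have "\<dots> \<le> (cnorm A w + q) / 2 * cnorm A (y n \<ominus> w)"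
        using yq[of n] w yc by (simp add: cnorm_minus_commute[of w] mult_right_mono cnorm_nonneg)
      finally show ?thesis by simp
    qed
    have "(\<lambda>n. (cnorm A w + q) / 2 * cnorm A (y n \<ominus> w) + cnorm A (y (Suc n) \<ominus> w)) \<longlonglongrightarrow> (cnorm A w + q) / 2 * 0 + 0"
      by (intro tendsto_add tendsto_mult_left lim LIMSEQ_Suc)
    hence "cnorm A (T w \<ominus> w) \<le> (cnorm A w + q) / 2 * 0 + 0"
      by (rule LIMSEQ_le_const) (use le in auto)
    hence "T w \<ominus> w = \<zero>" using w T_closed cnorm_nonneg[of "T w \<ominus> w"] by (simp flip: cnorm_eq_0)
    thus ?thesis using w T_closed by simp
  qed
  have "w \<oplus> w = 2 \<odot> T w"
    using scalar.smult_l_distr[of 1 1 w] scalar.smult_one[of w] w by (simp add: Tw)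
  also have "\<dots> = h \<oplus> w \<otimes> w"
    using scalar.smult_assoc1[of 2 "1/2" "h \<oplus> w \<otimes> w"] scalar.smult_one[of "h \<oplus> w \<otimes> w"] h w by (simp add: T_def)
  finally have ww: "w \<oplus> w = h \<oplus> w \<otimes> w" .
  have "star A (\<one> \<ominus> w) \<otimes> (\<one> \<ominus> w) = (\<one> \<ominus> w) \<otimes> (\<one> \<ominus> w)"
    using w sw by (simp add: star_minus star_one)
  also have "\<dots> = \<one> \<ominus> (w \<oplus> w) \<oplus> w \<otimes> w"
  proof -
    have "w \<otimes> \<one> = w" using w by simp
    thus ?thesis using w by algebra
  qed
  also have "\<dots> = \<one> \<ominus> h" unfolding ww using w h by algebra
  finally show ?thesis using that[of "\<one> \<ominus> w"] w by simp
qed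

text \<open>For \<open>t > |a|^2\<close> the element \<open>1 - a* a / t\<close> is of the form \<open>s* s\<close>, so \<open>f\<close> is nonnegative on it.\<close>

theorem positive_functional_bound:
  assumes add: "\<And>x y. x \<in> carrier A \<Longrightarrow> y \<in> carrier A \<Longrightarrow> f (x \<oplus> y) = f x + f y"
    and smult: "\<And>c x. x \<in> carrier A \<Longrightarrow> f (c \<odot> x) = c * f x"
    and pos: "\<And>x. x \<in> carrier A \<Longrightarrow> 0 \<le> Re (f (star A x \<otimes> x))"
    and a: "a \<in> carrier A"
  shows "Re (f (star A a \<otimes> a)) \<le> (cnorm A a)\<^sup>2 * Re (f \<one>)"
proof -
  have ac: "star A a \<otimes> a \<in> carrier A" using a star_closed by simp
  have f1: "0 \<le> Re (f \<one>)" using pos[of \<one>] by (simp add: star_one)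
  have le: "Re (f (star A a \<otimes> a)) \<le> t * Re (f \<one>)" if t: "(cnorm A a)\<^sup>2 < t" for t
  proof -
    have t0: "0 < t" using t zero_le_power2[of "cnorm A a"] by linarith
    define h where "h = complex_of_real (1 / t) \<odot> (star A a \<otimes> a)"
    have h: "h \<in> carrier A" using ac by (simp add: h_def)
    have "star A h = h" using a star_closed
      by (simp add: h_def star_smult star_mult star_star)
    moreover have "cnorm A h < 1"
      using t t0 ac a by (simp add: h_def cnorm_smult cstar_identity norm_divide)
    ultimately obtain s where s: "s \<in> carrier A" "star A s \<otimes> s = \<one> \<ominus> h"
      using sqrt_one_minus[OF h] by blast
    have "f (\<one> \<ominus> h) = f \<one> - f h"
      using h by (simp add: a_minus_def add smult a_inv_eq_smult)
    also have "f h = complex_of_real (1 / t) * f (star A a \<otimes> a)" using ac by (simp add: h_def smult)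
    finally have "0 \<le> Re (f \<one>) - Re (f (star A a \<otimes> a)) / t" using pos[OF s(1)] s(2) by simp
    thus ?thesis using t0 by (simp add: field_simps)
  qed
  show ?thesis
  proof (rule field_le_epsilon)
    fix e :: real assume e: "0 < e"
    have "Re (f (star A a \<otimes> a)) \<le> ((cnorm A a)\<^sup>2 + e / (Re (f \<one>) + 1)) * Re (f \<one>)"
      using e f1 by (intro le) simp
    also have "\<dots> \<le> (cnorm A a)\<^sup>2 * Re (f \<one>) + e"
      using e f1 by (simp add: distrib_right divide_le_eq mult_left_mono)
    finally show "Re (f (star A a \<otimes> a)) \<le> (cnorm A a)\<^sup>2 * Re (f \<one>) + e" .
  qed
qed

lemma norm2_tracial_le:
  assumes "tracial_state A \<tau>" "a \<in> carrier A"
  shows "norm2 A \<tau> a \<le> cnorm A a"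
proof -
  have "Re (\<tau> (star A a \<otimes> a)) \<le> (cnorm A a)\<^sup>2 * Re (\<tau> \<one>)"
    by (rule positive_functional_bound) (use assms in \<open>auto simp: tracial_state_def\<close>)
  hence "Re (\<tau> (star A a \<otimes> a)) \<le> (cnorm A a)\<^sup>2" using assms(1) by (simp add: tracial_state_def)
  thus ?thesis using real_sqrt_le_mono cnorm_nonneg[OF assms(2)] by (fastforce simp: norm2_def)
qed

text \<open>For every vector \<open>v\<close>, \<open>x \<mapsto> <\<phi> x v, v>\<close> is a positive functional with value \<open>|v|^2\<close> at 1.\<close>

lemma rep_contractive:
  assumes \<phi>: "\<phi> \<in> unital_star_hom A (mat_calg k)" and a: "a \<in> carrier A"
  shows "op_norm (\<phi> a) \<le> cnorm A a"
proof (rule op_norm_leI)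
  have hom: "\<phi> \<in> Ring.ring_hom A (mat_calg k)" using \<phi> by (simp add: unital_star_hom_def)
  have cl: "\<phi> x \<in> carrier_mat k k" if "x \<in> carrier A" for x using ring_hom_closed[OF hom that] by simp
  show "0 \<le> cnorm A a" by (rule cnorm_nonneg[OF a])
  fix v :: "complex vec" assume "v \<in> carrier_vec (dim_col (\<phi> a))"
  hence v: "v \<in> carrier_vec k" using cl[OF a] by simp
  define f where "f x = (\<phi> x *\<^sub>v v) \<bullet>c v" for x
  have mv: "\<phi> x *\<^sub>v v \<in> carrier_vec k" if "x \<in> carrier A" for x
    using cl[OF that] v by (auto intro!: mult_mat_vec_carrier[of _ k k])
  have fstar: "f (star A x \<otimes> x) = complex_of_real ((vec_norm2 (\<phi> x *\<^sub>v v))\<^sup>2)" if x: "x \<in> carrier A" for x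
  proof -
    have "\<phi> (star A x \<otimes> x) = mat_adjoint (\<phi> x) * \<phi> x"
      using \<phi> x ring_hom_mult[OF hom star_closed[OF x] x] by (simp add: unital_star_hom_def)
    hence "f (star A x \<otimes> x) = (mat_adjoint (\<phi> x) *\<^sub>v (\<phi> x *\<^sub>v v)) \<bullet>c v"
      unfolding f_def using assoc_mult_mat_vec[OF mat_adjoint_closed[OF cl[OF x]] cl[OF x] v] by simp
    also have "\<dots> = (\<phi> x *\<^sub>v v) \<bullet>c (\<phi> x *\<^sub>v v)"
      using sprod_adjoint[OF mat_adjoint_closed[OF cl[OF x]] mv[OF x] v] by simp
    finally show ?thesis by (simp only: vec_norm2_sq_sprod)
  qed
  have "Re (f (star A a \<otimes> a)) \<le> (cnorm A a)\<^sup>2 * Re (f \<one>)"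
  proof (rule positive_functional_bound[OF _ _ _ a])
    show "f (x \<oplus> y) = f x + f y" if "x \<in> carrier A" "y \<in> carrier A" for x y
      using ring_hom_add[OF hom that] cl that v mv
      by (simp add: f_def add_mult_distrib_mat_vec[of _ k k] add_scalar_prod_distrib[of _ k])
    show "f (c \<odot> x) = c * f x" if "x \<in> carrier A" for c x
    proof -
      have "\<phi> (c \<odot> x) = c \<cdot>\<^sub>m \<phi> x" using \<phi> that by (simp add: unital_star_hom_def)
      moreover have "(c \<cdot>\<^sub>m \<phi> x) *\<^sub>v v = c \<cdot>\<^sub>v (\<phi> x *\<^sub>v v)"
        using cl[OF that] v by (intro eq_vecI) auto
      ultimately show ?thesis using mv[OF that] v by (simp add: f_def)
    qed
    show "0 \<le> Re (f (star A x \<otimes> x))" if "x \<in> carrier A" for x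
      using fstar[OF that] by simp
  qed
  moreover have "f \<one> = complex_of_real ((vec_norm2 v)\<^sup>2)"
    using ring_hom_one[OF hom] v unfolding vec_norm2_sq_sprod by (simp add: f_def)
  ultimately have "(vec_norm2 (\<phi> a *\<^sub>v v))\<^sup>2 \<le> (cnorm A a)\<^sup>2 * (vec_norm2 v)\<^sup>2"
    using fstar[OF a] by simp
  hence le: "(vec_norm2 (\<phi> a *\<^sub>v v))\<^sup>2 \<le> (cnorm A a * vec_norm2 v)\<^sup>2"
    by (simp only: power_mult_distrib)
  show "vec_norm2 (\<phi> a *\<^sub>v v) \<le> cnorm A a * vec_norm2 v"
    by (rule power2_le_imp_le[OF le]) (rule mult_nonneg_nonneg[OF cnorm_nonneg[OF a] vec_norm2_nonneg])
qed

text \<open>The closure of \<open>D\<close> is a unital C*-subalgebra that contains the generators.\<close>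

lemma dense_subalgebra:
  assumes gen: "cstar_generated A S = carrier A" and SD: "S \<subseteq> D" and D: "D \<subseteq> carrier A"
    and one: "\<one> \<in> D" and add: "\<And>x y. x \<in> D \<Longrightarrow> y \<in> D \<Longrightarrow> x \<oplus> y \<in> D"
    and mult: "\<And>x y. x \<in> D \<Longrightarrow> y \<in> D \<Longrightarrow> x \<otimes> y \<in> D"
    and smult: "\<And>c x. x \<in> D \<Longrightarrow> c \<odot> x \<in> D"
    and star: "\<And>x. x \<in> D \<Longrightarrow> star A x \<in> D"
    and a: "a \<in> carrier A" and e: "0 < \<eta>"
  obtains b where "b \<in> D" "cnorm A (a \<ominus> b) < \<eta>"
proof -
  interpret M: Metric_space "carrier A" "cdist A" by (rule Metric_space_cdist)
  define B where "B = M.mtopology closure_of D"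
  have B_iff: "x \<in> B \<longleftrightarrow> x \<in> carrier A \<and> (\<forall>r>0. \<exists>y\<in>D. cnorm A (x \<ominus> y) < r)" for x
    unfolding B_def M.metric_closure_of using D by (auto simp: M.in_mball cdist_def subset_iff)
  have B_approx: "\<exists>y. y \<in> D \<and> cnorm A (x \<ominus> y) < r" if "x \<in> B" "0 < r" for x r
    using that unfolding B_iff by auto
  have Dc: "x \<in> carrier A" if "x \<in> D" for x using D that by auto
  have DB: "D \<subseteq> B"
  proof
    fix x assume x: "x \<in> D"
    hence "cnorm A (x \<ominus> x) = 0" using Dc by (simp add: a_minus_def r_neg)
    thus "x \<in> B" using x Dc unfolding B_iff by metis
  qed
  have addB: "x \<oplus> y \<in> B" if mem: "x \<in> B" "y \<in> B" for x y
    unfolding B_iff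
  proof (intro conjI allI impI)
    show "x \<oplus> y \<in> carrier A" using that by (simp add: B_iff)
    fix r :: real assume "0 < r"
    then obtain x' y' where xy: "x' \<in> D" "cnorm A (x \<ominus> x') < r / 2" "y' \<in> D" "cnorm A (y \<ominus> y') < r / 2"
      using B_approx[OF mem(1), of "r / 2"] B_approx[OF mem(2), of "r / 2"] half_gt_zero by blast
    thus "\<exists>z\<in>D. cnorm A ((x \<oplus> y) \<ominus> z) < r"
      using cnorm_add_diff_le[of x y x' y'] that Dc by (intro bexI[of _ "x' \<oplus> y'"] add) (auto simp: B_iff)
  qed
  have starB: "star A x \<in> B" if mem: "x \<in> B" for x
    unfolding B_iff
  proof (intro conjI allI impI)
    show "star A x \<in> carrier A" using that star_closed by (simp add: B_iff)
    fix r :: real assume "0 < r"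
    then obtain x' where x': "x' \<in> D" "cnorm A (x \<ominus> x') < r"
      using B_approx[OF mem] by blast
    thus "\<exists>z\<in>D. cnorm A (star A x \<ominus> z) < r"
      using that Dc by (intro bexI[of _ "star A x'"] star) (auto simp: B_iff cnorm_star simp flip: star_minus)
  qed
  have multB: "x \<otimes> y \<in> B" if mem: "x \<in> B" "y \<in> B" for x y
    unfolding B_iff
  proof (intro conjI allI impI)
    show "x \<otimes> y \<in> carrier A" using that by (simp add: B_iff)
    fix r :: real assume r: "0 < r"
    have xy: "x \<in> carrier A" "y \<in> carrier A" using that by (auto simp: B_iff)
    have nn: "0 \<le> cnorm A x" "0 \<le> cnorm A y" using xy by (auto intro: cnorm_nonneg)
    define d where "d = min 1 (r / (2 * (cnorm A x + cnorm A y + 2)))"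
    have d: "0 < d" using r nn by (simp add: d_def)
    have d1: "d \<le> 1" by (simp add: d_def)
    have "d * (2 * (cnorm A x + cnorm A y + 2)) \<le> r"
      using nn by (subst pos_le_divide_eq[symmetric]) (auto simp: d_def)
    hence dr: "2 * (d * (cnorm A x + cnorm A y + 2)) \<le> r" by (simp add: algebra_simps)
    obtain x' y' where x'y': "x' \<in> D" "cnorm A (x \<ominus> x') < d" "y' \<in> D" "cnorm A (y \<ominus> y') < d"
      using B_approx[OF mem(1) d] B_approx[OF mem(2) d] by blast
    note c' = Dc[OF x'y'(1)] Dc[OF x'y'(3)]
    have "y' = y \<ominus> (y \<ominus> y')" using xy c' by algebra
    hence "cnorm A y' \<le> cnorm A y + cnorm A (y \<ominus> y')" using cnorm_minus_le[of y "y \<ominus> y'"] xy c' by simp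
    hence y'1: "cnorm A y' \<le> cnorm A y + 1" using x'y' d1 by linarith
    have "cnorm A (x \<otimes> y \<ominus> x' \<otimes> y') \<le> cnorm A x * cnorm A (y \<ominus> y') + cnorm A (x \<ominus> x') * cnorm A y'"
      by (rule cnorm_mult_diff_le) (use xy c' in auto)
    also have "\<dots> \<le> cnorm A x * d + d * (cnorm A y + 1)"
      using x'y' nn y'1 d xy c' by (intro add_mono mult_mono) (auto intro: cnorm_nonneg)
    also have "\<dots> < 2 * (d * (cnorm A x + cnorm A y + 2))"
    proof -
      have "0 \<le> d * cnorm A x" "0 \<le> d * cnorm A y" using d nn by auto
      thus ?thesis using d by (simp add: algebra_simps)
    qed
    finally show "\<exists>z\<in>D. cnorm A (x \<otimes> y \<ominus> z) < r" using mult x'y' dr by (meson less_le_trans)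
  qed
  have smultB: "c \<odot> x \<in> B" if "x \<in> B" for c x
    using multB[OF subsetD[OF DB smult[OF one]] that, of c] that by (simp add: smult_mult_left B_iff)
  have "unital_cstar_subalgebra B A"
    unfolding unital_cstar_subalgebra_def
  proof (intro conjI allI ballI)
    show "subring B A"
    proof (rule subringI)
      show "B \<subseteq> carrier A" by (auto simp: B_iff)
      show "\<one> \<in> B" using one DB by auto
      show "\<ominus> h \<in> B" if "h \<in> B" for h
        using smultB[OF that, of "-1"] that by (simp add: a_inv_eq_smult B_iff)
    qed (auto intro: multB addB)
    show "closedin M.mtopology B" unfolding B_def by (rule closedin_closure_of)
  qed (auto intro: smultB starB)
  moreover have "S \<subseteq> B" using SD DB by auto
  ultimately have "cstar_generated A S \<subseteq> B" unfolding cstar_generated_def by auto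
  hence "a \<in> B" using gen a by auto
  thus ?thesis using that e unfolding B_iff by blast
qed

end


section \<open>Tracial ultraproducts of matrix algebras\<close>

locale matrix_ultraproduct =
  fixes I :: "'i set" and \<alpha> :: "'i filter" and k :: "'i \<Rightarrow> nat"
  assumes ultra: "ultrafilter_on I \<alpha>" and k_pos: "0 < k i"
begin

abbreviation "MP \<equiv> cstar_product I (\<lambda>i. mat_calg (k i))"
abbreviation "MJ \<equiv> trace_null_ideal I \<alpha> (\<lambda>i. mat_calg (k i)) (\<lambda>i. ntrace (k i))"
abbreviation "MU \<equiv> tracial_ultraproduct I \<alpha> (\<lambda>i. mat_calg (k i)) (\<lambda>i. ntrace (k i))"

text \<open>Families are total on the index type and are only restricted to \<open>I\<close> when they enter the product. This
avoids case distinctions on \<open>i \<in> I\<close>.\<close>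

definition bounded_family :: "('i \<Rightarrow> complex mat) \<Rightarrow> bool" where
  "bounded_family Y \<longleftrightarrow> (\<forall>i. Y i \<in> carrier_mat (k i) (k i)) \<and> (\<exists>C. \<forall>i. op_norm (Y i) \<le> C)"

definition coset_of :: "('i \<Rightarrow> complex mat) \<Rightarrow> ('i \<Rightarrow> complex mat) set" where
  "coset_of Y = ultra_coset I \<alpha> (\<lambda>i. mat_calg (k i)) (\<lambda>i. ntrace (k i)) (restrict Y I)"

lemma eventually_I: "eventually (\<lambda>i. i \<in> I) \<alpha>" and alpha_nbot: "\<alpha> \<noteq> bot"
  using ultra by (auto simp: ultrafilter_on_def)

lemma bounded_familyD: "bounded_family Y \<Longrightarrow> Y i \<in> carrier_mat (k i) (k i)"
  by (simp add: bounded_family_def)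

lemma bounded_familyE:
  assumes "bounded_family Y"
  obtains C where "0 \<le> C" "\<And>i. op_norm (Y i) \<le> C"
  using assms unfolding bounded_family_def by (meson op_norm_nonneg order_trans)

lemma bounded_familyI:
  "(\<And>i. Y i \<in> carrier_mat (k i) (k i)) \<Longrightarrow> (\<And>i. op_norm (Y i) \<le> C) \<Longrightarrow> bounded_family Y"
  by (auto simp: bounded_family_def)

lemma bounded_family_add:
  assumes "bounded_family Y" "bounded_family Z"
  shows "bounded_family (\<lambda>i. Y i + Z i)"
proof -
  obtain C D where C: "\<And>i. op_norm (Y i) \<le> C" and D: "\<And>i. op_norm (Z i) \<le> D"
    using assms bounded_familyE by metis
  show ?thesis
  proof (rule bounded_familyI)
    fix i
    show "Y i + Z i \<in> carrier_mat (k i) (k i)" using assms bounded_familyD by auto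
    show "op_norm (Y i + Z i) \<le> C + D"
      using op_norm_add[OF bounded_familyD bounded_familyD, OF assms, of i] C[of i] D[of i] by linarith
  qed
qed

lemma bounded_family_mult:
  assumes "bounded_family Y" "bounded_family Z"
  shows "bounded_family (\<lambda>i. Y i * Z i)"
proof -
  obtain C D where C: "0 \<le> C" "\<And>i. op_norm (Y i) \<le> C" and D: "0 \<le> D" "\<And>i. op_norm (Z i) \<le> D"
    using assms bounded_familyE by metis
  show ?thesis
  proof (rule bounded_familyI)
    fix i
    show "Y i * Z i \<in> carrier_mat (k i) (k i)" using assms bounded_familyD by auto
    have "op_norm (Y i * Z i) \<le> op_norm (Y i) * op_norm (Z i)"
      using assms bounded_familyD by (auto intro: op_norm_mult)
    also have "\<dots> \<le> C * D" using C D by (intro mult_mono) auto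
    finally show "op_norm (Y i * Z i) \<le> C * D" .
  qed
qed

lemma bounded_family_smult:
  assumes "bounded_family Y"
  shows "bounded_family (\<lambda>i. c \<cdot>\<^sub>m Y i)"
proof -
  obtain C where C: "0 \<le> C" "\<And>i. op_norm (Y i) \<le> C" using assms bounded_familyE by metis
  show ?thesis
  proof (rule bounded_familyI)
    fix i
    show "c \<cdot>\<^sub>m Y i \<in> carrier_mat (k i) (k i)" using assms bounded_familyD by auto
    have "op_norm (c \<cdot>\<^sub>m Y i) \<le> cmod c * op_norm (Y i)" by (rule op_norm_smult)
    also have "\<dots> \<le> cmod c * C" using C by (intro mult_left_mono) auto
    finally show "op_norm (c \<cdot>\<^sub>m Y i) \<le> cmod c * C" .
  qed
qed

lemma bounded_family_adjoint: "bounded_family Y \<Longrightarrow> bounded_family (\<lambda>i. mat_adjoint (Y i))"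
  by (auto simp: bounded_family_def op_norm_adjoint)

lemma bounded_family_one: "bounded_family (\<lambda>i. 1\<^sub>m (k i))"
  by (rule bounded_familyI[where C = 1]) (auto intro: op_norm_one)

lemma bounded_family_zero: "bounded_family (\<lambda>i. 0\<^sub>m (k i) (k i))"
  by (rule bounded_familyI[where C = 0]) (auto simp: op_norm_zero)

lemma bounded_family_minus:
  assumes "bounded_family Y" "bounded_family Z"
  shows "bounded_family (\<lambda>i. Y i - Z i)"
proof -
  have "(\<lambda>i. Y i - Z i) = (\<lambda>i. Y i + (-1) \<cdot>\<^sub>m Z i)"
  proof
    fix i show "Y i - Z i = Y i + (-1) \<cdot>\<^sub>m Z i"
      using bounded_familyD[OF assms(1), of i] bounded_familyD[OF assms(2), of i] by (intro eq_matI) auto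
  qed
  thus ?thesis using bounded_family_add[OF assms(1) bounded_family_smult[OF assms(2)]] by metis
qed

lemma restrict_in_product: "bounded_family Y \<Longrightarrow> restrict Y I \<in> carrier MP"
  by (auto simp: cstar_product_def bounded_family_def)

lemma product_elementE:
  assumes "a \<in> carrier MP"
  obtains Y where "bounded_family Y" "a = restrict Y I"
proof -
  obtain C where C: "\<forall>i\<in>I. op_norm (a i) \<le> C" and a: "a \<in> (\<Pi>\<^sub>E i\<in>I. carrier_mat (k i) (k i))"
    using assms by (auto simp: cstar_product_def)
  define Y where "Y i = (if i \<in> I then a i else 0\<^sub>m (k i) (k i))" for i
  have "bounded_family Y"
    by (rule bounded_familyI[where C = "max 0 C"])
       (use C a in \<open>auto simp: Y_def op_norm_zero intro: order_trans\<close>)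
  moreover have "a = restrict Y I" using a by (auto simp: Y_def PiE_iff extensional_def)
  ultimately show ?thesis using that by blast
qed

lemma product_ops:
  "restrict Y I \<oplus>\<^bsub>MP\<^esub> restrict Z I = restrict (\<lambda>i. Y i + Z i) I"
  "restrict Y I \<otimes>\<^bsub>MP\<^esub> restrict Z I = restrict (\<lambda>i. Y i * Z i) I"
  "\<one>\<^bsub>MP\<^esub> = restrict (\<lambda>i. 1\<^sub>m (k i)) I"
  "\<zero>\<^bsub>MP\<^esub> = restrict (\<lambda>i. 0\<^sub>m (k i) (k i)) I"
  "c \<odot>\<^bsub>MP\<^esub> restrict Y I = restrict (\<lambda>i. c \<cdot>\<^sub>m Y i) I"
  "star MP (restrict Y I) = restrict (\<lambda>i. mat_adjoint (Y i)) I"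
  by (auto simp: cstar_product_def cong: restrict_cong)

lemma ring_product: "ring MP"
proof (rule ringI)
  note D = bounded_familyD
  show "abelian_group MP"
  proof (rule abelian_groupI)
    fix x y assume "x \<in> carrier MP" "y \<in> carrier MP"
    then obtain X Y where XY: "bounded_family X" "x = restrict X I" "bounded_family Y" "y = restrict Y I"
      by (metis product_elementE)
    show "x \<oplus>\<^bsub>MP\<^esub> y \<in> carrier MP"
      unfolding XY product_ops by (intro restrict_in_product bounded_family_add XY)
    show "x \<oplus>\<^bsub>MP\<^esub> y = y \<oplus>\<^bsub>MP\<^esub> x"
      unfolding XY product_ops
      by (rule restrict_ext) (rule comm_add_mat[OF D[OF XY(1)] D[OF XY(3)]])
    fix z assume "z \<in> carrier MP"
    then obtain Z where Z: "bounded_family Z" "z = restrict Z I" by (metis product_elementE)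
    show "x \<oplus>\<^bsub>MP\<^esub> y \<oplus>\<^bsub>MP\<^esub> z = x \<oplus>\<^bsub>MP\<^esub> (y \<oplus>\<^bsub>MP\<^esub> z)"
      unfolding XY Z product_ops
      by (rule restrict_ext) (rule assoc_add_mat[OF D[OF XY(1)] D[OF XY(3)] D[OF Z(1)]])
  next
    show "\<zero>\<^bsub>MP\<^esub> \<in> carrier MP" unfolding product_ops by (intro restrict_in_product bounded_family_zero)
  next
    fix x assume "x \<in> carrier MP"
    then obtain X where X: "bounded_family X" "x = restrict X I" by (metis product_elementE)
    show "\<zero>\<^bsub>MP\<^esub> \<oplus>\<^bsub>MP\<^esub> x = x"
      unfolding X product_ops by (rule restrict_ext) (rule left_add_zero_mat[OF D[OF X(1)]])
    show "\<exists>y\<in>carrier MP. y \<oplus>\<^bsub>MP\<^esub> x = \<zero>\<^bsub>MP\<^esub>"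
    proof (rule bexI[of _ "restrict (\<lambda>i. (-1) \<cdot>\<^sub>m X i) I"])
      show "restrict (\<lambda>i. (-1) \<cdot>\<^sub>m X i) I \<oplus>\<^bsub>MP\<^esub> x = \<zero>\<^bsub>MP\<^esub>"
        unfolding X product_ops
      proof (rule restrict_ext)
        fix i show "(-1) \<cdot>\<^sub>m X i + X i = 0\<^sub>m (k i) (k i)"
          using D[OF X(1), of i] by (intro eq_matI) auto
      qed
    qed (intro restrict_in_product bounded_family_smult X)
  qed
  show "Group.monoid MP"
  proof (rule Group.monoidI)
    fix x y assume "x \<in> carrier MP" "y \<in> carrier MP"
    then obtain X Y where XY: "bounded_family X" "x = restrict X I" "bounded_family Y" "y = restrict Y I"
      by (metis product_elementE)
    show "x \<otimes>\<^bsub>MP\<^esub> y \<in> carrier MP"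
      unfolding XY product_ops by (intro restrict_in_product bounded_family_mult XY)
    fix z assume "z \<in> carrier MP"
    then obtain Z where Z: "bounded_family Z" "z = restrict Z I" by (metis product_elementE)
    show "x \<otimes>\<^bsub>MP\<^esub> y \<otimes>\<^bsub>MP\<^esub> z = x \<otimes>\<^bsub>MP\<^esub> (y \<otimes>\<^bsub>MP\<^esub> z)"
      unfolding XY Z product_ops
      by (rule restrict_ext) (rule assoc_mult_mat[OF D[OF XY(1)] D[OF XY(3)] D[OF Z(1)]])
  next
    show "\<one>\<^bsub>MP\<^esub> \<in> carrier MP" unfolding product_ops by (intro restrict_in_product bounded_family_one)
  next
    fix x assume "x \<in> carrier MP"
    then obtain X where X: "bounded_family X" "x = restrict X I" by (metis product_elementE)
    show "\<one>\<^bsub>MP\<^esub> \<otimes>\<^bsub>MP\<^esub> x = x"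
      unfolding X product_ops by (rule restrict_ext) (rule left_mult_one_mat[OF D[OF X(1)]])
    show "x \<otimes>\<^bsub>MP\<^esub> \<one>\<^bsub>MP\<^esub> = x"
      unfolding X product_ops by (rule restrict_ext) (rule right_mult_one_mat[OF D[OF X(1)]])
  qed
  fix x y z assume "x \<in> carrier MP" "y \<in> carrier MP" "z \<in> carrier MP"
  then obtain X Y Z where XYZ: "bounded_family X" "x = restrict X I" "bounded_family Y" "y = restrict Y I"
    "bounded_family Z" "z = restrict Z I"
    by (metis product_elementE)
  show "(x \<oplus>\<^bsub>MP\<^esub> y) \<otimes>\<^bsub>MP\<^esub> z = x \<otimes>\<^bsub>MP\<^esub> z \<oplus>\<^bsub>MP\<^esub> y \<otimes>\<^bsub>MP\<^esub> z"
    unfolding XYZ product_ops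
    by (rule restrict_ext) (rule add_mult_distrib_mat[OF D[OF XYZ(1)] D[OF XYZ(3)] D[OF XYZ(5)]])
  show "z \<otimes>\<^bsub>MP\<^esub> (x \<oplus>\<^bsub>MP\<^esub> y) = z \<otimes>\<^bsub>MP\<^esub> x \<oplus>\<^bsub>MP\<^esub> z \<otimes>\<^bsub>MP\<^esub> y"
    unfolding XYZ product_ops
    by (rule restrict_ext) (rule mult_add_distrib_mat[OF D[OF XYZ(5)] D[OF XYZ(1)] D[OF XYZ(3)]])
qed

lemma in_ideal_iff:
  assumes "bounded_family Y"
  shows "restrict Y I \<in> MJ \<longleftrightarrow> ((\<lambda>i. hs_norm (k i) (Y i)) \<longlongrightarrow> 0) \<alpha>"
proof -
  have "eventually (\<lambda>i. norm2 (mat_calg (k i)) (ntrace (k i)) (restrict Y I i) = hs_norm (k i) (Y i)) \<alpha>"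
    using eventually_I by eventually_elim (simp add: norm2_mat_calg)
  from tendsto_cong[OF this, of 0] show ?thesis
    using restrict_in_product[OF assms] by (simp add: trace_null_ideal_def)
qed

lemma product_inverse:
  assumes "bounded_family Y"
  shows "\<ominus>\<^bsub>MP\<^esub> restrict Y I = restrict (\<lambda>i. (-1) \<cdot>\<^sub>m Y i) I"
proof -
  interpret P: ring MP by (rule ring_product)
  show ?thesis
  proof (rule P.minus_equality)
    show "restrict (\<lambda>i. (-1) \<cdot>\<^sub>m Y i) I \<oplus>\<^bsub>MP\<^esub> restrict Y I = \<zero>\<^bsub>MP\<^esub>"
      unfolding product_ops
    proof (rule restrict_ext)
      fix i show "(-1) \<cdot>\<^sub>m Y i + Y i = 0\<^sub>m (k i) (k i)"
        using bounded_familyD[OF assms, of i] by (intro eq_matI) auto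
    qed
  qed (intro restrict_in_product bounded_family_smult assms)+
qed

lemma product_minus:
  assumes "bounded_family Y" "bounded_family Z"
  shows "restrict Y I \<ominus>\<^bsub>MP\<^esub> restrict Z I = restrict (\<lambda>i. Y i - Z i) I"
  unfolding a_minus_def product_inverse[OF assms(2)] product_ops
proof (rule restrict_ext)
  fix i show "Y i + (-1) \<cdot>\<^sub>m Z i = Y i - Z i"
    using bounded_familyD[OF assms(1), of i] bounded_familyD[OF assms(2), of i] by (intro eq_matI) auto
qed

lemma tendsto_hs_le:
  assumes Y: "\<And>i. Y i \<in> carrier_mat (k i) (k i)"
    and le: "\<And>i. hs_norm (k i) (Y i) \<le> C * f i" and f: "(f \<longlongrightarrow> 0) \<alpha>"
  shows "((\<lambda>i. hs_norm (k i) (Y i)) \<longlongrightarrow> 0) \<alpha>"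
  by (rule tendsto_sandwich[OF _ _ tendsto_const])
     (use le Y tendsto_mult_right_zero[OF f, of C] in \<open>auto simp: hs_norm_nonneg\<close>)

lemma ideal_trace_null: "ideal MJ MP"
proof (rule idealI[OF ring_product])
  interpret P: ring MP by (rule ring_product)
  have sub: "MJ \<subseteq> carrier MP" by (auto simp: trace_null_ideal_def)
  show "subgroup MJ (add_monoid MP)"
  proof (rule P.add.subgroupI)
    show "MJ \<subseteq> carrier MP" by (rule sub)
    have "restrict (\<lambda>i. 0\<^sub>m (k i) (k i)) I \<in> MJ"
      unfolding in_ideal_iff[OF bounded_family_zero] by (simp add: hs_norm_zero)
    thus "MJ \<noteq> {}" by blast
    fix a assume a: "a \<in> MJ"
    then obtain Y where Y: "bounded_family Y" "a = restrict Y I" using sub product_elementE by blast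
    show "\<ominus>\<^bsub>MP\<^esub> a \<in> MJ"
      using a bounded_familyD[OF Y(1)] unfolding Y(2) product_inverse[OF Y(1)]
      by (simp add: in_ideal_iff Y bounded_family_smult hs_norm_smult)
    fix b assume b: "b \<in> MJ"
    then obtain Z where Z: "bounded_family Z" "b = restrict Z I" using sub product_elementE by blast
    have "((\<lambda>i. hs_norm (k i) (Y i) + hs_norm (k i) (Z i)) \<longlongrightarrow> 0) \<alpha>"
      using a b tendsto_add[of "\<lambda>i. hs_norm (k i) (Y i)" 0 \<alpha> "\<lambda>i. hs_norm (k i) (Z i)" 0]
      unfolding Y(2) Z(2) by (simp add: in_ideal_iff Y Z)
    hence "((\<lambda>i. hs_norm (k i) (Y i + Z i)) \<longlongrightarrow> 0) \<alpha>"
      using bounded_familyD[OF Y(1)] bounded_familyD[OF Z(1)]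
      by (intro tendsto_hs_le[where C = 1 and f = "\<lambda>i. hs_norm (k i) (Y i) + hs_norm (k i) (Z i)"])
         (auto intro: hs_norm_add)
    thus "a \<oplus>\<^bsub>MP\<^esub> b \<in> MJ"
      unfolding Y(2) Z(2) product_ops by (simp add: in_ideal_iff bounded_family_add Y Z)
  qed
  fix a x assume a: "a \<in> MJ" and x: "x \<in> carrier MP"
  obtain Y where Y: "bounded_family Y" "a = restrict Y I" using a sub product_elementE by blast
  obtain X where X: "bounded_family X" "x = restrict X I" using x product_elementE by blast
  obtain C where C: "0 \<le> C" "\<And>i. op_norm (X i) \<le> C" using X bounded_familyE by metis
  note D = bounded_familyD[OF Y(1)] bounded_familyD[OF X(1)]
  have lim: "((\<lambda>i. hs_norm (k i) (Y i)) \<longlongrightarrow> 0) \<alpha>" using a unfolding Y(2) in_ideal_iff[OF Y(1)] .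
  have "hs_norm (k i) (X i * Y i) \<le> C * hs_norm (k i) (Y i)" for i
    by (rule order_trans[OF hs_norm_mult_left[OF D(2,1)]])
       (rule mult_right_mono[OF C(2) hs_norm_nonneg[OF D(1)]])
  hence "((\<lambda>i. hs_norm (k i) (X i * Y i)) \<longlongrightarrow> 0) \<alpha>"
    by (intro tendsto_hs_le[OF _ _ lim]) (use D in auto)
  thus "x \<otimes>\<^bsub>MP\<^esub> a \<in> MJ"
    unfolding Y(2) X(2) product_ops by (simp add: in_ideal_iff bounded_family_mult Y X)
  have "hs_norm (k i) (Y i * X i) \<le> C * hs_norm (k i) (Y i)" for i
    by (rule order_trans[OF hs_norm_mult_right[OF D]])
       (use mult_left_mono[OF C(2) hs_norm_nonneg[OF D(1)]] in \<open>simp add: mult.commute\<close>)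
  hence "((\<lambda>i. hs_norm (k i) (Y i * X i)) \<longlongrightarrow> 0) \<alpha>"
    by (intro tendsto_hs_le[OF _ _ lim]) (use D in auto)
  thus "a \<otimes>\<^bsub>MP\<^esub> x \<in> MJ"
    unfolding Y(2) X(2) product_ops by (simp add: in_ideal_iff bounded_family_mult Y X)
qed

lemma coset_of_eq_iff:
  assumes "bounded_family Y" "bounded_family Z"
  shows "coset_of Y = coset_of Z \<longleftrightarrow> ((\<lambda>i. hs_norm (k i) (Y i - Z i)) \<longlongrightarrow> 0) \<alpha>"
  unfolding coset_of_def ultra_coset_def
    ring.quotient_eq_iff_same_a_r_cos[OF ring_product ideal_trace_null restrict_in_product[OF assms(1)]
      restrict_in_product[OF assms(2)], symmetric]
    product_minus[OF assms] in_ideal_iff[OF bounded_family_minus[OF assms]] ..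

lemma coset_of_closed: "bounded_family Y \<Longrightarrow> coset_of Y \<in> carrier MU"
  by (auto simp: coset_of_def ultra_coset_def tracial_ultraproduct_def FactRing_def Let_def
      A_RCOSETS_def' intro!: restrict_in_product)

lemma coset_of_mult:
  "bounded_family Y \<Longrightarrow> bounded_family Z \<Longrightarrow> coset_of Y \<otimes>\<^bsub>MU\<^esub> coset_of Z = coset_of (\<lambda>i. Y i * Z i)"
  using ideal.rcoset_mult_add[OF ideal_trace_null restrict_in_product restrict_in_product, of Y Z]
  by (simp add: coset_of_def ultra_coset_def tracial_ultraproduct_def FactRing_def Let_def product_ops)

lemma coset_of_add:
  "bounded_family Y \<Longrightarrow> bounded_family Z \<Longrightarrow> coset_of Y \<oplus>\<^bsub>MU\<^esub> coset_of Z = coset_of (\<lambda>i. Y i + Z i)"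
  using ideal.a_rcos_sum[OF ideal_trace_null restrict_in_product restrict_in_product, of Y Z]
  by (simp add: coset_of_def ultra_coset_def tracial_ultraproduct_def FactRing_def Let_def product_ops)

lemma coset_of_one: "\<one>\<^bsub>MU\<^esub> = coset_of (\<lambda>i. 1\<^sub>m (k i))"
  by (simp add: coset_of_def ultra_coset_def tracial_ultraproduct_def FactRing_def Let_def product_ops)

lemma coset_of_self: "bounded_family Y \<Longrightarrow> restrict Y I \<in> coset_of Y"
proof -
  interpret ideal MJ MP by (rule ideal_trace_null)
  show "bounded_family Y \<Longrightarrow> restrict Y I \<in> coset_of Y"
    unfolding coset_of_def ultra_coset_def by (intro a_rcos_self restrict_in_product)
qed

lemma coset_of_memE:
  assumes "bounded_family Y" "x \<in> coset_of Y"
  obtains Z where "bounded_family Z" "x = restrict Z I" "((\<lambda>i. hs_norm (k i) (Z i - Y i)) \<longlongrightarrow> 0) \<alpha>"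
proof -
  interpret ideal MJ MP by (rule ideal_trace_null)
  have x: "x \<in> carrier MP"
    using assms(2) a_r_coset_subset_G[OF a_subset restrict_in_product[OF assms(1)]]
    unfolding coset_of_def ultra_coset_def by blast
  then obtain Z where Z: "bounded_family Z" "x = restrict Z I" by (metis product_elementE)
  have "MJ +>\<^bsub>MP\<^esub> restrict Y I = MJ +>\<^bsub>MP\<^esub> x"
    by (rule a_repr_independence)
       (use assms(2) restrict_in_product[OF assms(1)] in \<open>simp_all add: coset_of_def ultra_coset_def abelian_subgroup_axioms a_subgroup\<close>)
  hence "coset_of Z = coset_of Y" by (simp add: coset_of_def ultra_coset_def Z(2))
  thus ?thesis using that[OF Z] coset_of_eq_iff[OF Z(1) assms(1)] by simp
qed

text \<open>An operation on representatives that scales Hilbert-Schmidt distances by a constant sends all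
elements of a coset into one and the same coset.\<close>

lemma coset_of_union:
  assumes Y: "bounded_family Y"
    and T: "\<And>Z. bounded_family Z \<Longrightarrow> bounded_family (\<lambda>i. T (Z i))"
    and hs: "\<And>Z i. bounded_family Z \<Longrightarrow> hs_norm (k i) (T (Z i) - T (Y i)) = C * hs_norm (k i) (Z i - Y i)"
    and F: "\<And>Z. F (restrict Z I) = restrict (\<lambda>i. T (Z i)) I"
  shows "(\<Union>a\<in>coset_of Y. MJ +>\<^bsub>MP\<^esub> F a) = coset_of (\<lambda>i. T (Y i))"
proof -
  have "MJ +>\<^bsub>MP\<^esub> F a = coset_of (\<lambda>i. T (Y i))" if "a \<in> coset_of Y" for a
  proof -
    obtain Z where Z: "bounded_family Z" "a = restrict Z I" "((\<lambda>i. hs_norm (k i) (Z i - Y i)) \<longlongrightarrow> 0) \<alpha>"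
      using coset_of_memE[OF Y \<open>a \<in> coset_of Y\<close>] .
    have "MJ +>\<^bsub>MP\<^esub> F a = coset_of (\<lambda>i. T (Z i))"
      by (simp add: Z(2) F coset_of_def ultra_coset_def)
    also have "\<dots> = coset_of (\<lambda>i. T (Y i))"
      unfolding coset_of_eq_iff[OF T[OF Z(1)] T[OF Y]] hs[OF Z(1)] by (rule tendsto_mult_right_zero[OF Z(3)])
    finally show ?thesis .
  qed
  moreover have "coset_of Y \<noteq> {}" using coset_of_self[OF Y] by blast
  ultimately show ?thesis by auto
qed

lemma coset_of_smult:
  assumes Y: "bounded_family Y"
  shows "c \<odot>\<^bsub>MU\<^esub> coset_of Y = coset_of (\<lambda>i. c \<cdot>\<^sub>m Y i)"
proof -
  have "(\<Union>a\<in>coset_of Y. MJ +>\<^bsub>MP\<^esub> (c \<odot>\<^bsub>MP\<^esub> a)) = coset_of (\<lambda>i. c \<cdot>\<^sub>m Y i)"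
  proof (rule coset_of_union[OF Y, where C = "cmod c"])
    fix Z i assume Z: "bounded_family Z"
    have "c \<cdot>\<^sub>m Z i - c \<cdot>\<^sub>m Y i = c \<cdot>\<^sub>m (Z i - Y i)"
      using bounded_familyD[OF Y, of i] bounded_familyD[OF Z, of i]
      by (intro eq_matI) (auto simp: right_diff_distrib)
    thus "hs_norm (k i) (c \<cdot>\<^sub>m Z i - c \<cdot>\<^sub>m Y i) = cmod c * hs_norm (k i) (Z i - Y i)"
      using hs_norm_smult[OF minus_carrier_mat[OF bounded_familyD[OF Y]]] by metis
  qed (auto simp: bounded_family_smult product_ops)
  thus ?thesis by (simp add: tracial_ultraproduct_def Let_def)
qed

lemma coset_of_star:
  assumes Y: "bounded_family Y"
  shows "star MU (coset_of Y) = coset_of (\<lambda>i. mat_adjoint (Y i))"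
proof -
  have "(\<Union>a\<in>coset_of Y. MJ +>\<^bsub>MP\<^esub> star MP a) = coset_of (\<lambda>i. mat_adjoint (Y i))"
  proof (rule coset_of_union[OF Y, where C = 1 and T = mat_adjoint])
    fix Z i assume Z: "bounded_family Z"
    show "hs_norm (k i) (mat_adjoint (Z i) - mat_adjoint (Y i)) = 1 * hs_norm (k i) (Z i - Y i)"
      using hs_norm_adjoint[OF minus_carrier_mat[OF bounded_familyD[OF Y, of i]], of "Z i"]
        mat_adjoint_minus[OF bounded_familyD[OF Z, of i] bounded_familyD[OF Y, of i]] by simp
  qed (auto simp: bounded_family_adjoint product_ops)
  thus ?thesis by (simp add: tracial_ultraproduct_def Let_def)
qed

end


section \<open>*-polynomials along a net of microstates\<close>

definition valid_word :: "nat \<Rightarrow> (nat \<times> bool) list \<Rightarrow> bool" where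
  "valid_word n w \<longleftrightarrow> set w \<subseteq> {..<n} \<times> UNIV"

text \<open>The adjoint of a monomial is the monomial of this word.\<close>

definition star_word :: "(nat \<times> bool) list \<Rightarrow> (nat \<times> bool) list" where
  "star_word w = rev (map (\<lambda>(j, s). (j, \<not> s)) w)"

lemma valid_word_simps [simp]:
  "valid_word n []" "valid_word n (l # w) \<longleftrightarrow> fst l < n \<and> valid_word n w"
  "valid_word n (v @ w) \<longleftrightarrow> valid_word n v \<and> valid_word n w"
  by (cases l; auto simp: valid_word_def)+

lemma valid_star_word: "valid_word n w \<Longrightarrow> valid_word n (star_word w)"
  by (auto simp: valid_word_def star_word_def)

lemma monomial_val_simps [simp]:
  "monomial_val A xs [] = \<one>\<^bsub>A\<^esub>"
  "monomial_val A xs (l # w) = letter_val A xs l \<otimes>\<^bsub>A\<^esub> monomial_val A xs w"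
  by (simp_all add: monomial_val_def)

context unital_cstar_algebra
begin

lemma letter_closed:
  "set xs \<subseteq> carrier A \<Longrightarrow> fst l < length xs \<Longrightarrow> letter_val A xs l \<in> carrier A"
  using nth_mem by (auto simp: letter_val_def intro!: star_closed)

lemma monomial_closed:
  "set xs \<subseteq> carrier A \<Longrightarrow> valid_word (length xs) w \<Longrightarrow> monomial_val A xs w \<in> carrier A"
  by (induction w) (auto intro: letter_closed)

lemma monomial_append:
  assumes "set xs \<subseteq> carrier A" "valid_word (length xs) v" "valid_word (length xs) w"
  shows "monomial_val A xs (v @ w) = monomial_val A xs v \<otimes> monomial_val A xs w"
  using assms(2) by (induction v) (auto simp: assms monomial_closed letter_closed m_assoc)

lemma monomial_star:
  assumes xs: "set xs \<subseteq> carrier A" and w: "valid_word (length xs) w"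
  shows "star A (monomial_val A xs w) = monomial_val A xs (star_word w)"
  using w
proof (induction w)
  case Nil
  thus ?case by (simp add: star_word_def star_one)
next
  case (Cons l w)
  obtain j s where l: "l = (j, s)" by force
  have j: "xs ! j \<in> carrier A" using xs Cons.prems l by (auto intro: nth_mem)
  have "star A (letter_val A xs l) = letter_val A xs (j, \<not> s)"
    using j by (simp add: l letter_val_def star_star)
  moreover have "monomial_val A xs (star_word (l # w)) = monomial_val A xs (star_word w) \<otimes> monomial_val A xs [(j, \<not> s)]"
    unfolding star_word_def l using Cons.prems l valid_star_word[of "length xs" w] xs
    by (simp add: monomial_append[OF xs] star_word_def del: monomial_val_simps)
  ultimately show ?case
    using Cons xs letter_closed[OF xs, of l] letter_closed[OF xs, of "(j, \<not> s)"] l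
    by (simp add: star_mult monomial_closed)
qed

end

lemma mat_letter_closed:
  "set Xs \<subseteq> carrier_mat k k \<Longrightarrow> fst l < length Xs \<Longrightarrow> letter_val (mat_calg k) Xs l \<in> carrier_mat k k"
  using nth_mem by (auto simp: letter_val_def)

lemma mat_monomial_closed:
  "set Xs \<subseteq> carrier_mat k k \<Longrightarrow> valid_word (length Xs) w \<Longrightarrow> monomial_val (mat_calg k) Xs w \<in> carrier_mat k k"
  by (induction w) (auto intro!: square_mult_closed mat_letter_closed)

lemma mat_monomial_append:
  assumes "set Xs \<subseteq> carrier_mat k k" "valid_word (length Xs) v" "valid_word (length Xs) w"
  shows "monomial_val (mat_calg k) Xs (v @ w) = monomial_val (mat_calg k) Xs v * monomial_val (mat_calg k) Xs w"
  using assms(2)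
proof (induction v)
  case Nil
  thus ?case using mat_monomial_closed[OF assms(1,3)] by simp
next
  case (Cons l v)
  thus ?case
    using mat_letter_closed[OF assms(1), of l] mat_monomial_closed[OF assms(1), of v] mat_monomial_closed[OF assms(1,3)]
    by (simp add: assoc_mult_mat[of _ k k _ k _ k])
qed

lemma mat_monomial_star:
  assumes xs: "set Xs \<subseteq> carrier_mat k k" and w: "valid_word (length Xs) w"
  shows "mat_adjoint (monomial_val (mat_calg k) Xs w) = monomial_val (mat_calg k) Xs (star_word w)"
  using w
proof (induction w)
  case Nil
  thus ?case by (simp add: star_word_def)
next
  case (Cons l w)
  obtain j s where l: "l = (j, s)" by force
  have j: "Xs ! j \<in> carrier_mat k k" using xs Cons.prems l by (auto intro: nth_mem)
  have "mat_adjoint (letter_val (mat_calg k) Xs l) = letter_val (mat_calg k) Xs (j, \<not> s)"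
    using j by (simp add: l letter_val_def)
  moreover have "monomial_val (mat_calg k) Xs (star_word (l # w)) = monomial_val (mat_calg k) Xs (star_word w) * monomial_val (mat_calg k) Xs [(j, \<not> s)]"
    unfolding star_word_def l using Cons.prems l valid_star_word[of "length Xs" w] xs
    by (simp add: mat_monomial_append[OF xs] star_word_def del: monomial_val_simps)
  ultimately show ?case
    using Cons xs mat_letter_closed[OF xs, of l] mat_letter_closed[OF xs, of "(j, \<not> s)"] l mat_monomial_closed[OF xs, of w]
    by (simp add: mat_adjoint_mult[of _ k k _ k])
qed

text \<open>A net of matrix tuples, uniformly bounded in operator norm, whose *-moments converge along the
ultrafilter to those of \<open>xs\<close> with respect to \<open>\<tau>\<close>.\<close>

locale microstate_net = matrix_ultraproduct I \<alpha> k + unital_cstar_algebra A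
  for I :: "'i set" and \<alpha> and k and A :: "'a calg" (structure) +
  fixes \<tau> :: "'a \<Rightarrow> complex" and xs :: "'a list" and X :: "'i \<Rightarrow> complex mat list" and R :: real
  assumes nontrivial: "nontrivial_ultrafilter I \<alpha>"
    and trace: "tracial_state A \<tau>"
    and xs_closed: "set xs \<subseteq> carrier A"
    and generated: "cstar_generated A (set xs) = carrier A"
    and X_tuple: "X i \<in> mat_tuples (length xs) (k i)"
    and X_bound: "Y \<in> set (X i) \<Longrightarrow> op_norm Y \<le> R"
    and moments: "valid_word (length xs) w \<Longrightarrow>
      ((\<lambda>i. ntrace (k i) (monomial_val (mat_calg (k i)) (X i) w)) \<longlongrightarrow> \<tau> (monomial_val A xs w)) \<alpha>"
begin

abbreviation "xmon w \<equiv> monomial_val A xs w"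
abbreviation "Xmon w i \<equiv> monomial_val (mat_calg (k i)) (X i) w"
abbreviation "valid w \<equiv> valid_word (length xs) w"

lemma X_len: "length (X i) = length xs" and X_closed: "set (X i) \<subseteq> carrier_mat (k i) (k i)"
  using X_tuple[of i] by (auto simp: mat_tuples_def)

lemma mono_closed: "valid w \<Longrightarrow> xmon w \<in> carrier A"
  by (rule monomial_closed[OF xs_closed])

lemma Mono_closed: "valid w \<Longrightarrow> Xmon w i \<in> carrier_mat (k i) (k i)"
  by (rule mat_monomial_closed[OF X_closed]) (simp add: X_len)

lemma bounded_letter: "fst l < length xs \<Longrightarrow> bounded_family (\<lambda>i. letter_val (mat_calg (k i)) (X i) l)"
proof (rule bounded_familyI)
  assume l: "fst l < length xs"
  fix i
  show "letter_val (mat_calg (k i)) (X i) l \<in> carrier_mat (k i) (k i)"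
    using mat_letter_closed[OF X_closed, of l i] l by (simp add: X_len)
  show "op_norm (letter_val (mat_calg (k i)) (X i) l) \<le> R"
    using X_bound[of "X i ! fst l" i] l X_len[of i] by (simp add: letter_val_def op_norm_adjoint)
qed

lemma bounded_Mono: "valid w \<Longrightarrow> bounded_family (Xmon w)"
proof (induction w)
  case Nil
  thus ?case using bounded_family_one by simp
next
  case (Cons l w)
  thus ?case using bounded_family_mult[OF bounded_letter[of l]] by simp
qed

text \<open>\<open>pol b Z\<close>: one and the same *-polynomial takes the value \<open>b\<close> at \<open>xs\<close> and the values \<open>Z i\<close> at \<open>X i\<close>.\<close>

inductive pol :: "'a \<Rightarrow> ('i \<Rightarrow> complex mat) \<Rightarrow> bool" where
  zero: "pol \<zero> (\<lambda>i. 0\<^sub>m (k i) (k i))"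
| add_monomial: "pol b Z \<Longrightarrow> valid w \<Longrightarrow> pol (c \<odot> xmon w \<oplus> b) (\<lambda>i. c \<cdot>\<^sub>m Xmon w i + Z i)"

lemma pol_closed: "pol b Z \<Longrightarrow> b \<in> carrier A"
  by (induction rule: pol.induct) (auto simp: mono_closed)

lemma pol_bounded: "pol b Z \<Longrightarrow> bounded_family Z"
proof (induction rule: pol.induct)
  case zero
  show ?case by (rule bounded_family_zero)
next
  case (add_monomial b Z w c)
  show ?case
    by (rule bounded_family_add[OF bounded_family_smult[OF bounded_Mono[OF add_monomial.hyps(2)]] add_monomial.IH])
qed

lemma pol_mat_closed: "pol b Z \<Longrightarrow> Z i \<in> carrier_mat (k i) (k i)"
  by (rule bounded_familyD[OF pol_bounded])

lemma pol_trace: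
  "pol b Z \<Longrightarrow> ((\<lambda>i. ntrace (k i) (Z i)) \<longlongrightarrow> \<tau> b) \<alpha>"
proof (induction rule: pol.induct)
  case zero
  have "\<tau> (0 \<odot> \<zero>) = 0 * \<tau> \<zero>" using trace unfolding tracial_state_def by blast
  hence "\<tau> \<zero> = 0" by (simp add: scalar.smult_r_null)
  thus ?case by (simp add: ntrace_def)
next
  case (add_monomial b Z w c)
  have "ntrace (k i) (c \<cdot>\<^sub>m Xmon w i + Z i) = c * ntrace (k i) (Xmon w i) + ntrace (k i) (Z i)" for i
    using Mono_closed[OF add_monomial.hyps(2)] pol_mat_closed[OF add_monomial.hyps(1)]
    by (simp add: ntrace_add ntrace_smult)
  moreover have "\<tau> (c \<odot> xmon w \<oplus> b) = c * \<tau> (xmon w) + \<tau> b"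
    using trace pol_closed[OF add_monomial.hyps(1)] mono_closed[OF add_monomial.hyps(2)]
    by (simp add: tracial_state_def)
  ultimately show ?case
    using add_monomial.IH moments[OF add_monomial.hyps(2)] by (auto intro!: tendsto_intros)
qed

lemma pol_add: "pol b Z \<Longrightarrow> pol b' Z' \<Longrightarrow> pol (b \<oplus> b') (\<lambda>i. Z i + Z' i)"
proof (induction rule: pol.induct)
  case zero
  have "\<zero> \<oplus> b' = b'" using pol_closed[OF zero] by simp
  moreover have "(\<lambda>i. 0\<^sub>m (k i) (k i) + Z' i) = Z'"
    using pol_mat_closed[OF zero] by auto
  ultimately show ?case using zero by simp
next
  case (add_monomial b Z w c)
  have eq: "(\<lambda>i. c \<cdot>\<^sub>m Xmon w i + (Z i + Z' i)) = (\<lambda>i. c \<cdot>\<^sub>m Xmon w i + Z i + Z' i)"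
  proof
    fix i show "c \<cdot>\<^sub>m Xmon w i + (Z i + Z' i) = c \<cdot>\<^sub>m Xmon w i + Z i + Z' i"
      using Mono_closed[OF add_monomial.hyps(2), of i] pol_mat_closed[OF add_monomial.hyps(1), of i]
        pol_mat_closed[OF add_monomial.prems, of i]
      by (simp add: assoc_add_mat[of _ "k i" "k i"])
  qed
  have "c \<odot> xmon w \<oplus> b \<oplus> b' = c \<odot> xmon w \<oplus> (b \<oplus> b')"
    using mono_closed[OF add_monomial.hyps(2)] pol_closed[OF add_monomial.hyps(1)]
      pol_closed[OF add_monomial.prems] by (simp add: a_assoc)
  thus ?case
    using pol.add_monomial[OF add_monomial.IH[OF add_monomial.prems] add_monomial.hyps(2), of c]
    unfolding eq by simp
qed

lemma pol_smult: "pol b Z \<Longrightarrow> pol (c \<odot> b) (\<lambda>i. c \<cdot>\<^sub>m Z i)"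
proof (induction rule: pol.induct)
  case zero
  thus ?case using pol.zero by (simp add: scalar.smult_r_null smult_zero_mat)
next
  case (add_monomial b Z w d)
  have eq: "(\<lambda>i. (c * d) \<cdot>\<^sub>m Xmon w i + c \<cdot>\<^sub>m Z i) = (\<lambda>i. c \<cdot>\<^sub>m (d \<cdot>\<^sub>m Xmon w i + Z i))"
  proof
    fix i show "(c * d) \<cdot>\<^sub>m Xmon w i + c \<cdot>\<^sub>m Z i = c \<cdot>\<^sub>m (d \<cdot>\<^sub>m Xmon w i + Z i)"
      using Mono_closed[OF add_monomial.hyps(2), of i] pol_mat_closed[OF add_monomial.hyps(1), of i]
      by (intro eq_matI) (auto simp: algebra_simps)
  qed
  have "c \<odot> (d \<odot> xmon w \<oplus> b) = (c * d) \<odot> xmon w \<oplus> c \<odot> b"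
    using mono_closed[OF add_monomial.hyps(2)] pol_closed[OF add_monomial.hyps(1)]
      scalar.smult_r_distr[of c "d \<odot> xmon w" b] scalar.smult_assoc1[of c d "xmon w"] by simp
  thus ?case using pol.add_monomial[OF add_monomial.IH add_monomial.hyps(2), of "c * d"]
    unfolding eq by simp
qed

lemma pol_minus:
  assumes "pol b Z" "pol b' Z'"
  shows "pol (b \<ominus> b') (\<lambda>i. Z i - Z' i)"
proof -
  have "(\<lambda>i. Z i + (-1) \<cdot>\<^sub>m Z' i) = (\<lambda>i. Z i - Z' i)"
  proof
    fix i show "Z i + (-1) \<cdot>\<^sub>m Z' i = Z i - Z' i"
      using pol_mat_closed[OF assms(1), of i] pol_mat_closed[OF assms(2), of i] by (intro eq_matI) auto
  qed
  thus ?thesis using pol_add[OF assms(1) pol_smult[OF assms(2), of "-1"]] pol_closed[OF assms(2)]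
    by (simp add: a_minus_def a_inv_eq_smult)
qed

lemma pol_monomial: "valid w \<Longrightarrow> pol (xmon w) (Xmon w)"
proof -
  assume w: "valid w"
  have "(\<lambda>i. 1 \<cdot>\<^sub>m Xmon w i + 0\<^sub>m (k i) (k i)) = Xmon w"
    using Mono_closed[OF w] by (intro ext eq_matI) auto
  thus ?thesis using pol.add_monomial[OF pol.zero w, of 1] mono_closed[OF w] scalar.smult_one[of "xmon w"] by simp
qed

lemma pol_one: "pol \<one> (\<lambda>i. 1\<^sub>m (k i))"
  using pol_monomial[of "[]"] by simp

lemma pol_monomial_mult: "pol b Z \<Longrightarrow> valid v \<Longrightarrow> pol (xmon v \<otimes> b) (\<lambda>i. Xmon v i * Z i)"
proof (induction rule: pol.induct)
  case zero
  have "(\<lambda>i. Xmon v i * 0\<^sub>m (k i) (k i)) = (\<lambda>i. 0\<^sub>m (k i) (k i))"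
    using Mono_closed[OF zero] by (auto intro!: ext right_mult_zero_mat)
  thus ?case using mono_closed[OF zero] pol.zero by simp
next
  case (add_monomial b Z w c)
  note v = \<open>valid v\<close> and w = add_monomial.hyps(2)
  have eq: "(\<lambda>i. c \<cdot>\<^sub>m Xmon (v @ w) i + Xmon v i * Z i) = (\<lambda>i. Xmon v i * (c \<cdot>\<^sub>m Xmon w i + Z i))"
  proof
    fix i show "c \<cdot>\<^sub>m Xmon (v @ w) i + Xmon v i * Z i = Xmon v i * (c \<cdot>\<^sub>m Xmon w i + Z i)"
      using Mono_closed[OF w, of i] Mono_closed[OF v, of i] pol_mat_closed[OF add_monomial.hyps(1), of i]
        mat_monomial_append[OF X_closed[of i], of v w] v w
      by (simp add: X_len mult_add_distrib_mat[of _ "k i" "k i" _ "k i"] mult_smult_distrib[of _ "k i" "k i" _ "k i"])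
  qed
  have "xmon v \<otimes> (c \<odot> xmon w \<oplus> b) = c \<odot> xmon (v @ w) \<oplus> xmon v \<otimes> b"
    using mono_closed[OF v] mono_closed[OF w] pol_closed[OF add_monomial.hyps(1)]
    by (simp add: r_distr smult_mult_right monomial_append[OF xs_closed v w])
  thus ?case using pol.add_monomial[OF add_monomial.IH[OF v], of "v @ w" c] v w
    unfolding eq by simp
qed

lemma pol_mult: "pol b Z \<Longrightarrow> pol b' Z' \<Longrightarrow> pol (b \<otimes> b') (\<lambda>i. Z i * Z' i)"
proof (induction rule: pol.induct)
  case zero
  have "(\<lambda>i. 0\<^sub>m (k i) (k i) * Z' i) = (\<lambda>i. 0\<^sub>m (k i) (k i))"
    using pol_mat_closed[OF zero] by (auto intro!: ext left_mult_zero_mat)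
  thus ?case using pol_closed[OF zero] pol.zero by simp
next
  case (add_monomial b Z w c)
  note w = add_monomial.hyps(2) and b' = add_monomial.prems
  have eq: "(\<lambda>i. c \<cdot>\<^sub>m (Xmon w i * Z' i) + Z i * Z' i) = (\<lambda>i. (c \<cdot>\<^sub>m Xmon w i + Z i) * Z' i)"
  proof
    fix i show "c \<cdot>\<^sub>m (Xmon w i * Z' i) + Z i * Z' i = (c \<cdot>\<^sub>m Xmon w i + Z i) * Z' i"
      using Mono_closed[OF w, of i] pol_mat_closed[OF b', of i] pol_mat_closed[OF add_monomial.hyps(1), of i]
      by (simp add: add_mult_distrib_mat[of _ "k i" "k i" _ _ "k i"] mult_smult_assoc_mat[of _ "k i" "k i" _ "k i"])
  qed
  have "(c \<odot> xmon w \<oplus> b) \<otimes> b' = c \<odot> (xmon w \<otimes> b') \<oplus> b \<otimes> b'"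
    using mono_closed[OF w] pol_closed[OF b'] pol_closed[OF add_monomial.hyps(1)]
    by (simp add: l_distr smult_mult_left)
  thus ?case
    using pol_add[OF pol_smult[OF pol_monomial_mult[OF b' w], of c] add_monomial.IH[OF b']]
    unfolding eq by simp
qed

lemma pol_star: "pol b Z \<Longrightarrow> pol (star A b) (\<lambda>i. mat_adjoint (Z i))"
proof (induction rule: pol.induct)
  case zero
  have "star A \<zero> = \<zero>" using cnorm_star[of \<zero>] star_closed[of \<zero>] by (simp add: cnorm_eq_0)
  thus ?case using pol.zero by simp
next
  case (add_monomial b Z w c)
  note w = add_monomial.hyps(2)
  have eq: "(\<lambda>i. cnj c \<cdot>\<^sub>m Xmon (star_word w) i + mat_adjoint (Z i)) = (\<lambda>i. mat_adjoint (c \<cdot>\<^sub>m Xmon w i + Z i))"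
  proof
    fix i show "cnj c \<cdot>\<^sub>m Xmon (star_word w) i + mat_adjoint (Z i) = mat_adjoint (c \<cdot>\<^sub>m Xmon w i + Z i)"
      using Mono_closed[OF w, of i] pol_mat_closed[OF add_monomial.hyps(1), of i]
        mat_monomial_star[OF X_closed, of i w] w
      by (simp add: X_len mat_adjoint_add[of _ "k i" "k i"] mat_adjoint_smult)
  qed
  have "star A (c \<odot> xmon w \<oplus> b) = cnj c \<odot> xmon (star_word w) \<oplus> star A b"
    using mono_closed[OF w] pol_closed[OF add_monomial.hyps(1)]
    by (simp add: star_add star_smult monomial_star[OF xs_closed w])
  thus ?case using pol.add_monomial[OF add_monomial.IH valid_star_word[OF w], of "cnj c"]
    unfolding eq by simp
qed

lemma pol_gen: "j < length xs \<Longrightarrow> pol (xs ! j) (\<lambda>i. X i ! j)"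
proof -
  assume j: "j < length xs"
  have "Xmon [(j, False)] i = X i ! j" for i
    using X_closed[of i] X_len[of i] j nth_mem[of j "X i"]
    by (simp add: letter_val_def subset_iff right_mult_one_mat[of _ "k i" "k i"])
  moreover have "xmon [(j, False)] = xs ! j" using xs_closed j nth_mem[of j xs] by (simp add: letter_val_def subset_iff)
  ultimately show ?thesis using pol_monomial[of "[(j, False)]"] j by simp
qed

text \<open>The square of the norm is the trace of \<open>b* b\<close>, and \<open>b* b\<close> is again a *-polynomial.\<close>

lemma pol_hs: "pol b Z \<Longrightarrow> ((\<lambda>i. hs_norm (k i) (Z i)) \<longlongrightarrow> norm2 A \<tau> b) \<alpha>"
  unfolding hs_norm_def norm2_def
  by (intro tendsto_real_sqrt tendsto_Re pol_trace pol_mult pol_star)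

lemma pol_hs_less:
  assumes "pol b Z" "cnorm A b < c"
  shows "eventually (\<lambda>i. hs_norm (k i) (Z i) < c) \<alpha>"
  using order_tendstoD(2)[OF pol_hs[OF assms(1)]] norm2_tracial_le[OF trace pol_closed[OF assms(1)]] assms(2)
  by force

lemma pol_odd_power:
  "pol b Z \<Longrightarrow> pol (odd_power A b q) (\<lambda>i. odd_power (mat_calg (k i)) (Z i) q)"
proof (induction q)
  case (Suc q)
  show ?case using pol_mult[OF Suc.IH[OF Suc.prems] pol_mult[OF pol_star[OF Suc.prems] Suc.prems]] by simp
qed simp

lemma cnorm_odd_power:
  assumes b: "b \<in> carrier A"
  shows "odd_power A b q \<in> carrier A \<and> cnorm A (odd_power A b q) \<le> cnorm A b ^ (2 * q + 1)"
proof (induction q)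
  case (Suc q)
  have "cnorm A (odd_power A b q \<otimes> (star A b \<otimes> b)) \<le> cnorm A (odd_power A b q) * (cnorm A b)\<^sup>2"
    using cnorm_mult[of "odd_power A b q" "star A b \<otimes> b"] Suc b star_closed[OF b] by (simp add: cstar_identity)
  also have "\<dots> \<le> cnorm A b ^ (2 * q + 1) * (cnorm A b)\<^sup>2"
    using Suc by (intro mult_right_mono) auto
  finally show ?case using Suc b star_closed[OF b] by (simp add: power2_eq_square mult_ac)
qed (use b in simp)

text \<open>By \<open>truncate_mat\<close>, the limit of the squared error is at most \<open>|b|^(4 q + 2) / M^(4 q)\<close> for every \<open>q\<close>,
and this tends to 0 as \<open>q\<close> grows because \<open>|b| < M\<close>.\<close>

lemma truncate_pol:
  assumes p: "pol b Z" and M: "cnorm A b < M" and e: "0 < \<eta>"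
  shows "eventually (\<lambda>i. hs_norm (k i) (Z i - truncate M (k i) (Z i)) < \<eta>) \<alpha>"
proof -
  have b: "b \<in> carrier A" by (rule pol_closed[OF p])
  have nb: "0 \<le> cnorm A b" by (rule cnorm_nonneg[OF b])
  have M0: "0 < M" using M nb by linarith
  define r where "r = cnorm A b / M"
  have r: "0 \<le> r" "r < 1" using nb M M0 by (auto simp: r_def)
  have "(\<lambda>q. (r ^ 2) ^ q) \<longlonglongrightarrow> 0" using r by (intro LIMSEQ_realpow_zero) (auto simp: power_less_one_iff)
  hence "(\<lambda>q. cnorm A b * (r ^ 2) ^ q) \<longlonglongrightarrow> 0" by (rule tendsto_mult_right_zero)
  from order_tendstoD(2)[OF this e] obtain q where q: "cnorm A b * (r ^ 2) ^ q < \<eta>"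
    by (auto simp: eventually_sequentially)
  have "cnorm A (odd_power A b q) \<le> cnorm A b ^ (2 * q + 1)" using cnorm_odd_power[OF b] by simp
  also have "\<dots> = cnorm A b * (r ^ 2) ^ q * M ^ (2 * q)"
    using M0 by (simp add: r_def power_divide power_mult[symmetric])
  also have "\<dots> < \<eta> * M ^ (2 * q)" using q M0 by simp
  finally have "eventually (\<lambda>i. hs_norm (k i) (odd_power (mat_calg (k i)) (Z i) q) < \<eta> * M ^ (2 * q)) \<alpha>"
    by (rule pol_hs_less[OF pol_odd_power[OF p]])
  thus ?thesis
  proof eventually_elim
    case (elim i)
    note Z = pol_mat_closed[OF p, of i]
    have O: "odd_power (mat_calg (k i)) (Z i) q \<in> carrier_mat (k i) (k i)"
      by (rule pol_mat_closed[OF pol_odd_power[OF p]])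
    have "(hs_norm (k i) (Z i - truncate M (k i) (Z i)))\<^sup>2
        \<le> (hs_norm (k i) (odd_power (mat_calg (k i)) (Z i) q))\<^sup>2 / M ^ (4 * q)"
      by (rule truncate(3)[OF Z M0])
    also have "\<dots> < (\<eta> * M ^ (2 * q))\<^sup>2 / M ^ (4 * q)"
      using M0 elim hs_norm_nonneg[OF O] by (intro divide_strict_right_mono power_strict_mono) auto
    also have "\<dots> = \<eta>\<^sup>2" using M0 by (simp add: power_mult_distrib power_mult[symmetric] mult.commute)
    finally show ?case using e by (intro power_less_imp_less_base[of _ 2 \<eta>]) auto
  qed
qed

end


section \<open>The homomorphism into the ultraproduct\<close>

context microstate_net
begin

text \<open>\<open>Y\<close> represents the value at \<open>a\<close> of the homomorphism under construction: some *-polynomial is at the same time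
near \<open>a\<close> in norm and near \<open>Y\<close> in the limit Hilbert-Schmidt norm.\<close>

definition approximates :: "'a \<Rightarrow> ('i \<Rightarrow> complex mat) \<Rightarrow> bool" where
  "approximates a Y \<longleftrightarrow> a \<in> carrier A \<and> bounded_family Y \<and>
     (\<forall>\<eta>>0. \<exists>b Z. pol b Z \<and> cnorm A (a \<ominus> b) < \<eta> \<and> eventually (\<lambda>i. hs_norm (k i) (Y i - Z i) < \<eta>) \<alpha>)"

lemma approximatesD:
  assumes "approximates a Y"
  shows "a \<in> carrier A" "bounded_family Y" "Y i \<in> carrier_mat (k i) (k i)"
  using assms bounded_familyD by (auto simp: approximates_def)

lemma approximatesE:
  assumes "approximates a Y" "0 < \<eta>"
  obtains b Z where "pol b Z" "b \<in> carrier A" "cnorm A (a \<ominus> b) < \<eta>"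
    "eventually (\<lambda>i. hs_norm (k i) (Y i - Z i) < \<eta>) \<alpha>"
  using assms pol_closed unfolding approximates_def by blast

lemma approximates_pol:
  assumes "pol b Z"
  shows "approximates b Z"
  unfolding approximates_def
proof (intro conjI allI impI)
  fix \<eta> :: real assume "0 < \<eta>"
  moreover have "Z i - Z i = 0\<^sub>m (k i) (k i)" for i
    using pol_mat_closed[OF assms, of i] by (intro eq_matI) auto
  ultimately have "pol b Z \<and> cnorm A (b \<ominus> b) < \<eta> \<and> (\<forall>\<^sub>F i in \<alpha>. hs_norm (k i) (Z i - Z i) < \<eta>)"
    using assms pol_closed[OF assms] by (simp add: hs_norm_zero a_minus_def r_neg)
  thus "\<exists>b' Z'. pol b' Z' \<and> cnorm A (b \<ominus> b') < \<eta> \<and> eventually (\<lambda>i. hs_norm (k i) (Z i - Z' i) < \<eta>) \<alpha>"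
    by blast
qed (use assms pol_closed pol_bounded in auto)

text \<open>Two *-polynomials near \<open>a\<close> are near each other in norm, hence by \<open>pol_hs_less\<close> also along the net.\<close>

lemma approximates_unique:
  assumes Y: "approximates a Y" and Y': "approximates a Y'"
  shows "((\<lambda>i. hs_norm (k i) (Y i - Y' i)) \<longlongrightarrow> 0) \<alpha>"
proof (rule tendstoI)
  fix e :: real assume "0 < e"
  hence e: "0 < e / 4" by simp
  note a = approximatesD[OF Y] and a' = approximatesD[OF Y']
  obtain b Z where b: "pol b Z" "b \<in> carrier A" "cnorm A (a \<ominus> b) < e / 4"
    and Z: "eventually (\<lambda>i. hs_norm (k i) (Y i - Z i) < e / 4) \<alpha>" using approximatesE[OF Y e] .
  obtain b' Z' where b': "pol b' Z'" "b' \<in> carrier A" "cnorm A (a \<ominus> b') < e / 4"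
    and Z': "eventually (\<lambda>i. hs_norm (k i) (Y' i - Z' i) < e / 4) \<alpha>" using approximatesE[OF Y' e] .
  have "cnorm A (b \<ominus> b') < e / 2"
    using cnorm_dist_triangle[of b a b'] cnorm_minus_commute[of a b] a b b' by simp
  from pol_hs_less[OF pol_minus[OF b(1) b'(1)] this] Z Z'
  show "eventually (\<lambda>i. dist (hs_norm (k i) (Y i - Y' i)) 0 < e) \<alpha>"
  proof eventually_elim
    case (elim i)
    note c = a(3)[of i] a'(3)[of i] pol_mat_closed[OF b(1), of i] pol_mat_closed[OF b'(1), of i]
    have "hs_norm (k i) (Y i - Y' i) \<le> hs_norm (k i) (Y i - Z i) + hs_norm (k i) (Z i - Y' i)"
      by (rule hs_norm_triangle) (use c in auto)
    also have "hs_norm (k i) (Z i - Y' i) \<le> hs_norm (k i) (Z i - Z' i) + hs_norm (k i) (Z' i - Y' i)"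
      by (rule hs_norm_triangle) (use c in auto)
    also have "hs_norm (k i) (Z' i - Y' i) = hs_norm (k i) (Y' i - Z' i)"
      by (rule hs_norm_minus_commute) (use c in auto)
    finally show ?case using elim hs_norm_nonneg[OF minus_carrier_mat[OF c(2)], of "Y i"] by simp
  qed
qed

text \<open>Let \<open>b m\<close> be *-polynomials in \<open>xs\<close> that converge to \<open>a\<close>, with values \<open>Z m\<close> at the net. \<open>F m\<close> collects the indices at which
the first \<open>m\<close> of the \<open>Z l\<close> and the truncation of \<open>Z m\<close> satisfy their limit estimates up to \<open>e m\<close>. Each \<open>F m\<close> belongs to the
ultrafilter, and each index lies in finitely many of them, thanks to the sets \<open>E n\<close> with empty intersection. So \<open>Y\<close> can use,
at each index, the last \<open>m\<close> that is good there; truncation at the common bound \<open>M\<close> keeps \<open>Y\<close> bounded.\<close>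

lemma approximates_exists:
  assumes a: "a \<in> carrier A"
  shows "\<exists>Y. approximates a Y"
proof -
  obtain E :: "nat \<Rightarrow> 'i set" where E: "\<And>n. eventually (\<lambda>i. i \<in> E n) \<alpha>" and E0: "(\<Inter>n. E n) = {}"
    using nontrivial by (auto simp: nontrivial_ultrafilter_def)
  define e where "e m = inverse (real (Suc m))" for m
  have e: "0 < e m" for m by (simp add: e_def)
  have e_mono: "e m \<le> e l" if "l \<le> m" for l m using that by (simp add: e_def)
  have "\<exists>b Z. pol b Z \<and> cnorm A (a \<ominus> b) < e m" for m
  proof -
    let ?D = "{b. \<exists>Z. pol b Z}"
    obtain b where "b \<in> ?D" "cnorm A (a \<ominus> b) < e m"
    proof (rule dense_subalgebra[OF generated _ _ _ _ _ _ _ a e[of m]])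
      show "set xs \<subseteq> ?D"
      proof
        fix x assume "x \<in> set xs"
        then obtain j where "j < length xs" "x = xs ! j" by (metis in_set_conv_nth)
        thus "x \<in> ?D" using pol_gen[of j] by blast
      qed
      show "?D \<subseteq> carrier A" using pol_closed by auto
      show "\<one> \<in> ?D" using pol_one by auto
      show "x \<oplus> y \<in> ?D" if "x \<in> ?D" "y \<in> ?D" for x y using that pol_add by blast
      show "x \<otimes> y \<in> ?D" if "x \<in> ?D" "y \<in> ?D" for x y using that pol_mult by blast
      show "c \<odot> x \<in> ?D" if "x \<in> ?D" for c x using that pol_smult by blast
      show "star A x \<in> ?D" if "x \<in> ?D" for x using that pol_star by blast
    qed
    thus ?thesis by blast
  qed
  then obtain b Z where p: "\<And>m. pol (b m) (Z m)" and ab: "\<And>m. cnorm A (a \<ominus> b m) < e m"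
    by metis
  have b: "b m \<in> carrier A" for m by (rule pol_closed[OF p])
  have Zc: "Z m i \<in> carrier_mat (k i) (k i)" for m i by (rule pol_mat_closed[OF p])
  have bb: "cnorm A (b l \<ominus> b m) < e l + e m" for l m
    using cnorm_dist_triangle[of "b l" a "b m"] cnorm_minus_commute[of a "b l"] a b ab[of l] ab[of m] by simp
  define M where "M = cnorm A a + 2"
  have M0: "0 < M" using cnorm_nonneg[OF a] by (simp add: M_def)
  have bM: "cnorm A (b m) < M" for m
  proof -
    have "b m = a \<ominus> (a \<ominus> b m)" using a b[of m] by algebra
    hence "cnorm A (b m) \<le> cnorm A a + cnorm A (a \<ominus> b m)"
      using cnorm_minus_le[of a "a \<ominus> b m"] a b[of m] by simp
    moreover have "e m \<le> 1" using e_mono[of 0 m] by (simp add: e_def)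
    ultimately show ?thesis using ab[of m] by (simp add: M_def)
  qed
  define F where "F m = {i. (\<forall>l\<le>m. i \<in> E l \<and> hs_norm (k i) (Z l i - Z m i) < e l + e m) \<and>
    hs_norm (k i) (Z m i - truncate M (k i) (Z m i)) < e m}" for m
  have evF: "eventually (\<lambda>i. i \<in> F m) \<alpha>" for m
  proof -
    have "eventually (\<lambda>i. i \<in> E l \<and> hs_norm (k i) (Z l i - Z m i) < e l + e m) \<alpha>" for l
      by (intro eventually_conj E pol_hs_less[OF pol_minus[OF p p] bb])
    hence "eventually (\<lambda>i. \<forall>l\<in>{..m}. i \<in> E l \<and> hs_norm (k i) (Z l i - Z m i) < e l + e m) \<alpha>"
      by (intro eventually_ball_finite) auto
    with truncate_pol[OF p bM e] show ?thesis
      by eventually_elim (simp add: F_def)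
  qed
  have finS: "finite {m. i \<in> F m}" for i
  proof -
    obtain n where n: "i \<notin> E n" using E0 by blast
    hence "{m. i \<in> F m} \<subseteq> {..n}" by (auto simp: F_def not_le intro: leI)
    thus ?thesis by (rule finite_subset) simp
  qed
  \<comment> \<open>The diagonal choice: at \<open>i\<close>, the best index whose requirements hold at \<open>i\<close>.\<close>
  define g where "g i = (if {m. i \<in> F m} = {} then 0 else Max {m. i \<in> F m})" for i
  define Y where "Y i = truncate M (k i) (Z (g i) i)" for i
  have Yc: "Y i \<in> carrier_mat (k i) (k i)" for i unfolding Y_def by (rule truncate(1)[OF Zc M0])
  have bY: "bounded_family Y"
    by (rule bounded_familyI[where C = M]) (auto simp: Y_def intro: truncate[OF Zc M0])
  have ev: "eventually (\<lambda>i. hs_norm (k i) (Y i - Z m i) < 3 * e m) \<alpha>" for m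
    using evF[of m]
  proof eventually_elim
    case (elim i)
    hence "{m. i \<in> F m} \<noteq> {}" by blast
    hence gi: "g i = Max {m. i \<in> F m}" unfolding g_def by (rule if_not_P)
    have "g i \<in> {m. i \<in> F m}" unfolding gi using elim finS by (intro Max_in) auto
    moreover have mg: "m \<le> g i" unfolding gi using elim finS by (intro Max_ge) auto
    ultimately have 1: "hs_norm (k i) (Z m i - Z (g i) i) < e m + e (g i)"
      and 2: "hs_norm (k i) (Z (g i) i - Y i) < e (g i)" by (auto simp: F_def Y_def)
    have "hs_norm (k i) (Z m i - Y i) \<le> hs_norm (k i) (Z m i - Z (g i) i) + hs_norm (k i) (Z (g i) i - Y i)"
      by (rule hs_norm_triangle[OF Zc Zc Yc])
    thus ?case using 1 2 e_mono[OF mg] hs_norm_minus_commute[OF Zc[of m i] Yc[of i]] by linarith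
  qed
  have "approximates a Y"
    unfolding approximates_def
  proof (intro conjI allI impI)
    fix \<eta> :: real assume "0 < \<eta>"
    then obtain m where m: "e m < \<eta> / 3" using reals_Archimedean[of "\<eta> / 3"] by (auto simp: e_def)
    have "eventually (\<lambda>i. hs_norm (k i) (Y i - Z m i) < \<eta>) \<alpha>"
      using ev[of m] by eventually_elim (use m in linarith)
    moreover have "cnorm A (a \<ominus> b m) < \<eta>" using ab[of m] m e[of m] by linarith
    ultimately show "\<exists>b Z. pol b Z \<and> cnorm A (a \<ominus> b) < \<eta> \<and> (\<forall>\<^sub>F i in \<alpha>. hs_norm (k i) (Y i - Z i) < \<eta>)"
      using p by blast
  qed (use a bY in auto)
  thus ?thesis by blast
qed

lemma approximates_add:
  assumes Y: "approximates a Y" and Y': "approximates a' Y'"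
  shows "approximates (a \<oplus> a') (\<lambda>i. Y i + Y' i)"
  unfolding approximates_def
proof (intro conjI allI impI)
  note c = approximatesD[OF Y] and c' = approximatesD[OF Y']
  show "a \<oplus> a' \<in> carrier A" using c c' by simp
  show "bounded_family (\<lambda>i. Y i + Y' i)" by (rule bounded_family_add[OF c(2) c'(2)])
  fix \<eta> :: real assume "0 < \<eta>"
  hence e: "0 < \<eta> / 2" by simp
  obtain b Z where b: "pol b Z" "b \<in> carrier A" "cnorm A (a \<ominus> b) < \<eta> / 2"
    and Z: "eventually (\<lambda>i. hs_norm (k i) (Y i - Z i) < \<eta> / 2) \<alpha>" using approximatesE[OF Y e] .
  obtain b' Z' where b': "pol b' Z'" "b' \<in> carrier A" "cnorm A (a' \<ominus> b') < \<eta> / 2"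
    and Z': "eventually (\<lambda>i. hs_norm (k i) (Y' i - Z' i) < \<eta> / 2) \<alpha>" using approximatesE[OF Y' e] .
  have "cnorm A ((a \<oplus> a') \<ominus> (b \<oplus> b')) < \<eta>"
    using cnorm_add_diff_le[of a a' b b'] c(1) c'(1) b b' by simp
  moreover have "eventually (\<lambda>i. hs_norm (k i) ((Y i + Y' i) - (Z i + Z' i)) < \<eta>) \<alpha>"
    using Z Z'
  proof eventually_elim
    case (elim i)
    note d = c(3)[of i] c'(3)[of i] pol_mat_closed[OF b(1), of i] pol_mat_closed[OF b'(1), of i]
    have "(Y i + Y' i) - (Z i + Z' i) = (Y i - Z i) + (Y' i - Z' i)"
      using d by (intro eq_matI) auto
    thus ?case using elim hs_norm_add[OF minus_carrier_mat[OF d(3)] minus_carrier_mat[OF d(4)], of "Y i" "Y' i"] by simp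
  qed
  ultimately show "\<exists>b Z. pol b Z \<and> cnorm A ((a \<oplus> a') \<ominus> b) < \<eta> \<and> eventually (\<lambda>i. hs_norm (k i) (Y i + Y' i - Z i) < \<eta>) \<alpha>"
    using pol_add[OF b(1) b'(1)] by blast
qed

lemma approximates_star:
  assumes Y: "approximates a Y"
  shows "approximates (star A a) (\<lambda>i. mat_adjoint (Y i))"
  unfolding approximates_def
proof (intro conjI allI impI)
  note d = approximatesD[OF Y]
  show "star A a \<in> carrier A" using d star_closed by simp
  show "bounded_family (\<lambda>i. mat_adjoint (Y i))" by (rule bounded_family_adjoint[OF d(2)])
  fix \<eta> :: real assume \<eta>: "0 < \<eta>"
  obtain b Z where b: "pol b Z" "b \<in> carrier A" "cnorm A (a \<ominus> b) < \<eta>"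
    and Z: "eventually (\<lambda>i. hs_norm (k i) (Y i - Z i) < \<eta>) \<alpha>"
    using approximatesE[OF Y \<eta>] .
  have "cnorm A (star A a \<ominus> star A b) < \<eta>"
    using b d(1) by (simp add: cnorm_star flip: star_minus)
  moreover have "hs_norm (k i) (mat_adjoint (Y i) - mat_adjoint (Z i)) = hs_norm (k i) (Y i - Z i)" for i
    using hs_norm_adjoint[OF minus_carrier_mat[OF pol_mat_closed[OF b(1), of i]], of "Y i"]
      mat_adjoint_minus[OF d(3)[of i] pol_mat_closed[OF b(1), of i]] by simp
  ultimately show "\<exists>b Z. pol b Z \<and> cnorm A (star A a \<ominus> b) < \<eta> \<and> eventually (\<lambda>i. hs_norm (k i) (mat_adjoint (Y i) - Z i) < \<eta>) \<alpha>"
    using pol_star[OF b(1)] Z by (intro exI conjI) auto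
qed

text \<open>The tolerance for the left factor depends on the norms of the polynomial chosen for the right
factor, so the right factor is approximated before the left one.\<close>

lemma approximates_mult:
  assumes Y: "approximates a Y" and Y': "approximates a' Y'"
  shows "approximates (a \<otimes> a') (\<lambda>i. Y i * Y' i)"
  unfolding approximates_def
proof (intro conjI allI impI)
  note c = approximatesD[OF Y] and c' = approximatesD[OF Y']
  show "a \<otimes> a' \<in> carrier A" using c c' by simp
  show "bounded_family (\<lambda>i. Y i * Y' i)" by (rule bounded_family_mult[OF c(2) c'(2)])
  obtain C where C: "0 \<le> C" "\<And>i. op_norm (Y i) \<le> C" using bounded_familyE[OF c(2)] by metis
  fix \<eta> :: real assume \<eta>: "0 < \<eta>"
  define K where "K = max C (cnorm A a) + 1"
  have K: "0 < K" "C \<le> K" "cnorm A a \<le> K" using C by (auto simp: K_def)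
  have "0 < \<eta> / (2 * K)" using \<eta> K by simp
  then obtain b' Z' where b': "pol b' Z'" "b' \<in> carrier A" "cnorm A (a' \<ominus> b') < \<eta> / (2 * K)"
    and Z': "eventually (\<lambda>i. hs_norm (k i) (Y' i - Z' i) < \<eta> / (2 * K)) \<alpha>" using approximatesE[OF Y'] by blast
  obtain C' where C': "0 \<le> C'" "\<And>i. op_norm (Z' i) \<le> C'" using bounded_familyE[OF pol_bounded[OF b'(1)]] by metis
  define K' where "K' = max C' (cnorm A b') + 1"
  have K': "0 < K'" "C' \<le> K'" "cnorm A b' \<le> K'" using C' by (auto simp: K'_def)
  have "0 < \<eta> / (2 * K')" using \<eta> K' by simp
  then obtain b Z where b: "pol b Z" "b \<in> carrier A" "cnorm A (a \<ominus> b) < \<eta> / (2 * K')"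
    and Z: "eventually (\<lambda>i. hs_norm (k i) (Y i - Z i) < \<eta> / (2 * K')) \<alpha>" using approximatesE[OF Y] by blast
  have split: "p * s + t * q < \<eta>"
    if "0 \<le> p" "p \<le> K" "0 \<le> s" "s < \<eta> / (2 * K)" "0 \<le> t" "t < \<eta> / (2 * K')" "0 \<le> q" "q \<le> K'" for p q s t
  proof -
    have "p * s \<le> K * s" using that by (intro mult_right_mono) auto
    also have "\<dots> < \<eta> / 2" using that K by (simp add: field_simps)
    finally have 1: "p * s < \<eta> / 2" .
    have "t * q \<le> t * K'" using that by (intro mult_left_mono) auto
    also have "\<dots> < \<eta> / 2" using that K' by (simp add: field_simps)
    finally show ?thesis using 1 by simp
  qed
  have "cnorm A (a \<otimes> a' \<ominus> b \<otimes> b') \<le> cnorm A a * cnorm A (a' \<ominus> b') + cnorm A (a \<ominus> b) * cnorm A b'"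
    by (rule cnorm_mult_diff_le) (use c(1) c'(1) b b' in auto)
  also have "\<dots> < \<eta>"
    by (rule split) (use K K' b b' c(1) c'(1) in \<open>auto intro: cnorm_nonneg\<close>)
  finally have "cnorm A (a \<otimes> a' \<ominus> b \<otimes> b') < \<eta>" .
  moreover have "eventually (\<lambda>i. hs_norm (k i) (Y i * Y' i - Z i * Z' i) < \<eta>) \<alpha>"
    using Z Z'
  proof eventually_elim
    case (elim i)
    note d = c(3)[of i] c'(3)[of i] pol_mat_closed[OF b(1), of i] pol_mat_closed[OF b'(1), of i]
    note m = minus_carrier_mat[OF d(3), of "Y i"] minus_carrier_mat[OF d(4), of "Y' i"]
    have "Y i * Y' i - Z i * Z' i = Y i * (Y' i - Z' i) + (Y i - Z i) * Z' i"
    proof -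
      have "Y i * (Y' i - Z' i) + (Y i - Z i) * Z' i = (Y i * Y' i - Y i * Z' i) + (Y i * Z' i - Z i * Z' i)"
        using d by (simp add: mult_minus_distrib_mat[of _ "k i" "k i" _ "k i"] minus_mult_distrib_mat[of _ "k i" "k i" _ _ "k i"])
      also have "\<dots> = Y i * Y' i - Z i * Z' i"
        using d by (intro eq_matI) (auto simp del: index_mult_mat(1))
      finally show ?thesis by simp
    qed
    hence "hs_norm (k i) (Y i * Y' i - Z i * Z' i) \<le> hs_norm (k i) (Y i * (Y' i - Z' i)) + hs_norm (k i) ((Y i - Z i) * Z' i)"
      using hs_norm_add[OF square_mult_closed[OF d(1) m(2)] square_mult_closed[OF m(1) d(4)]] by simp
    also have "\<dots> \<le> op_norm (Y i) * hs_norm (k i) (Y' i - Z' i) + hs_norm (k i) (Y i - Z i) * op_norm (Z' i)"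
      by (intro add_mono hs_norm_mult_left hs_norm_mult_right d m)
    also have "\<dots> < \<eta>"
      by (rule split) (use elim hs_norm_nonneg[OF m(1)] hs_norm_nonneg[OF m(2)] C(2)[of i] K C'(2)[of i] K' in auto)
    finally show ?case .
  qed
  ultimately show "\<exists>b Z. pol b Z \<and> cnorm A (a \<otimes> a' \<ominus> b) < \<eta> \<and> eventually (\<lambda>i. hs_norm (k i) (Y i * Y' i - Z i) < \<eta>) \<alpha>"
    using pol_mult[OF b(1) b'(1)] by blast
qed

text \<open>Scalar multiplication is multiplication by the *-polynomial \<^term>\<open>c \<odot> \<one>\<close>.\<close>

lemma approximates_smult:
  assumes Y: "approximates a Y"
  shows "approximates (c \<odot> a) (\<lambda>i. c \<cdot>\<^sub>m Y i)"
proof -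
  have "(\<lambda>i. (c \<cdot>\<^sub>m 1\<^sub>m (k i)) * Y i) = (\<lambda>i. c \<cdot>\<^sub>m Y i)"
  proof
    fix i show "(c \<cdot>\<^sub>m 1\<^sub>m (k i)) * Y i = c \<cdot>\<^sub>m Y i"
      using approximatesD(3)[OF Y, of i] by (simp add: mult_smult_assoc_mat[of _ "k i" "k i" _ "k i"])
  qed
  moreover have "(c \<odot> \<one>) \<otimes> a = c \<odot> a"
    using approximatesD(1)[OF Y] by (simp add: smult_mult_left)
  ultimately show ?thesis
    using approximates_mult[OF approximates_pol[OF pol_smult[OF pol_one, of c]] Y] by simp
qed

definition limit_hom :: "'a \<Rightarrow> ('i \<Rightarrow> complex mat) set" where
  "limit_hom a = coset_of (SOME Y. approximates a Y)"

lemma limit_hom_eq: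
  assumes "approximates a Y"
  shows "limit_hom a = coset_of Y"
proof -
  have "approximates a (SOME Y. approximates a Y)" using assms by (rule someI[of "approximates a"])
  thus ?thesis unfolding limit_hom_def
    using coset_of_eq_iff[OF approximatesD(2) approximatesD(2)] approximates_unique assms by blast
qed

theorem limit_hom: "limit_hom \<in> unital_star_hom A MU"
proof -
  have "limit_hom \<in> Ring.ring_hom A MU"
  proof (rule ring_hom_memI)
    fix x assume "x \<in> carrier A"
    then obtain Y where Y: "approximates x Y" using approximates_exists by blast
    show "limit_hom x \<in> carrier MU"
      unfolding limit_hom_eq[OF Y] by (rule coset_of_closed[OF approximatesD(2)[OF Y]])
    fix y assume "y \<in> carrier A"
    then obtain Y' where Y': "approximates y Y'" using approximates_exists by blast
    note b = approximatesD(2)[OF Y] approximatesD(2)[OF Y']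
    show "limit_hom (x \<otimes> y) = limit_hom x \<otimes>\<^bsub>MU\<^esub> limit_hom y"
      unfolding limit_hom_eq[OF Y] limit_hom_eq[OF Y'] limit_hom_eq[OF approximates_mult[OF Y Y']] coset_of_mult[OF b] ..
    show "limit_hom (x \<oplus> y) = limit_hom x \<oplus>\<^bsub>MU\<^esub> limit_hom y"
      unfolding limit_hom_eq[OF Y] limit_hom_eq[OF Y'] limit_hom_eq[OF approximates_add[OF Y Y']] coset_of_add[OF b] ..
  next
    show "limit_hom \<one> = \<one>\<^bsub>MU\<^esub>"
      unfolding limit_hom_eq[OF approximates_pol[OF pol_one]] coset_of_one ..
  qed
  moreover have "limit_hom (c \<odot> x) = c \<odot>\<^bsub>MU\<^esub> limit_hom x" if "x \<in> carrier A" for c x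
  proof -
    obtain Y where Y: "approximates x Y" using approximates_exists \<open>x \<in> carrier A\<close> by blast
    show ?thesis
      unfolding limit_hom_eq[OF Y] limit_hom_eq[OF approximates_smult[OF Y]] coset_of_smult[OF approximatesD(2)[OF Y]] ..
  qed
  moreover have "limit_hom (star A x) = star MU (limit_hom x)" if "x \<in> carrier A" for x
  proof -
    obtain Y where Y: "approximates x Y" using approximates_exists \<open>x \<in> carrier A\<close> by blast
    show ?thesis
      unfolding limit_hom_eq[OF Y] limit_hom_eq[OF approximates_star[OF Y]] coset_of_star[OF approximatesD(2)[OF Y]] ..
  qed
  ultimately show ?thesis by (simp add: unital_star_hom_def)
qed

lemma limit_hom_generator: "j < length xs \<Longrightarrow> limit_hom (xs ! j) = coset_of (\<lambda>i. X i ! j)"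
  by (rule limit_hom_eq[OF approximates_pol[OF pol_gen]])

end


section \<open>Good microstates are near representations\<close>

lemma mat_tuples_nth: "Xs \<in> mat_tuples n k \<Longrightarrow> j < n \<Longrightarrow> Xs ! j \<in> carrier_mat k k"
  by (auto simp: mat_tuples_def)

lemma tuple_norm2_eq:
  assumes "Xs \<in> mat_tuples n k" "Ys \<in> mat_tuples n k"
  shows "tuple_norm2 k (map2 (-) Xs Ys) = L2_set (\<lambda>j. hs_norm k (Xs ! j - Ys ! j)) {..<n}"
proof -
  have len: "length Xs = n" "length Ys = n" using assms by (auto simp: mat_tuples_def)
  have "(\<Sum>X\<leftarrow>map2 (-) Xs Ys. Re (ntrace k (mat_adjoint X * X)))
      = (\<Sum>j<n. Re (ntrace k (mat_adjoint (Xs ! j - Ys ! j) * (Xs ! j - Ys ! j))))"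
    using len by (simp add: sum_list_sum_nth atLeast0LessThan)
  also have "\<dots> = (\<Sum>j<n. (hs_norm k (Xs ! j - Ys ! j))\<^sup>2)"
    using assms by (intro sum.cong) (auto intro!: hs_norm_sq[symmetric] minus_carrier_mat mat_tuples_nth)
  finally show ?thesis by (simp add: tuple_norm2_def L2_set_def)
qed

lemma tuple_norm2_triangle:
  assumes "Xs \<in> mat_tuples n k" "Ys \<in> mat_tuples n k" "Zs \<in> mat_tuples n k"
  shows "tuple_norm2 k (map2 (-) Xs Zs) \<le> tuple_norm2 k (map2 (-) Xs Ys) + tuple_norm2 k (map2 (-) Ys Zs)"
proof -
  have "L2_set (\<lambda>j. hs_norm k (Xs ! j - Zs ! j)) {..<n}
      \<le> L2_set (\<lambda>j. hs_norm k (Xs ! j - Ys ! j) + hs_norm k (Ys ! j - Zs ! j)) {..<n}"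
    using assms by (intro L2_set_mono) (auto intro!: hs_norm_triangle hs_norm_nonneg minus_carrier_mat mat_tuples_nth)
  also have "\<dots> \<le> L2_set (\<lambda>j. hs_norm k (Xs ! j - Ys ! j)) {..<n} + L2_set (\<lambda>j. hs_norm k (Ys ! j - Zs ! j)) {..<n}"
    by (rule L2_set_triangle_ineq)
  finally show ?thesis
    unfolding tuple_norm2_eq[OF assms(1,3)] tuple_norm2_eq[OF assms(1,2)] tuple_norm2_eq[OF assms(2,3)] .
qed

lemma tuple_norm2_le:
  assumes "Xs \<in> mat_tuples n k" "Ys \<in> mat_tuples n k"
    and "\<And>j. j < n \<Longrightarrow> hs_norm k (Xs ! j - Ys ! j) \<le> c"
  shows "tuple_norm2 k (map2 (-) Xs Ys) \<le> n * c"
proof -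
  have "L2_set (\<lambda>j. hs_norm k (Xs ! j - Ys ! j)) {..<n} \<le> (\<Sum>j<n. hs_norm k (Xs ! j - Ys ! j))"
    using assms by (intro L2_set_le_sum) (auto intro!: hs_norm_nonneg minus_carrier_mat mat_tuples_nth)
  also have "\<dots> \<le> (\<Sum>j<n. c)" using assms by (intro sum_mono) auto
  finally show ?thesis by (simp add: tuple_norm2_eq[OF assms(1,2)])
qed

lemma (in unital_cstar_algebra) reps_restrict:
  assumes "\<phi> \<in> unital_star_hom A (mat_calg k)"
  shows "restrict \<phi> (carrier A) \<in> reps A k"
proof -
  have hom: "\<phi> \<in> Ring.ring_hom A (mat_calg k)" using assms by (simp add: unital_star_hom_def)
  have "restrict \<phi> (carrier A) \<in> Ring.ring_hom A (mat_calg k)"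
    by (rule ring_hom_memI) (use ring_hom_closed[OF hom] ring_hom_mult[OF hom] ring_hom_add[OF hom] ring_hom_one[OF hom] in auto)
  thus ?thesis using assms star_closed by (auto simp: reps_def unital_star_hom_def)
qed

text \<open>A number \<open>m\<close> misses some \<open>E n\<close>, so the complement of \<open>{m}\<close> belongs to the ultrafilter; hence so does every
cofinite set.\<close>

lemma nontrivial_ultrafilter_nat_le_sequentially:
  assumes "nontrivial_ultrafilter J (\<beta> :: nat filter)"
  shows "\<beta> \<le> sequentially"
proof -
  obtain E :: "nat \<Rightarrow> nat set" where E: "\<And>n. eventually (\<lambda>i. i \<in> E n) \<beta>" and E0: "(\<Inter>n. E n) = {}"
    using assms by (auto simp: nontrivial_ultrafilter_def)
  have ne: "eventually (\<lambda>i. i \<noteq> m) \<beta>" for m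
  proof -
    obtain n where "m \<notin> E n" using E0 by blast
    show ?thesis using E[of n] by eventually_elim (use \<open>m \<notin> E n\<close> in blast)
  qed
  have "eventually (\<lambda>i. N \<le> i) \<beta>" for N
  proof -
    have "eventually (\<lambda>i. \<forall>m\<in>{..<N}. i \<noteq> m) \<beta>"
      using ne by (intro eventually_ball_finite) auto
    thus ?thesis by eventually_elim (auto simp: not_less[symmetric])
  qed
  thus ?thesis
    by (intro filter_leI) (metis (mono_tags, lifting) eventually_sequentially eventually_mono)
qed

lemma nontrivial_ultrafilter_filtermap:
  assumes b: "nontrivial_ultrafilter J \<beta>" and f: "inj f"
  shows "nontrivial_ultrafilter (f ` J) (filtermap f \<beta>)"
proof -
  obtain E :: "nat \<Rightarrow> 'a set" where E: "\<And>n. eventually (\<lambda>i. i \<in> E n) \<beta>" and E0: "(\<Inter>n. E n) = {}"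
    using b by (auto simp: nontrivial_ultrafilter_def)
  have "(\<Inter>n. f ` E n) = {}" using E0 image_INT[of f UNIV UNIV E 0] f by simp
  moreover have "eventually (\<lambda>i. i \<in> f ` E n) (filtermap f \<beta>)" for n
    unfolding eventually_filtermap using E[of n] by eventually_elim auto
  moreover have "infinite (f ` J)"
    using b f finite_imageD[of f J] by (auto simp: nontrivial_ultrafilter_def inj_on_def)
  moreover have "ultrafilter_on (f ` J) (filtermap f \<beta>)"
    using b unfolding nontrivial_ultrafilter_def ultrafilter_on_def eventually_filtermap filtermap_bot_iff
    by (auto elim: eventually_mono)
  ultimately show ?thesis
    unfolding nontrivial_ultrafilter_def by (intro conjI exI[of _ "\<lambda>n. f ` E n"]) auto
qed

text \<open>Otherwise there are, for every \<open>m\<close>, microstates of quality \<open>m\<close> and size greater than \<open>m\<close> that are \<open>\<omega>\<close>-far from all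
representations. Embeddability provides a nontrivial ultrafilter on the naturals, which an injection carries over to the
index type of the stability assumption. The resulting homomorphism into the ultraproduct lifts, and the lifts are representations
with \<open>\<phi> i (xs ! j)\<close> eventually close to \<open>X i ! j\<close>.\<close>

theorem microstates_near_reps:
  fixes A :: "'a calg"
  assumes A: "unital_cstar_algebra A" and xs: "set xs \<subseteq> carrier A"
    and gen: "cstar_generated A (set xs) = carrier A"
    and stable: "matricially_tracially_stable TYPE('i::infinite) A"
    and trace: "tracial_state A \<tau>" and emb: "embeddable A \<tau>"
    and R: "\<forall>x\<in>set xs. cnorm A x < R" and \<omega>: "0 < \<omega>"
  obtains \<epsilon> N K where "0 < \<epsilon>"
    "\<And>k Xs. K \<le> k \<Longrightarrow> Xs \<in> microstates A \<tau> R xs N k \<epsilon> \<Longrightarrow>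
      \<exists>\<phi>\<in>reps A k. tuple_norm2 k (map2 (-) Xs (map \<phi> xs)) < \<omega>"
proof (rule ccontr)
  assume contr: "\<not> thesis"
  interpret unital_cstar_algebra A by (rule A)
  let ?n = "length xs"
  have "\<exists>k Xs. Suc m \<le> k \<and> Xs \<in> microstates A \<tau> R xs m k (inverse (real (Suc m))) \<and>
      (\<forall>\<phi>\<in>reps A k. \<not> tuple_norm2 k (map2 (-) Xs (map \<phi> xs)) < \<omega>)" for m
    using contr that[of "inverse (real (Suc m))" "Suc m" m] by (metis inverse_positive_iff_positive of_nat_0_less_iff zero_less_Suc)
  then obtain \<kappa> \<Xi> where \<kappa>: "\<And>m. Suc m \<le> \<kappa> m"
    and \<Xi>: "\<And>m. \<Xi> m \<in> microstates A \<tau> R xs m (\<kappa> m) (inverse (real (Suc m)))"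
    and far: "\<And>m \<phi>. \<phi> \<in> reps A (\<kappa> m) \<Longrightarrow> \<not> tuple_norm2 (\<kappa> m) (map2 (-) (\<Xi> m) (map \<phi> xs)) < \<omega>"
    by metis
  obtain \<beta> where \<beta>: "nontrivial_ultrafilter {1::nat..} \<beta>" using emb by (auto simp: embeddable_def)
  obtain f :: "nat \<Rightarrow> 'i" where f: "inj f"
    using infinite_countable_subset[of "UNIV :: 'i set"] infinite_UNIV by blast
  define I where "I = f ` {1..}"
  define \<alpha> where "\<alpha> = filtermap f \<beta>"
  have \<alpha>: "nontrivial_ultrafilter I \<alpha>"
    unfolding I_def \<alpha>_def by (rule nontrivial_ultrafilter_filtermap[OF \<beta> f])
  \<comment> \<open>Outside \<open>I\<close> the net is filled up with zero matrices of size 1.\<close>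
  define k where "k i = (if i \<in> I then \<kappa> (inv_into UNIV f i) else 1)" for i
  define X where "X i = (if i \<in> I then \<Xi> (inv_into UNIV f i) else replicate ?n (0\<^sub>m 1 1))" for i
  have kf: "k (f m) = \<kappa> m" and Xf: "X (f m) = \<Xi> m" if "1 \<le> m" for m
    using that f by (auto simp: k_def X_def I_def)
  have evN: "eventually (\<lambda>m. N \<le> m) \<beta>" for N
    using nontrivial_ultrafilter_nat_le_sequentially[OF \<beta>] eventually_ge_at_top[of N] by (simp add: filter_leD)
  interpret microstate_net I \<alpha> k A \<tau> xs X R
  proof
    show "ultrafilter_on I \<alpha>" using \<alpha> by (simp add: nontrivial_ultrafilter_def)
    show "nontrivial_ultrafilter I \<alpha>" by (rule \<alpha>)
    show "tracial_state A \<tau>" "set xs \<subseteq> carrier A" "cstar_generated A (set xs) = carrier A"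
      by (rule trace xs gen)+
    fix i
    show "0 < k i" using \<kappa>[of "inv_into UNIV f i"] by (simp add: k_def)
    show "X i \<in> mat_tuples ?n (k i)"
      using \<Xi>[of "inv_into UNIV f i"] by (auto simp: X_def k_def microstates_def mat_tuples_def)
    fix Y assume Y: "Y \<in> set (X i)"
    show "op_norm Y \<le> R"
    proof (cases "i \<in> I")
      case True
      thus ?thesis using Y \<Xi>[of "inv_into UNIV f i"] by (auto simp: X_def microstates_def)
    next
      case False
      hence "xs \<noteq> []" "Y = 0\<^sub>m 1 1" using Y by (auto simp: X_def)
      moreover have "0 \<le> R"
      proof -
        have x: "hd xs \<in> set xs" using \<open>xs \<noteq> []\<close> by simp
        thus ?thesis using R xs cnorm_nonneg[of "hd xs"] by force
      qed
      ultimately show ?thesis by (simp add: op_norm_zero)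
    qed
  next
    fix w assume w: "valid_word ?n w"
    let ?g = "\<lambda>m. ntrace (\<kappa> m) (monomial_val (mat_calg (\<kappa> m)) (\<Xi> m) w)"
    have "(?g \<longlongrightarrow> \<tau> (monomial_val A xs w)) sequentially"
    proof (rule Lim_transform_bound[OF _ LIMSEQ_inverse_real_of_nat, THEN LIM_zero_cancel])
      show "eventually (\<lambda>m. norm (?g m - \<tau> (monomial_val A xs w)) \<le> norm (inverse (real (Suc m)))) sequentially"
        using eventually_ge_at_top[of "length w"]
      proof eventually_elim
        case (elim m)
        have "w \<in> star_monomials ?n m" using w elim by (auto simp: star_monomials_def valid_word_def)
        hence "cmod (\<tau> (monomial_val A xs w) - ?g m) < inverse (real (Suc m))"
          using \<Xi>[of m] by (auto simp: microstates_def)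
        thus ?case by (simp add: norm_minus_commute)
      qed
    qed
    hence "(?g \<longlongrightarrow> \<tau> (monomial_val A xs w)) \<beta>"
      by (rule tendsto_mono[OF nontrivial_ultrafilter_nat_le_sequentially[OF \<beta>]])
    moreover have "eventually (\<lambda>m. ?g m = ntrace (k (f m)) (monomial_val (mat_calg (k (f m))) (X (f m)) w)) \<beta>"
      using evN[of 1] by eventually_elim (simp add: kf Xf)
    ultimately show "((\<lambda>i. ntrace (k i) (monomial_val (mat_calg (k i)) (X i) w)) \<longlongrightarrow> \<tau> (monomial_val A xs w)) \<alpha>"
      unfolding \<alpha>_def filterlim_filtermap using tendsto_cong by fast
  qed
  have "approximately_liftable A I \<alpha> (\<lambda>i. mat_calg (k i)) (\<lambda>i. ntrace (k i)) limit_hom"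
    using stable[unfolded matricially_tracially_stable_def, rule_format, OF \<alpha> _ limit_hom]
      k_pos tracial_state_ntrace by blast
  then obtain E \<phi> where E: "E \<subseteq> I" "eventually (\<lambda>i. i \<in> E) \<alpha>"
    and \<phi>: "\<And>i. i \<in> E \<Longrightarrow> \<phi> i \<in> unital_star_hom A (mat_calg (k i))"
    and lift: "\<And>a. a \<in> carrier A \<Longrightarrow> limit_hom a = ultra_coset I \<alpha> (\<lambda>i. mat_calg (k i)) (\<lambda>i. ntrace (k i))
        (\<lambda>i\<in>I. if i \<in> E then \<phi> i a else \<zero>\<^bsub>mat_calg (k i)\<^esub>)"
    unfolding approximately_liftable_def by blast
  define Y where "Y j i = (if i \<in> E then \<phi> i (xs ! j) else 0\<^sub>m (k i) (k i))" for j i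
  have gens: "xs ! j \<in> carrier A" if "j < ?n" for j using xs that nth_mem by blast
  have \<phi>c: "\<phi> i a \<in> carrier_mat (k i) (k i)" if "i \<in> E" "a \<in> carrier A" for i a
    using \<phi>[OF that(1)] ring_hom_closed[of "\<phi> i" A "mat_calg (k i)" a] that by (simp add: unital_star_hom_def)
  have bY: "bounded_family (Y j)" if "j < ?n" for j
  proof (rule bounded_familyI[where C = "cnorm A (xs ! j)"])
    fix i
    show "Y j i \<in> carrier_mat (k i) (k i)" using \<phi>c gens[OF that] by (auto simp: Y_def)
    show "op_norm (Y j i) \<le> cnorm A (xs ! j)"
      using rep_contractive[OF \<phi> gens[OF that]] cnorm_nonneg[OF gens[OF that]] by (auto simp: Y_def op_norm_zero)
  qed
  have bX: "bounded_family (\<lambda>i. X i ! j)" if "j < ?n" for j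
    by (rule pol_bounded[OF pol_gen[OF that]])
  have lim: "((\<lambda>i. hs_norm (k i) (X i ! j - Y j i)) \<longlongrightarrow> 0) \<alpha>" if "j < ?n" for j
  proof -
    have "coset_of (\<lambda>i. X i ! j) = coset_of (Y j)"
      unfolding limit_hom_generator[OF that, symmetric] lift[OF gens[OF that]] coset_of_def Y_def
      by (simp cong: if_cong)
    thus ?thesis using coset_of_eq_iff[OF bX[OF that] bY[OF that]] by simp
  qed
  define \<eta> where "\<eta> = \<omega> / (real ?n + 1)"
  have \<eta>: "0 < \<eta>" using \<omega> by (simp add: \<eta>_def)
  have "eventually (\<lambda>i. \<forall>j\<in>{..<?n}. hs_norm (k i) (X i ! j - Y j i) < \<eta>) \<alpha>"
    using order_tendstoD(2)[OF lim \<eta>] by (intro eventually_ball_finite) auto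
  with E(2) eventually_I have "eventually (\<lambda>i. i \<in> I \<and> i \<in> E \<and> (\<forall>j<?n. hs_norm (k i) (X i ! j - Y j i) < \<eta>)) \<alpha>"
    by eventually_elim auto
  then obtain i where i: "i \<in> I" "i \<in> E" "\<forall>j<?n. hs_norm (k i) (X i ! j - Y j i) < \<eta>"
    using eventually_happens'[OF alpha_nbot] by blast
  then obtain m where m: "i = f m" "1 \<le> m" by (auto simp: I_def)
  define \<psi> where "\<psi> = restrict (\<phi> i) (carrier A)"
  have \<psi>: "\<psi> \<in> reps A (\<kappa> m)"
    using reps_restrict[OF \<phi>[OF i(2)]] kf[OF m(2)] unfolding \<psi>_def m(1) by simp
  have \<psi>Y: "map \<psi> xs ! j = Y j i" if "j < ?n" for j
    using that i(2) gens[OF that] by (simp add: \<psi>_def Y_def)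
  have "map \<psi> xs \<in> mat_tuples ?n (k i)"
    using \<phi>c[OF i(2)] xs by (auto simp: mat_tuples_def \<psi>_def)
  hence "tuple_norm2 (k i) (map2 (-) (X i) (map \<psi> xs)) \<le> ?n * \<eta>"
    by (intro tuple_norm2_le[OF X_tuple]) (use i(3) \<psi>Y in \<open>auto intro: less_imp_le\<close>)
  also have "\<dots> < \<omega>" using \<omega> by (simp add: \<eta>_def field_simps)
  finally show False using far[OF \<psi>] kf[OF m(2)] Xf[OF m(2)] unfolding m(1) by simp
qed


section \<open>Counting representations\<close>

text \<open>With \<open>D = U - V\<close>, the difference is \<open>D a U* + V a D*\<close>.\<close>

lemma hs_norm_conj_diff:
  assumes U: "U \<in> unitary_mats k" and V: "V \<in> unitary_mats k"
    and a: "a \<in> carrier_mat k k" and r: "op_norm a \<le> r"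
  shows "hs_norm k (U * a * mat_adjoint U - V * a * mat_adjoint V) \<le> 2 * r * hs_norm k (U - V)"
proof -
  note Uc = unitary_matsD(1)[OF U] and Vc = unitary_matsD(1)[OF V]
  note U1 = op_norm_unitary[OF unitary_mats_adjoint[OF U]] and V1 = op_norm_unitary[OF V]
  define D where "D = U - V"
  have D: "D \<in> carrier_mat k k" unfolding D_def by (rule minus_carrier_mat[OF Vc])
  have Da: "mat_adjoint D \<in> carrier_mat k k" using D by auto
  have Ua: "mat_adjoint U \<in> carrier_mat k k" using Uc by auto
  have Va: "mat_adjoint V \<in> carrier_mat k k" using Vc by auto
  have DaE: "mat_adjoint D = mat_adjoint U - mat_adjoint V"
    unfolding D_def by (rule mat_adjoint_minus[OF Uc Vc])
  have "D * a * mat_adjoint U + V * a * mat_adjoint D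
      = (U * a * mat_adjoint U - V * a * mat_adjoint U) + (V * a * mat_adjoint U - V * a * mat_adjoint V)"
    unfolding DaE unfolding D_def using Uc Vc Ua Va a
    by (simp add: minus_mult_distrib_mat[of _ k k _ _ k] mult_minus_distrib_mat[of _ k k _ k] square_mult_closed[of _ k])
  also have "\<dots> = U * a * mat_adjoint U - V * a * mat_adjoint V"
    using Uc Vc a by (intro eq_matI) (auto simp del: index_mult_mat(1))
  finally have eq: "U * a * mat_adjoint U - V * a * mat_adjoint V = D * a * mat_adjoint U + V * a * mat_adjoint D" ..
  have DaC: "D * a \<in> carrier_mat k k" and VaC: "V * a \<in> carrier_mat k k"
    using D Vc a by auto
  have 1: "hs_norm k (D * a * mat_adjoint U) \<le> hs_norm k D * r"
  proof -
    have "hs_norm k (D * a * mat_adjoint U) \<le> hs_norm k (D * a) * op_norm (mat_adjoint U)"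
      by (rule hs_norm_mult_right[OF DaC Ua])
    also have "\<dots> \<le> hs_norm k (D * a) * 1" by (rule mult_left_mono[OF U1 hs_norm_nonneg[OF DaC]])
    also have "\<dots> \<le> hs_norm k D * op_norm a" using hs_norm_mult_right[OF D a] by simp
    also have "\<dots> \<le> hs_norm k D * r" by (rule mult_left_mono[OF r hs_norm_nonneg[OF D]])
    finally show ?thesis .
  qed
  have 2: "hs_norm k (V * a * mat_adjoint D) \<le> r * hs_norm k D"
  proof -
    have "hs_norm k (V * a * mat_adjoint D) \<le> op_norm (V * a) * hs_norm k (mat_adjoint D)"
      by (rule hs_norm_mult_left[OF VaC Da])
    also have "op_norm (V * a) \<le> op_norm V * op_norm a" by (rule op_norm_mult[OF Vc a])
    also have "op_norm V * op_norm a \<le> 1 * r" by (intro mult_mono V1 r) auto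
    finally show ?thesis using hs_norm_adjoint[OF D] hs_norm_nonneg[OF D] by (simp add: mult_right_mono)
  qed
  have "hs_norm k (U * a * mat_adjoint U - V * a * mat_adjoint V)
      \<le> hs_norm k (D * a * mat_adjoint U) + hs_norm k (V * a * mat_adjoint D)"
    unfolding eq by (rule hs_norm_add) (use DaC VaC Ua Da in auto)
  thus ?thesis using 1 2 by (simp add: D_def algebra_simps)
qed

lemma covering_number_le:
  assumes "C \<subseteq> mat_tuples n k" "S \<subseteq> (\<Union>Ys\<in>C. tuple_ball n k Ys \<omega>)" "finite C"
  shows "covering_number n k S \<omega> \<le> enat (card C)"
  unfolding covering_number_def using assms
  by (intro INF_lower2[of C]) (auto simp: ecard_def)

context unital_cstar_algebra
begin

lemma reps_closed:
  assumes "\<phi> \<in> reps A k" "a \<in> carrier A"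
  shows "\<phi> a \<in> carrier_mat k k" "op_norm (\<phi> a) \<le> cnorm A a"
  using assms rep_contractive[of \<phi> k a] ring_hom_closed[of \<phi> A "mat_calg k" a]
  by (auto simp: reps_def unital_star_hom_def)

lemma unitary_equiv_refl:
  assumes "\<phi> \<in> reps A k"
  shows "(\<phi>, \<phi>) \<in> unitary_equiv A k"
proof -
  have "1\<^sub>m k \<in> unitary_mats k" by (simp add: unitary_mats_iff)
  moreover have "\<phi> a = 1\<^sub>m k * \<phi> a * mat_adjoint (1\<^sub>m k)" if "a \<in> carrier A" for a
    using reps_closed(1)[OF assms that] by (simp add: left_mult_one_mat[of _ k k] right_mult_one_mat[of _ k k])
  ultimately show ?thesis using assms unfolding unitary_equiv_def by blast
qed

lemma unitary_equiv_transversal: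
  assumes fin: "finite (reps A k // unitary_equiv A k)"
  obtains T where "finite T" "card T \<le> card (reps A k // unitary_equiv A k)" "T \<subseteq> reps A k"
    "\<And>\<phi>. \<phi> \<in> reps A k \<Longrightarrow> \<exists>\<psi>\<in>T. \<exists>U\<in>unitary_mats k. \<forall>a\<in>carrier A. \<phi> a = U * \<psi> a * mat_adjoint U"
proof -
  define s where "s c = (SOME \<psi>. \<psi> \<in> reps A k \<and> c = unitary_equiv A k `` {\<psi>})" for c
  have s: "s c \<in> reps A k \<and> c = unitary_equiv A k `` {s c}" if "c \<in> reps A k // unitary_equiv A k" for c
  proof -
    have "\<exists>\<psi>. \<psi> \<in> reps A k \<and> c = unitary_equiv A k `` {\<psi>}" using that by (auto simp: quotient_def)
    thus ?thesis unfolding s_def by (rule someI_ex)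
  qed
  show ?thesis
  proof (rule that[of "s ` (reps A k // unitary_equiv A k)"])
    show "finite (s ` (reps A k // unitary_equiv A k))" using fin by simp
    show "card (s ` (reps A k // unitary_equiv A k)) \<le> card (reps A k // unitary_equiv A k)"
      by (rule card_image_le[OF fin])
    show "s ` (reps A k // unitary_equiv A k) \<subseteq> reps A k" using s by auto
    fix \<phi> assume \<phi>: "\<phi> \<in> reps A k"
    define c where "c = unitary_equiv A k `` {\<phi>}"
    have c: "c \<in> reps A k // unitary_equiv A k" using \<phi> by (auto simp: c_def quotient_def)
    have "\<phi> \<in> c" using unitary_equiv_refl[OF \<phi>] by (simp add: c_def)
    hence "(s c, \<phi>) \<in> unitary_equiv A k" using s[OF c] by blast
    thus "\<exists>\<psi>\<in>s ` (reps A k // unitary_equiv A k). \<exists>U\<in>unitary_mats k. \<forall>a\<in>carrier A. \<phi> a = U * \<psi> a * mat_adjoint U"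
      using c by (auto simp: unitary_equiv_def)
  qed
qed

text \<open>Take one representation from each class and one unitary from a \<open>4 \<delta>\<close>-net of \<open>U(k)\<close>. Conjugating a tuple of \<open>n\<close> matrices
of norm at most \<open>|r|\<close> by unitaries at distance \<open>4 \<delta>\<close> moves it by at most \<open>n * 2 |r| * 4 \<delta>\<close>, which is less than \<open>\<omega>\<close> for
\<open>\<delta> = \<omega> / (8 n |r| + 8)\<close>. Adding the distance to the nearest representation gives the radius \<open>2 \<omega>\<close>; adding 8 keeps \<open>\<delta>\<close> below 1
and the denominator positive.\<close>

lemma covering_by_orbits:
  fixes \<omega> r :: real
  assumes k: "0 < k" and xs: "set xs \<subseteq> carrier A" and r: "\<forall>x\<in>set xs. cnorm A x < r"
    and \<omega>: "0 < \<omega>" "\<omega> \<le> 1"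
    and fin: "finite (reps A k // unitary_equiv A k)"
    and S: "S \<subseteq> mat_tuples (length xs) k"
    and near: "\<And>Xs. Xs \<in> S \<Longrightarrow> \<exists>\<phi>\<in>reps A k. tuple_norm2 k (map2 (-) Xs (map \<phi> xs)) < \<omega>"
  obtains m where "covering_number (length xs) k S (2 * \<omega>) \<le> enat m"
    "real m \<le> real (card (reps A k // unitary_equiv A k)) * (18 * (8 * real (length xs) * \<bar>r\<bar> + 8) / \<omega>) ^ k\<^sup>2"
proof -
  let ?n = "length xs"
  define C0 where "C0 = 8 * real ?n * \<bar>r\<bar> + 8"
  have C0: "8 \<le> C0" by (simp add: C0_def)
  define \<delta> where "\<delta> = \<omega> / C0"
  have \<delta>: "0 < \<delta>" "\<delta> \<le> 1" using \<omega> C0 by (auto simp: \<delta>_def divide_le_eq)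
  obtain \<V> where V: "finite \<V>" "\<V> \<subseteq> unitary_mats k" "real (card \<V>) \<le> (18 / \<delta>) ^ k\<^sup>2"
    "\<And>U. U \<in> unitary_mats k \<Longrightarrow> \<exists>V\<in>\<V>. hs_norm k (U - V) \<le> 4 * \<delta>"
    using unitary_cover[OF k \<delta>] by metis
  obtain T where T: "finite T" "card T \<le> card (reps A k // unitary_equiv A k)" "T \<subseteq> reps A k"
    "\<And>\<phi>. \<phi> \<in> reps A k \<Longrightarrow> \<exists>\<psi>\<in>T. \<exists>U\<in>unitary_mats k. \<forall>a\<in>carrier A. \<phi> a = U * \<psi> a * mat_adjoint U"
    using unitary_equiv_transversal[OF fin] by metis
  define c :: "('a \<Rightarrow> complex mat) \<times> complex mat \<Rightarrow> complex mat list"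
    where "c = (\<lambda>(\<psi>, V). map (\<lambda>x. V * \<psi> x * mat_adjoint V) xs)"
  have c_tup: "c (\<psi>, V) \<in> mat_tuples ?n k" if "\<psi> \<in> reps A k" "V \<in> unitary_mats k" for \<psi> V
    using reps_closed(1)[OF that(1)] unitary_matsD(1)[OF that(2)] xs
    by (auto simp: c_def mat_tuples_def intro!: square_mult_closed)
  show ?thesis
  proof (rule that)
    show "covering_number ?n k S (2 * \<omega>) \<le> enat (card (c ` (T \<times> \<V>)))"
    proof (rule covering_number_le)
      show "c ` (T \<times> \<V>) \<subseteq> mat_tuples ?n k" using T(3) V(2) c_tup by auto
      show "finite (c ` (T \<times> \<V>))" using T V by simp
      show "S \<subseteq> (\<Union>Ys\<in>c ` (T \<times> \<V>). tuple_ball ?n k Ys (2 * \<omega>))"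
      proof
        fix Xs assume Xs: "Xs \<in> S"
        obtain \<phi> where \<phi>: "\<phi> \<in> reps A k" "tuple_norm2 k (map2 (-) Xs (map \<phi> xs)) < \<omega>" using near[OF Xs] by blast
        obtain \<psi> U where \<psi>: "\<psi> \<in> T" and U: "U \<in> unitary_mats k"
          and \<phi>U: "\<forall>a\<in>carrier A. \<phi> a = U * \<psi> a * mat_adjoint U" using T(4)[OF \<phi>(1)] by blast
        have \<psi>r: "\<psi> \<in> reps A k" using \<psi> T(3) by blast
        obtain V where VV: "V \<in> \<V>" "hs_norm k (U - V) \<le> 4 * \<delta>" using V(4)[OF U] by blast
        have Vu: "V \<in> unitary_mats k" using VV V(2) by blast
        have t: "map \<phi> xs \<in> mat_tuples ?n k" using reps_closed(1)[OF \<phi>(1)] xs by (auto simp: mat_tuples_def)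
        have ct: "c (\<psi>, V) \<in> mat_tuples ?n k" by (rule c_tup[OF \<psi>r Vu])
        have "tuple_norm2 k (map2 (-) (map \<phi> xs) (c (\<psi>, V))) \<le> ?n * (2 * \<bar>r\<bar> * (4 * \<delta>))"
        proof (rule tuple_norm2_le[OF t ct])
          fix j assume j: "j < ?n"
          have xj: "xs ! j \<in> carrier A" "cnorm A (xs ! j) < r" using xs r j nth_mem by blast+
          have "op_norm (\<psi> (xs ! j)) \<le> \<bar>r\<bar>" using reps_closed(2)[OF \<psi>r xj(1)] xj(2) by linarith
          hence "hs_norm k (U * \<psi> (xs ! j) * mat_adjoint U - V * \<psi> (xs ! j) * mat_adjoint V) \<le> 2 * \<bar>r\<bar> * hs_norm k (U - V)"
            by (rule hs_norm_conj_diff[OF U Vu reps_closed(1)[OF \<psi>r xj(1)]])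
          also have "\<dots> \<le> 2 * \<bar>r\<bar> * (4 * \<delta>)" using VV by (intro mult_left_mono) auto
          finally show "hs_norm k (map \<phi> xs ! j - c (\<psi>, V) ! j) \<le> 2 * \<bar>r\<bar> * (4 * \<delta>)"
            using j \<phi>U xj by (simp add: c_def)
        qed
        also have "\<dots> < \<omega>"
        proof -
          have "?n * (2 * \<bar>r\<bar> * (4 * \<delta>)) = (C0 - 8) * \<delta>" by (simp add: C0_def)
          also have "\<dots> < C0 * \<delta>" using \<delta> by simp
          also have "\<dots> = \<omega>" using C0 by (simp add: \<delta>_def)
          finally show ?thesis .
        qed
        finally have "tuple_norm2 k (map2 (-) Xs (c (\<psi>, V))) < 2 * \<omega>"
          using tuple_norm2_triangle[of Xs ?n k "map \<phi> xs" "c (\<psi>, V)"] t ct Xs S \<phi>(2) by fastforce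
        moreover have "c (\<psi>, V) \<in> c ` (T \<times> \<V>)" using \<psi> VV by blast
        ultimately show "Xs \<in> (\<Union>Ys\<in>c ` (T \<times> \<V>). tuple_ball ?n k Ys (2 * \<omega>))"
          using Xs S unfolding tuple_ball_def by blast
      qed
    qed
    have "card (c ` (T \<times> \<V>)) \<le> card T * card \<V>"
      using card_image_le[of "T \<times> \<V>" c] T V by (simp add: card_cartesian_product)
    hence "real (card (c ` (T \<times> \<V>))) \<le> real (card T) * real (card \<V>)" by (metis of_nat_le_iff of_nat_mult)
    also have "\<dots> \<le> real (card (reps A k // unitary_equiv A k)) * (18 / \<delta>) ^ k\<^sup>2"
      using T(2) V(3) by (intro mult_mono) auto
    finally show "real (card (c ` (T \<times> \<V>))) \<le> real (card (reps A k // unitary_equiv A k)) * (18 * (8 * real ?n * \<bar>r\<bar> + 8) / \<omega>) ^ k\<^sup>2"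
      by (simp add: \<delta>_def C0_def)
  qed
qed

end

lemma elog_mono: "m \<le> n \<Longrightarrow> elog m \<le> elog n"
  by (cases m; cases n) (auto simp: elog_def)

lemma elog_le_exp:
  assumes "real m \<le> exp x"
  shows "elog (enat m) \<le> ereal x"
proof (cases "m = 0")
  case False
  hence "ln (real m) \<le> ln (exp x)" using assms by (subst ln_le_cancel_iff) auto
  thus ?thesis using False by (simp add: elog_def)
qed (simp add: elog_def)

text \<open>For \<open>0 < k\<close> the quotient is \<^term>\<open>\<infinity> :: ereal\<close> when \<open>m\<close> is infinite, so the bound also gives finiteness.\<close>

lemma elog_lessD:
  assumes "elog m / ereal (real k ^ 2) < ereal M" "0 < k"
  obtains n where "m = enat n" "real n \<le> exp (M * real k ^ 2)"
proof (cases m)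
  case (enat n)
  have "real n \<le> exp (M * real k ^ 2)"
  proof (cases "n = 0")
    case False
    hence "ln (real n) < M * real k ^ 2"
      using assms enat by (simp add: elog_def divide_less_eq)
    hence "exp (ln (real n)) \<le> exp (M * real k ^ 2)" by simp
    thus ?thesis using False by simp
  qed simp
  thus ?thesis using that enat by blast
next
  case infinity
  thus ?thesis using assms by (simp add: elog_def)
qed

lemma entropy_rate_tendsto_one:
  "((\<lambda>\<omega>. (M + ln (c / \<omega>)) / \<bar>ln \<omega>\<bar>) \<longlongrightarrow> 1) (at_right 0)" if c: "0 < c" for M c :: real
proof -
  have ln0: "filterlim (\<lambda>x. - ln x) at_top (at_right (0::real))"
    using ln_at_0 by (simp add: filterlim_uminus_at_top)
  have "((\<lambda>\<omega>. (M + ln c) / (- ln \<omega>) + 1) \<longlongrightarrow> 0 + 1) (at_right (0::real))"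
    by (intro tendsto_add tendsto_const tendsto_divide_0[OF tendsto_const] filterlim_at_top_imp_at_infinity ln0)
  moreover have "eventually (\<lambda>\<omega>. (M + ln c) / (- ln \<omega>) + 1 = (M + ln (c / \<omega>)) / \<bar>ln \<omega>\<bar>) (at_right (0::real))"
  proof -
    have "eventually (\<lambda>\<omega>::real. \<omega> \<in> {0<..<1}) (at_right 0)"
      by (rule eventually_at_right_real) simp
    thus ?thesis
    proof eventually_elim
      case (elim \<omega>)
      hence neg: "ln \<omega> < 0" by simp
      have "M + ln (c / \<omega>) = (M + ln c) + (- ln \<omega>)" using c elim by (simp add: ln_div)
      hence "(M + ln (c / \<omega>)) / \<bar>ln \<omega>\<bar> = ((M + ln c) + (- ln \<omega>)) / (- ln \<omega>)"
        using neg by (simp only: abs_of_neg)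
      also have "\<dots> = (M + ln c) / (- ln \<omega>) + 1" using neg by (simp only: add_divide_distrib) simp
      finally show ?case ..
    qed
  qed
  ultimately show ?thesis by (simp add: tendsto_cong)
qed

text \<open>A bound \<open>M\<close> on the growth rate is played against \<open>microstates_near_reps\<close> at radius \<open>\<omega> / 2\<close>: the
microstates are covered by balls of radius \<open>\<omega>\<close>, the extra factor 2 being absorbed into \<open>C = 2 * 18 * (8 n |R| + 8)\<close>.\<close>

theorem theorem4p2:
  fixes A :: "'a calg" and xs :: "'a list" and \<tau> :: "'a \<Rightarrow> complex" and R :: real
  assumes "unital_cstar_algebra A"
    and "set xs \<subseteq> carrier A"
    and "cstar_generated A (set xs) = carrier A"
    and "matricially_tracially_stable TYPE('i::infinite) A"
    and "tracial_state A \<tau>"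
    and "embeddable A \<tau>"
    and "\<forall>x\<in>set xs. cnorm A x < R"
    and "1 < free_entropy_dim A \<tau> R xs"
  shows "limsup (\<lambda>k. elog (ecard (reps A k // unitary_equiv A k)) / ereal ((real k)\<^sup>2)) = \<infinity>"
proof (rule ccontr)
  interpret unital_cstar_algebra A by (rule assms(1))
  let ?n = "length xs"
  let ?card = "\<lambda>k. ecard (reps A k // unitary_equiv A k)"
  assume "limsup (\<lambda>k. elog (?card k) / ereal ((real k)\<^sup>2)) \<noteq> \<infinity>"
  hence "limsup (\<lambda>k. elog (?card k) / ereal ((real k)\<^sup>2)) < \<infinity>" by simp
  then obtain M :: nat where "limsup (\<lambda>k. elog (?card k) / ereal ((real k)\<^sup>2)) < ereal (real M)"
    using less_PInf_Ex_of_nat by auto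
  hence "eventually (\<lambda>k. elog (?card k) / ereal ((real k)\<^sup>2) < ereal (real M)) sequentially"
    by (rule Limsup_lessD)
  then obtain K0 where K0: "\<And>k. K0 \<le> k \<Longrightarrow> elog (?card k) / ereal ((real k)\<^sup>2) < ereal (real M)"
    by (auto simp: eventually_sequentially)
  define C where "C = 36 * (8 * real ?n * \<bar>R\<bar> + 8)"
  have C: "288 \<le> C" by (simp add: C_def)
  define G where "G \<omega> = (INF (\<epsilon>, N) \<in> {0<..} \<times> UNIV.
      limsup (\<lambda>k. elog (covering_number ?n k (microstates A \<tau> R xs N k \<epsilon>) \<omega>) / ereal ((real k)\<^sup>2 * \<bar>ln \<omega>\<bar>)))" for \<omega>
  have le: "G \<omega> \<le> ereal ((real M + ln (C / \<omega>)) / \<bar>ln \<omega>\<bar>)" if \<omega>: "0 < \<omega>" "\<omega> < 1" for \<omega>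
  proof -
    have \<omega>2: "0 < \<omega> / 2" using \<omega> by simp
    obtain \<epsilon> N K where \<epsilon>: "0 < \<epsilon>"
      and near: "\<And>k Xs. K \<le> k \<Longrightarrow> Xs \<in> microstates A \<tau> R xs N k \<epsilon> \<Longrightarrow>
        \<exists>\<phi>\<in>reps A k. tuple_norm2 k (map2 (-) Xs (map \<phi> xs)) < \<omega> / 2"
      using microstates_near_reps[OF assms(1-7) \<omega>2] by metis
    have lnw: "0 < \<bar>ln \<omega>\<bar>" using \<omega> by simp
    have "eventually (\<lambda>k. elog (covering_number ?n k (microstates A \<tau> R xs N k \<epsilon>) \<omega>) / ereal ((real k)\<^sup>2 * \<bar>ln \<omega>\<bar>)
        \<le> ereal ((real M + ln (C / \<omega>)) / \<bar>ln \<omega>\<bar>)) sequentially"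
      using eventually_ge_at_top[of "max 1 (max K K0)"]
    proof eventually_elim
      case (elim k)
      hence k: "0 < k" "K \<le> k" "K0 \<le> k" by auto
      obtain n where n: "?card k = enat n" "real n \<le> exp (real M * real k ^ 2)"
        using elog_lessD[OF K0[OF k(3)] k(1)] .
      have fin: "finite (reps A k // unitary_equiv A k)" "card (reps A k // unitary_equiv A k) = n"
        using n(1) by (auto simp: ecard_def split: if_splits)
      obtain m where m: "covering_number ?n k (microstates A \<tau> R xs N k \<epsilon>) (2 * (\<omega> / 2)) \<le> enat m"
        "real m \<le> real (card (reps A k // unitary_equiv A k)) * (18 * (8 * real ?n * \<bar>R\<bar> + 8) / (\<omega> / 2)) ^ k\<^sup>2"
        using covering_by_orbits[OF k(1) assms(2,7) \<omega>2 _ fin(1), of "microstates A \<tau> R xs N k \<epsilon>"] near[OF k(2)] \<omega>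
        by (auto simp: microstates_def)
      have "real m \<le> real n * (C / \<omega>) ^ k\<^sup>2" using m(2) fin(2) by (simp add: C_def)
      also have "\<dots> \<le> exp (real M * real k ^ 2) * (C / \<omega>) ^ k\<^sup>2"
        using n(2) C \<omega> by (intro mult_right_mono) auto
      also have "(C / \<omega>) ^ k\<^sup>2 = exp (ln (C / \<omega>) * real k ^ 2)"
        using C \<omega> by (simp add: exp_of_nat2_mult flip: of_nat_power)
      finally have "real m \<le> exp ((real M + ln (C / \<omega>)) * real k ^ 2)" by (simp add: exp_add distrib_right)
      hence "elog (covering_number ?n k (microstates A \<tau> R xs N k \<epsilon>) \<omega>) \<le> ereal ((real M + ln (C / \<omega>)) * real k ^ 2)"
        using elog_mono[OF m(1)] elog_le_exp by (metis order_trans nonzero_mult_div_cancel_left times_divide_eq_right zero_neq_numeral)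
      hence "elog (covering_number ?n k (microstates A \<tau> R xs N k \<epsilon>) \<omega>) / ereal ((real k)\<^sup>2 * \<bar>ln \<omega>\<bar>)
          \<le> ereal ((real M + ln (C / \<omega>)) * real k ^ 2) / ereal ((real k)\<^sup>2 * \<bar>ln \<omega>\<bar>)"
        using k lnw by (intro ereal_divide_right_mono) auto
      also have "\<dots> = ereal ((real M + ln (C / \<omega>)) / \<bar>ln \<omega>\<bar>)" using k lnw by simp
      finally show ?case .
    qed
    hence "limsup (\<lambda>k. elog (covering_number ?n k (microstates A \<tau> R xs N k \<epsilon>) \<omega>) / ereal ((real k)\<^sup>2 * \<bar>ln \<omega>\<bar>))
        \<le> ereal ((real M + ln (C / \<omega>)) / \<bar>ln \<omega>\<bar>)"
      by (rule Limsup_bounded)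
    thus ?thesis unfolding G_def using \<epsilon> by (intro INF_lower2[of "(\<epsilon>, N)"]) auto
  qed
  have "eventually (\<lambda>\<omega>. G \<omega> \<le> ereal ((real M + ln (C / \<omega>)) / \<bar>ln \<omega>\<bar>)) (at_right 0)"
    using eventually_at_right_real[of 0 1] by (auto elim!: eventually_mono intro: le)
  hence "free_entropy_dim A \<tau> R xs \<le> Limsup (at_right 0) (\<lambda>\<omega>. ereal ((real M + ln (C / \<omega>)) / \<bar>ln \<omega>\<bar>))"
    unfolding free_entropy_dim_def G_def[symmetric] by (rule Limsup_mono)
  also have "\<dots> = ereal 1"
    using entropy_rate_tendsto_one[of C "real M"] C
    by (intro lim_imp_Limsup) (auto simp: trivial_limit_at_right_real tendsto_ereal)
  finally show False using assms(8) by (simp add: one_ereal_def)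
qed

end
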